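(* Let $\Lambda$ be a compact smooth manifold without boundary, let $E^{u},E^{s}$ be smooth Banach vector bundles of finite ranks $u,s$ over $\Lambda$, let $E=E^{u}\oplus E^{s}$, and let $D\subset E$ be the set $D=\{(\theta;x,y)\in E\,|\,\|x\|_u\le 1,\ \|y\|_s\le 1\}$. If $f:D\rightarrow E$ is a continuous map and $D_{\theta}\overset{f}{\Longrightarrow}D$ holds for every $\theta\in\Lambda$, then for any $\theta\in\Lambda$ there exists $v\in D_{\theta}$ such that $f^{m}(v)\in D$ for all $m\in\mathbb{N}$.
   Context: **Banach vector bundles.** A smooth Banach vector bundle of rank $k$ over $\Lambda$ is a smooth real vector bundle $\pi:E\to\Lambda$ of (finite) rank $k$ with a fixed collection of local trivializations whose bases cover $\Lambda$, such that all transition functions $\mathbb{R}^k\to\mathbb{R}^k$ on fibers are isometries of the Euclidean norm. Hence each fiber carries a well-defined norm (the Euclidean norm read in any of these trivializations). No orientability is assumed. **Whitney sum.** Points of $E=E^u\oplus E^s$ are written $(\theta;x,y)$ with $\theta\in\Lambda$, $x\in E^u_\theta$, $y\in E^s_\theta$; $\|x\|_u$, $\|y\|_s$ are the fiber norms. $E_\theta=E^u_\theta\oplus E^s_\theta$ is the fiber over $\theta$. **Sets.** $D^-=\{(\theta;x,y)\in E\,|\,\|x\|_u=1,\|y\|_s\le1\}$, $D^+=\{(\theta;x,y)\in E\,|\,\|x\|_u\le1,\|y\|_s=1\}$, $D_\theta=D\cap E_\theta$, $D^-_\theta=D^-\cap E_\theta$, $B^u_\theta=\{x\in E^u_\theta\,|\,\|x\|_u\le1\}$.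 **Covering of $D$ by $D_\theta$.** For a continuous (not necessarily invertible) $f:D\to E$ and $\theta\in\Lambda$, $D_\theta\overset{f}{\Longrightarrow}D$ means: 1. there is a (continuous) homotopy $h_\theta:[0,1]\times D_\theta\to E$ with $h_\theta(0,\cdot)=f|_{D_\theta}$, $h_\theta([0,1]\times D_\theta^-)\cap D=\emptyset$, $h_\theta([0,1]\times D_\theta)\cap D^+=\emptyset$; and 2. (a) if $u>0$: there exist $\Theta\in\Lambda$ (possibly depending on $\theta$) and a linear map $A_\theta:E^u_\theta\to E^u_\Theta$ with $A_\theta(\partial B^u_\theta)\subset E^u_\Theta\setminus B^u_\Theta$ and $h_\theta(1,(\theta;x,y))=(\Theta;A_\theta x,0)$ for all $(\theta;x,y)\in D_\theta$; (b) if $u=0$: there exists $\Theta\in\Lambda$ with $h_\theta(1,(\theta;y))=(\Theta;0)$ for all $(\theta;y)\in D_\theta$. The condition "$f^m(v)\in D$ for all $m$" means that all successive iterates of $v$ under $f$ are defined and lie in $D$. *)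

theory Defs
  imports "HOL-Analysis.Analysis"
begin

text \<open>
  Conventions. \<open>\<real>\<^sup>n\<close> is \<^const>\<open>Euclidean_space\<close> \<open>n\<close>: sequences \<open>nat \<Rightarrow> real\<close> vanishing from
  index \<open>n\<close> on, with the product topology. Unlike \<open>real ^ 'n\<close> this admits dimension and rank
  \<open>0\<close>. The Euclidean norm of such an \<open>x\<close> is \<open>L2_set x {..<n}\<close>.
\<close>

section \<open>Smooth manifolds\<close>

text \<open>
  \<open>Ck_on n k V g\<close>: all partial derivatives of \<open>g\<close> of order at most \<open>k\<close> exist and are continuous on
  \<open>V\<close>, where \<open>V\<close> is meant to be an open subset of \<open>\<real>\<^sup>n\<close>.
\<close>

primrec Ck_on :: "nat \<Rightarrow> nat \<Rightarrow> (nat \<Rightarrow> real) set \<Rightarrow> ((nat \<Rightarrow> real) \<Rightarrow> real) \<Rightarrow> bool" where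
  "Ck_on n 0 V g \<longleftrightarrow> continuous_map (subtopology (Euclidean_space n) V) euclideanreal g"
| "Ck_on n (Suc k) V g \<longleftrightarrow>
     continuous_map (subtopology (Euclidean_space n) V) euclideanreal g \<and>
     (\<forall>i<n. \<exists>g'. (\<forall>x\<in>V. ((\<lambda>t. g (x(i := t))) has_real_derivative g' x) (at (x i))) \<and>
                 Ck_on n k V g')"

definition smooth_on :: "nat \<Rightarrow> (nat \<Rightarrow> real) set \<Rightarrow> ((nat \<Rightarrow> real) \<Rightarrow> real) \<Rightarrow> bool" where
  "smooth_on n V g \<longleftrightarrow> (\<forall>k. Ck_on n k V g)"

type_synonym 'a atlas = "('a set \<times> ('a \<Rightarrow> nat \<Rightarrow> real)) set"

definition smooth_manifold :: "nat \<Rightarrow> 'a topology \<Rightarrow> 'a atlas \<Rightarrow> bool" where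
  "smooth_manifold n M \<A> \<longleftrightarrow>
     Hausdorff_space M \<and> second_countable M \<and>
     (\<forall>(U, \<kappa>)\<in>\<A>. openin M U \<and> openin (Euclidean_space n) (\<kappa> ` U) \<and>
        homeomorphic_map (subtopology M U) (subtopology (Euclidean_space n) (\<kappa> ` U)) \<kappa>) \<and>
     \<Union>(fst ` \<A>) = topspace M \<and>
     (\<forall>(U, \<kappa>)\<in>\<A>. \<forall>(V, \<psi>)\<in>\<A>. \<forall>i<n.
        smooth_on n (\<kappa> ` (U \<inter> V)) (\<lambda>x. \<psi> (inv_into U \<kappa> x) i))"

definition smooth_fun_on :: "nat \<Rightarrow> 'a atlas \<Rightarrow> 'a set \<Rightarrow> ('a \<Rightarrow> real) \<Rightarrow> bool" where
  "smooth_fun_on n \<A> W g \<longleftrightarrow>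
     (\<forall>(U, \<kappa>)\<in>\<A>. smooth_on n (\<kappa> ` (U \<inter> W)) (\<lambda>x. g (inv_into U \<kappa> x)))"

section \<open>Banach vector bundles\<close>

text \<open>
  The fiber operations are only relevant on vectors of a common fiber. A member \<open>(U, \<phi>)\<close> of
  \<open>btriv\<close> is a local trivialization \<open>\<phi>\<close> over the base \<open>U\<close>.
\<close>

record ('a, 'e) vbundle =
  brank :: nat
  btop :: "'e topology"
  bproj :: "'e \<Rightarrow> 'a"
  badd :: "'e \<Rightarrow> 'e \<Rightarrow> 'e"
  bscale :: "real \<Rightarrow> 'e \<Rightarrow> 'e"
  bzero :: "'a \<Rightarrow> 'e"
  btriv :: "('a set \<times> ('e \<Rightarrow> 'a \<times> (nat \<Rightarrow> real))) set"

definition bover :: "('a, 'e) vbundle \<Rightarrow> 'a set \<Rightarrow> 'e set" where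
  "bover B U = {v \<in> topspace (btop B). bproj B v \<in> U}"

abbreviation bfiber :: "('a, 'e) vbundle \<Rightarrow> 'a \<Rightarrow> 'e set" where
  "bfiber B \<theta> \<equiv> bover B {\<theta>}"

definition linear_on_fiber ::
    "('a, 'e) vbundle \<Rightarrow> 'a \<Rightarrow> ('e \<Rightarrow> nat \<Rightarrow> real) \<Rightarrow> bool" where
  "linear_on_fiber B \<theta> L \<longleftrightarrow>
     (\<forall>v\<in>bfiber B \<theta>. \<forall>w\<in>bfiber B \<theta>. L (badd B v w) = (\<lambda>i. L v i + L w i)) \<and>
     (\<forall>c. \<forall>v\<in>bfiber B \<theta>. L (bscale B c v) = (\<lambda>i. c * L v i)) \<and>
     L (bzero B \<theta>) = (\<lambda>i. 0)"

text \<open>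
  Local trivializations are homeomorphisms onto \<open>U \<times> \<real>\<^sup>k\<close> over \<open>U\<close> that are linear on fibers. As
  each of them is bijective from fibers to \<open>\<real>\<^sup>k\<close>, the vector space axioms for the fibers follow.
\<close>

definition local_trivialization ::
    "'a topology \<Rightarrow> ('a, 'e) vbundle \<Rightarrow> 'a set \<Rightarrow> ('e \<Rightarrow> 'a \<times> (nat \<Rightarrow> real)) \<Rightarrow> bool" where
  "local_trivialization M B U \<phi> \<longleftrightarrow>
     openin M U \<and>
     homeomorphic_map (subtopology (btop B) (bover B U))
       (prod_topology (subtopology M U) (Euclidean_space (brank B))) \<phi> \<and>
     (\<forall>v\<in>bover B U. fst (\<phi> v) = bproj B v) \<and>
     (\<forall>\<theta>\<in>U. linear_on_fiber B \<theta> (\<lambda>v. snd (\<phi> v)))"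

definition transition ::
    "('a, 'e) vbundle \<Rightarrow> 'a set \<Rightarrow> ('e \<Rightarrow> 'a \<times> (nat \<Rightarrow> real)) \<Rightarrow> ('e \<Rightarrow> 'a \<times> (nat \<Rightarrow> real)) \<Rightarrow>
     'a \<Rightarrow> (nat \<Rightarrow> real) \<Rightarrow> nat \<Rightarrow> real" where
  "transition B U \<phi> \<psi> \<theta> x = snd (\<psi> (inv_into (bover B U) \<phi> (\<theta>, x)))"

text \<open>
  The smooth structure of a vector bundle is that given by a trivializing cover with smooth
  transition functions \<open>U \<inter> V \<rightarrow> GL(k)\<close>. By linearity the latter means that \<open>\<theta> \<mapsto> g(\<theta>) x\<close> is smooth
  for every \<open>x\<close> in \<open>\<real>\<^sup>k\<close>. Linearity of \<open>g(\<theta>)\<close> is part of \<^const>\<open>local_trivialization\<close>.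
\<close>

definition smooth_banach_bundle ::
    "nat \<Rightarrow> 'a topology \<Rightarrow> 'a atlas \<Rightarrow> ('a, 'e) vbundle \<Rightarrow> bool" where
  "smooth_banach_bundle n M \<A> B \<longleftrightarrow>
     continuous_map (btop B) M (bproj B) \<and>
     (\<forall>\<theta>\<in>topspace M. bzero B \<theta> \<in> bfiber B \<theta> \<and>
        (\<forall>v\<in>bfiber B \<theta>. \<forall>w\<in>bfiber B \<theta>. badd B v w \<in> bfiber B \<theta>) \<and>
        (\<forall>c. \<forall>v\<in>bfiber B \<theta>. bscale B c v \<in> bfiber B \<theta>)) \<and>
     \<Union>(fst ` btriv B) = topspace M \<and>
     (\<forall>(U, \<phi>)\<in>btriv B. local_trivialization M B U \<phi>) \<and>
     (\<forall>(U, \<phi>)\<in>btriv B. \<forall>(V, \<psi>)\<in>btriv B.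
        (\<forall>x\<in>topspace (Euclidean_space (brank B)). \<forall>i<brank B.
           smooth_fun_on n \<A> (U \<inter> V) (\<lambda>\<theta>. transition B U \<phi> \<psi> \<theta> x i)) \<and>
        (\<forall>\<theta>\<in>U \<inter> V. \<forall>x\<in>topspace (Euclidean_space (brank B)).
           \<forall>y\<in>topspace (Euclidean_space (brank B)).
           L2_set (\<lambda>i. transition B U \<phi> \<psi> \<theta> x i - transition B U \<phi> \<psi> \<theta> y i) {..<brank B} =
           L2_set (\<lambda>i. x i - y i) {..<brank B}))"

text \<open>The fiber norm does not depend on the trivialization, see \<open>bnorm_eq\<close> below.\<close>

definition bnorm :: "('a, 'e) vbundle \<Rightarrow> 'e \<Rightarrow> real" where
  "bnorm B v = (THE r. \<exists>(U, \<phi>)\<in>btriv B. bproj B v \<in> U \<and> r = L2_set (snd (\<phi> v)) {..<brank B})"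

lemma bnorm_eq:
  assumes B: "smooth_banach_bundle n M \<A> B"
    and triv: "(U, \<phi>) \<in> btriv B" and v: "v \<in> bover B U"
  shows "bnorm B v = L2_set (snd (\<phi> v)) {..<brank B}"
proof -
  let ?k = "brank B"
  have agree: "L2_set (snd (\<psi> v)) {..<?k} = L2_set (snd (\<phi> v)) {..<?k}"
    if \<psi>: "(V, \<psi>) \<in> btriv B" and V: "bproj B v \<in> V" for V \<psi>
  proof -
    let ?\<theta> = "bproj B v"
    have lt: "local_trivialization M B U \<phi>" "local_trivialization M B V \<psi>"
      using B triv \<psi> unfolding smooth_banach_bundle_def by auto
    have \<theta>: "?\<theta> \<in> U" "?\<theta> \<in> topspace M"
      using v lt openin_subset[of M U] unfolding bover_def local_trivialization_def by auto
    have z: "bzero B ?\<theta> \<in> bfiber B ?\<theta>"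
      using B \<theta> unfolding smooth_banach_bundle_def by blast
    have zU: "bzero B ?\<theta> \<in> bover B U"
      using z \<theta> by (auto simp: bover_def)
    have sub: "bover B U \<subseteq> topspace (btop B)"
      by (auto simp: bover_def)
    have inj: "inj_on \<phi> (bover B U)"
      and im: "\<phi> ` bover B U = U \<times> topspace (Euclidean_space ?k)"
      using lt(1) homeomorphic_imp_surjective_map homeomorphic_imp_injective_map sub
      unfolding local_trivialization_def
      by (fastforce simp: Int_absorb1 dest: openin_subset)+
    have \<phi>v: "\<phi> v = (?\<theta>, snd (\<phi> v))" and \<phi>z: "\<phi> (bzero B ?\<theta>) = (?\<theta>, \<lambda>i. 0)"
      and \<psi>z: "snd (\<psi> (bzero B ?\<theta>)) = (\<lambda>i. 0)"
      using lt v z zU \<theta> V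
      unfolding local_trivialization_def linear_on_fiber_def
      by (auto simp: prod_eq_iff bover_def)
    have "\<phi> v \<in> U \<times> topspace (Euclidean_space ?k)"
      using im v by blast
    then have x: "snd (\<phi> v) \<in> topspace (Euclidean_space ?k)"
      "(\<lambda>i. 0) \<in> topspace (Euclidean_space ?k)"
      by (auto simp: topspace_Euclidean_space)
    have t: "transition B U \<phi> \<psi> ?\<theta> (snd (\<phi> v)) = snd (\<psi> v)"
      "transition B U \<phi> \<psi> ?\<theta> (\<lambda>i. 0) = (\<lambda>i. 0)"
      unfolding transition_def
      using inv_into_f_f[OF inj v] inv_into_f_f[OF inj zU] \<phi>v \<phi>z \<psi>z by auto
    have "\<forall>x\<in>topspace (Euclidean_space ?k). \<forall>y\<in>topspace (Euclidean_space ?k).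
       L2_set (\<lambda>i. transition B U \<phi> \<psi> ?\<theta> x i - transition B U \<phi> \<psi> ?\<theta> y i) {..<?k} =
       L2_set (\<lambda>i. x i - y i) {..<?k}"
      using B triv \<psi> \<theta> V unfolding smooth_banach_bundle_def by blast
    from this[rule_format, OF x] show ?thesis
      by (simp add: t)
  qed
  show ?thesis
    unfolding bnorm_def
  proof (rule the_equality)
    show "\<exists>(V, \<psi>)\<in>btriv B. bproj B v \<in> V \<and>
            L2_set (snd (\<phi> v)) {..<?k} = L2_set (snd (\<psi> v)) {..<?k}"
      using triv v by (auto simp: bover_def)
  qed (use agree in auto)
qed

definition fiber_linear ::
    "('a, 'e) vbundle \<Rightarrow> 'a \<Rightarrow> 'a \<Rightarrow> ('e \<Rightarrow> 'e) \<Rightarrow> bool" where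
  "fiber_linear B \<theta> \<Theta> A \<longleftrightarrow>
     A ` bfiber B \<theta> \<subseteq> bfiber B \<Theta> \<and>
     (\<forall>v\<in>bfiber B \<theta>. \<forall>w\<in>bfiber B \<theta>. A (badd B v w) = badd B (A v) (A w)) \<and>
     (\<forall>c. \<forall>v\<in>bfiber B \<theta>. A (bscale B c v) = bscale B c (A v))"

definition unit_ball :: "('a, 'e) vbundle \<Rightarrow> 'a \<Rightarrow> 'e set" where
  "unit_ball B \<theta> = {x \<in> bfiber B \<theta>. bnorm B x \<le> 1}"

definition unit_ball_boundary :: "('a, 'e) vbundle \<Rightarrow> 'a \<Rightarrow> 'e set" where
  "unit_ball_boundary B \<theta> = subtopology (btop B) (bfiber B \<theta>) frontier_of unit_ball B \<theta>"

section \<open>The Whitney sum and the covering relation\<close>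

text \<open>The point \<open>(\<theta>; x, y)\<close> is the pair \<open>(x, y)\<close>, and \<open>\<theta>\<close> is the common projection of \<open>x\<close> and \<open>y\<close>.\<close>

definition whitney :: "('a, 'e) vbundle \<Rightarrow> ('a, 'f) vbundle \<Rightarrow> ('e \<times> 'f) topology" where
  "whitney Eu Es =
     subtopology (prod_topology (btop Eu) (btop Es)) {(x, y). bproj Eu x = bproj Es y}"

definition Dset :: "('a, 'e) vbundle \<Rightarrow> ('a, 'f) vbundle \<Rightarrow> ('e \<times> 'f) set" where
  "Dset Eu Es = {(x, y) \<in> topspace (whitney Eu Es). bnorm Eu x \<le> 1 \<and> bnorm Es y \<le> 1}"

definition Dminus :: "('a, 'e) vbundle \<Rightarrow> ('a, 'f) vbundle \<Rightarrow> ('e \<times> 'f) set" where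
  "Dminus Eu Es = {(x, y) \<in> topspace (whitney Eu Es). bnorm Eu x = 1 \<and> bnorm Es y \<le> 1}"

definition Dplus :: "('a, 'e) vbundle \<Rightarrow> ('a, 'f) vbundle \<Rightarrow> ('e \<times> 'f) set" where
  "Dplus Eu Es = {(x, y) \<in> topspace (whitney Eu Es). bnorm Eu x \<le> 1 \<and> bnorm Es y = 1}"

definition Dfib :: "('a, 'e) vbundle \<Rightarrow> ('a, 'f) vbundle \<Rightarrow> 'a \<Rightarrow> ('e \<times> 'f) set" where
  "Dfib Eu Es \<theta> = Dset Eu Es \<inter> (bfiber Eu \<theta> \<times> bfiber Es \<theta>)"

definition Dminus_fib :: "('a, 'e) vbundle \<Rightarrow> ('a, 'f) vbundle \<Rightarrow> 'a \<Rightarrow> ('e \<times> 'f) set" where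
  "Dminus_fib Eu Es \<theta> = Dminus Eu Es \<inter> (bfiber Eu \<theta> \<times> bfiber Es \<theta>)"

definition covers ::
    "'a topology \<Rightarrow> ('a, 'e) vbundle \<Rightarrow> ('a, 'f) vbundle \<Rightarrow> ('e \<times> 'f \<Rightarrow> 'e \<times> 'f) \<Rightarrow> 'a \<Rightarrow> bool" where
  "covers M Eu Es f \<theta> \<longleftrightarrow>
     (\<exists>h :: real \<times> 'e \<times> 'f \<Rightarrow> 'e \<times> 'f.
        continuous_map
          (prod_topology (top_of_set {0..1}) (subtopology (whitney Eu Es) (Dfib Eu Es \<theta>)))
          (whitney Eu Es) h \<and>
        (\<forall>v\<in>Dfib Eu Es \<theta>. h (0, v) = f v) \<and>
        h ` ({0..1} \<times> Dminus_fib Eu Es \<theta>) \<inter> Dset Eu Es = {} \<and>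
        h ` ({0..1} \<times> Dfib Eu Es \<theta>) \<inter> Dplus Eu Es = {} \<and>
        (if brank Eu > 0 then
           (\<exists>\<Theta>\<in>topspace M. \<exists>A. fiber_linear Eu \<theta> \<Theta> A \<and>
              A ` unit_ball_boundary Eu \<theta> \<subseteq> bfiber Eu \<Theta> - unit_ball Eu \<Theta> \<and>
              (\<forall>(x, y)\<in>Dfib Eu Es \<theta>. h (1, (x, y)) = (A x, bzero Es \<Theta>)))
         else
           (\<exists>\<Theta>\<in>topspace M. \<forall>v\<in>Dfib Eu Es \<theta>. h (1, v) = (bzero Eu \<Theta>, bzero Es \<Theta>))))"

end

theory Submission
  imports Defs "HOL-Homology.Homology"
begin

text \<open>
  For \<open>u > 0\<close>, regard \<open>f\<close> as a partial map of \<open>D\<close>, defined where \<open>f v \<in> D\<close>. Since \<open>f\<close> avoids \<open>D\<^sup>+\<close> and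
  throws \<open>D\<^sup>-\<close> out of \<open>D\<close>, it becomes a pointed continuous map when \<open>D\<^sup>-\<close> is collapsed. The homotopies
  of the covering relations can then be concatenated. They deform \<open>f\<^sup>k\<close> on the unstable disc of a
  fiber to a linear isomorphism onto another fiber, restricted to the unit ball. If no point of the
  disc had \<open>k\<close> iterates in \<open>D\<close>, then this linear map could be deformed to the nowhere defined one. This
  is impossible by a mod 2 count of the zeros of the \<open>E\<^sup>u\<close>-component. The infinite orbit follows by
  compactness of \<open>D\<^sub>\<theta>\<close>.

  The count takes the place of the mod 2 Thom class, as \<open>E\<^sup>u\<close> need not be orientable. On small
  singular simplices of the domain of the deformation the bundle is trivial. There the section is
  pushed off its zeros in dimensions below \<open>u\<close>, and a simplex of dimension \<open>u\<close> then has a class in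
  \<open>H\<^sub>u(\<real>\<^sup>u, \<real>\<^sup>u - 0) \<cong> \<int>\<close>. Its parity, that is divisibility by two, does not depend on the trivialization.
  The parities of the faces of a simplex of dimension \<open>u + 1\<close> add up to an even number.
\<close>

subsection \<open>Relative cycles that are twice another one\<close>

text \<open>The obstacle is that the deformation is only partially defined on the cylinder [0,1] x
  ball and that its values wander from fiber to fiber. It is defined with unstable norm below one on
  an open set \<open>W\<close> of no particular shape, over which the pulled back bundle may be
  nontrivial and even nonorientable. There is thus no global coordinate in which to take a degree;
  only small simplices can be compared with Euclidean space. The ragged edge of \<open>W\<close>
  does no harm: at its boundary points the value is still defined and has norm one, so the zeros
  form a set that is closed in the whole cylinder. Simplices that miss this set count as even,
  whether or not they lie in \<open>W\<close>. The bottom of the cylinder is free of zeros if there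
  is no orbit, and the side is free of them because the linear maps expand and D^- is thrown out. So
  only the top contributes to the count over the boundary of the cylinder. That count has to be
  even, whereas a linear isomorphism contributes an odd number.\<close>

definition halvable :: "nat \<Rightarrow> 'a topology \<Rightarrow> 'a set \<Rightarrow> 'a chain \<Rightarrow> bool" where
  "halvable p X S z \<longleftrightarrow> (\<exists>y. singular_relcycle p X S y \<and> homologous_rel p X S z (y + y))"

lemma halvable_cong:
  assumes "homologous_rel p X S a b"
  shows "halvable p X S a \<longleftrightarrow> halvable p X S b"
  unfolding halvable_def by (meson assms homologous_rel_sym homologous_rel_trans)

lemma halvable_relboundary:
  assumes "singular_relboundary p X S z"
  shows "halvable p X S z"
  unfolding halvable_def homologous_rel_def
  by (rule exI[of _ 0]) (use assms in auto)

lemma halvable_chain_map: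
  assumes "halvable p X S z" "continuous_map X Y f" "f \<in> S \<rightarrow> V"
  shows "halvable p Y V (chain_map p f z)"
proof -
  obtain y where y: "singular_relcycle p X S y" "singular_relboundary p X S (z - (y + y))"
    using assms(1) unfolding halvable_def homologous_rel_def by blast
  have "singular_relboundary p Y V (chain_map p f z - (chain_map p f y + chain_map p f y))"
    using singular_relboundary_chain_map[OF y(2) assms(2,3)] by (simp add: chain_map_diff chain_map_add)
  then show ?thesis
    unfolding halvable_def homologous_rel_def
    using singular_relcycle_chain_map[OF y(1) assms(2,3)] by blast
qed

lemma homotopic_id_chain_map:
  assumes "homotopic_with (\<lambda>h. h \<in> S \<rightarrow> S) X X f id" "singular_relcycle p X S z"
  shows "homologous_rel p X S (chain_map p f z) z"
  using homotopic_imp_homologous_rel_chain_maps[OF assms] chain_map_ident[of p X z] assms(2)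
  by (simp add: singular_relcycle)

text \<open>Both properties pass forward along \<open>f\<close> and back along \<open>g\<close>, and
  \<open>g \<circ> f\<close> takes \<open>z\<close> to a relative cycle homologous to
  \<open>z\<close>.\<close>

lemma relative_homotopy_equivalence:
  assumes f: "continuous_map X Y f" "f \<in> S \<rightarrow> V" and g: "continuous_map Y X g" "g \<in> V \<rightarrow> S"
    and gf: "homotopic_with (\<lambda>h. h \<in> S \<rightarrow> S) X X (g \<circ> f) id" and z: "singular_relcycle p X S z"
  shows relboundary_homotopy_equivalence:
      "singular_relboundary p Y V (chain_map p f z) \<longleftrightarrow> singular_relboundary p X S z"
    and halvable_homotopy_equivalence:
      "halvable p Y V (chain_map p f z) \<longleftrightarrow> halvable p X S z"
proof -
  have h: "homologous_rel p X S (chain_map p g (chain_map p f z)) z"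
    using homotopic_id_chain_map[OF gf z] by (simp add: chain_map_compose)
  show "singular_relboundary p Y V (chain_map p f z) \<longleftrightarrow> singular_relboundary p X S z"
  proof
    assume "singular_relboundary p Y V (chain_map p f z)"
    from singular_relboundary_chain_map[OF this g] h
    show "singular_relboundary p X S z"
      unfolding homologous_rel_def using singular_relboundary_diff by fastforce
  qed (rule singular_relboundary_chain_map[OF _ f])
  show "halvable p Y V (chain_map p f z) \<longleftrightarrow> halvable p X S z"
    using halvable_chain_map[OF _ f] halvable_chain_map[OF _ g] halvable_cong[OF h] by blast
qed

subsection \<open>Parity of a section over acyclic carriers\<close>

text \<open>The sum of the coefficients of those generators that satisfy \<open>\<Phi>\<close>. It
  is written as an extension to the free abelian group on one generator, so that additivity is
  inherited from \<open>frag_extend\<close>.\<close>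

definition weight :: "('b \<Rightarrow> bool) \<Rightarrow> ('b \<Rightarrow>\<^sub>0 int) \<Rightarrow> int" where
  "weight \<Phi> c = Poly_Mapping.lookup (frag_extend (\<lambda>x. frag_cmul (of_bool (\<Phi> x)) (frag_of ())) c) ()"

lemma weight_0 [simp]: "weight \<Phi> 0 = 0"
  and weight_of [simp]: "weight \<Phi> (frag_of x) = of_bool (\<Phi> x)"
  and weight_diff: "weight \<Phi> (a - b) = weight \<Phi> a - weight \<Phi> b"
  and weight_add: "weight \<Phi> (a + b) = weight \<Phi> a + weight \<Phi> b"
  by (simp_all add: weight_def frag_extend_diff frag_extend_add lookup_minus lookup_add)

text \<open>What the obstruction argument asks of a bundle over \<open>X\<close> with total space
  \<open>T\<close>, nonzero vectors \<open>N\<close>, and a section \<open>s\<close> with zeros in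
  \<open>Z\<close>. The region \<open>R C\<close> receives the section over a good set
  \<open>C\<close> and behaves homologically like a vector space of dimension \<open>u\<close>
  relative to its nonzero vectors. It depends on \<open>C\<close> and not on a chart, so choices
  made for a face can be reused in every simplex that has this face.\<close>

locale acyclic_carrier =
  fixes u :: nat and X :: "'x topology" and Z :: "'x set" and T :: "'t topology" and N :: "'t set"
    and s :: "'x \<Rightarrow> 't" and R :: "'x set \<Rightarrow> 't set" and good :: "'x set \<Rightarrow> bool"
  assumes good_mono: "\<And>C C'. good C \<Longrightarrow> C' \<subseteq> C \<Longrightarrow> good C'"
    and R_mono: "\<And>C C'. C' \<subseteq> C \<Longrightarrow> R C' \<subseteq> R C"
    and section_cont: "\<And>C. good C \<Longrightarrow> continuous_map (subtopology X C) (subtopology T (R C)) s"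
    and section_nz: "\<And>C x. good C \<Longrightarrow> x \<in> C \<Longrightarrow> x \<in> topspace X \<Longrightarrow> x \<notin> Z \<Longrightarrow> s x \<in> N"
    and acyclic: "\<And>C j z. good C \<Longrightarrow> C \<noteq> {} \<Longrightarrow> j < u \<Longrightarrow>
       singular_relcycle j (subtopology T (R C)) N z \<Longrightarrow> singular_relboundary j (subtopology T (R C)) N z"
    and parity_diff: "\<And>C a b. good C \<Longrightarrow> C \<noteq> {} \<Longrightarrow>
       singular_relcycle u (subtopology T (R C)) N a \<Longrightarrow> singular_relcycle u (subtopology T (R C)) N b \<Longrightarrow>
       halvable u (subtopology T (R C)) N (a - b) \<longleftrightarrow>
         (halvable u (subtopology T (R C)) N a \<longleftrightarrow> halvable u (subtopology T (R C)) N b)"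
    and parity_mono: "\<And>C C' z. good C \<Longrightarrow> C' \<subseteq> C \<Longrightarrow> C' \<noteq> {} \<Longrightarrow>
       singular_relcycle u (subtopology T (R C')) N z \<Longrightarrow>
       halvable u (subtopology T (R C')) N z \<longleftrightarrow> halvable u (subtopology T (R C)) N z"
begin

abbreviation TT where "TT C \<equiv> subtopology T (R C)"

text \<open>
  \<open>corr j\<close> acts on simplices of dimension \<open>j - 1\<close>. The chain \<open>corr\<close> of a simplex pushes the section
  off its zeros, compatibly with faces. This is possible below dimension \<open>u\<close>, where a vector space
  of dimension \<open>u\<close> is acyclic relative to its nonzero vectors.
\<close>

primrec corr :: "nat \<Rightarrow> ((nat \<Rightarrow> real) \<Rightarrow> 'x) \<Rightarrow> 't chain" where
  "corr 0 = (\<lambda>\<rho>. 0)"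
| "corr (Suc j) = (\<lambda>\<rho>. if \<rho> ` standard_simplex j \<inter> Z = {} then 0 else
     SOME k. singular_chain (Suc j) (TT (\<rho> ` standard_simplex j)) k \<and>
       singular_chain j (subtopology (TT (\<rho> ` standard_simplex j)) N)
         (chain_map j s (frag_of \<rho>) + frag_extend (corr j) (chain_boundary j (frag_of \<rho>))
            + chain_boundary (Suc j) k))"

declare corr.simps(2) [simp del]

text \<open>The image of \<open>c\<close> with the corrections of its faces attached, but none for
  \<open>c\<close> itself. For a simplex of dimension \<open>u\<close> this is the relative cycle
  whose class obstructs one further push.\<close>

definition pushed :: "nat \<Rightarrow> 'x chain \<Rightarrow> 't chain" where
  "pushed j c = chain_map j s c + frag_extend (corr j) (chain_boundary j c)"

lemma pushed_diff: "pushed j (a - b) = pushed j a - pushed j b"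
  by (simp add: pushed_def chain_map_diff frag_extend_diff chain_boundary_diff)

lemma pushed_0 [simp]: "pushed j 0 = 0"
  by (simp add: pushed_def)

lemma simplex_image_nonempty: "\<rho> ` standard_simplex j \<noteq> {}"
  by (simp add: nonempty_standard_simplex)

text \<open>Corrections are set to 0 where the section has no zeros. Hence a part of a chain off the
  zeros keeps its plain image.\<close>

lemma corr_off_zeros:
  assumes "singular_chain (j - Suc 0) (subtopology X (- Z)) c"
  shows "frag_extend (corr j) c = 0"
proof (rule frag_extend_eq_0)
  fix \<rho> assume "\<rho> \<in> Poly_Mapping.keys c"
  then have "\<rho> ` standard_simplex (j - Suc 0) \<inter> Z = {}"
    using assms by (auto simp: singular_chain_subtopology)
  then show "corr j \<rho> = 0"
    by (cases j) (auto simp: corr.simps(2))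
qed

lemma corr_chain_aux:
  assumes "\<And>\<rho>. singular_simplex j (subtopology X C) \<rho> \<Longrightarrow>
       singular_chain (Suc j) (TT (\<rho> ` standard_simplex j)) (corr (Suc j) \<rho>)"
    and "singular_chain j (subtopology X C) c"
  shows "singular_chain (Suc j) (TT C) (frag_extend (corr (Suc j)) c)"
proof (rule singular_chain_extend)
  fix \<rho> assume "\<rho> \<in> Poly_Mapping.keys c"
  then have \<rho>: "singular_simplex j (subtopology X C) \<rho>"
    using assms(2) by (auto simp: singular_chain_def)
  then have "R (\<rho> ` standard_simplex j) \<subseteq> R C"
    by (intro R_mono) (auto simp: singular_simplex_subtopology)
  then show "singular_chain (Suc j) (TT C) (corr (Suc j) \<rho>)"
    using assms(1)[OF \<rho>] singular_chain_mono by blast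
qed

text \<open>Let \<open>e\<close> be the boundary of \<open>c\<close>. The boundary of the pushed
  chain is the image of \<open>e\<close> plus the boundary of its corrections, and this is what the
  choice of \<open>corr\<close> puts into \<open>N\<close>. The facts about \<open>corr\<close>
  appear as hypotheses because the lemma is applied inside the induction that proves them as well as
  after it.\<close>

lemma pushed_relcycle_aux:
  assumes gC: "good C"
    and corr_chain: "\<And>i \<rho>. j = Suc i \<Longrightarrow> singular_simplex i (subtopology X C) \<rho> \<Longrightarrow>
       singular_chain (Suc i) (TT (\<rho> ` standard_simplex i)) (corr (Suc i) \<rho>)"
    and corr_bd: "\<And>i \<rho>. j = Suc i \<Longrightarrow> singular_simplex i (subtopology X C) \<rho> \<Longrightarrow>
       singular_chain i (subtopology (TT (\<rho> ` standard_simplex i)) N)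
         (pushed i (frag_of \<rho>) + chain_boundary (Suc i) (corr (Suc i) \<rho>))"
    and c: "singular_chain j (subtopology X C) c"
  shows "singular_relcycle j (TT C) N (pushed j c)"
proof -
  have sc: "singular_chain j (TT C) (chain_map j s c)"
    using singular_chain_chain_map[OF c section_cont[OF gC]] .
  show ?thesis
  proof (cases j)
    case 0
    then show ?thesis
      using sc by (simp add: pushed_def singular_relcycle chain_boundary_def)
  next
    case (Suc i)
    define e where "e = chain_boundary j c"
    have e: "singular_chain i (subtopology X C) e"
      using singular_chain_boundary[OF c] by (simp add: Suc e_def)
    have ch: "singular_chain j (TT C) (frag_extend (corr j) e)"
      using corr_chain_aux[OF _ e] corr_chain Suc by simp
    have step: "singular_chain i (subtopology (TT C) N)
        (pushed i a + chain_boundary (Suc i) (frag_extend (corr (Suc i)) a))"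
      if "singular_chain i (subtopology X C) a" for a
      using that[unfolded singular_chain_def]
    proof (induction rule: frag_induction)
      case (one \<rho>)
      then have \<rho>: "singular_simplex i (subtopology X C) \<rho>" by simp
      then have "R (\<rho> ` standard_simplex i) \<subseteq> R C"
        by (intro R_mono) (auto simp: singular_simplex_subtopology)
      then show ?case
        using singular_chain_mono[of i T "R (\<rho> ` standard_simplex i) \<inter> N" _ "R C \<inter> N"] corr_bd[OF Suc \<rho>]
        unfolding subtopology_subtopology frag_extend_of by (simp add: le_infI1)
    next
      case (diff a b)
      have "pushed i (a - b) + chain_boundary (Suc i) (frag_extend (corr (Suc i)) (a - b)) =
          (pushed i a + chain_boundary (Suc i) (frag_extend (corr (Suc i)) a)) -
          (pushed i b + chain_boundary (Suc i) (frag_extend (corr (Suc i)) b))"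
        by (simp add: pushed_diff frag_extend_diff chain_boundary_diff)
      then show ?case
        using diff singular_chain_diff by metis
    qed simp
    \<comment> \<open>The corrections in \<open>pushed i e\<close> sit on the boundary of
      \<open>e\<close>, which vanishes. So \<open>step\<close>, applied to \<open>e\<close>, speaks
      of the bare image of \<open>e\<close>.\<close>
    have "chain_boundary i e = 0"
      using chain_boundary_boundary[OF c] Suc by (simp add: e_def)
    then have "pushed i e = chain_map i s e"
      by (simp add: pushed_def)
    moreover have "chain_boundary j (pushed j c) =
        chain_map i s e + chain_boundary j (frag_extend (corr j) e)"
      using chain_boundary_chain_map[OF c, of s] Suc
      by (simp add: pushed_def chain_boundary_add e_def)
    ultimately have "singular_chain i (subtopology (TT C) N) (chain_boundary j (pushed j c))"
      using step[OF e] Suc by simp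
    then show ?thesis
      using singular_chain_add[OF sc ch] Suc by (simp add: singular_relcycle pushed_def e_def)
  qed
qed

text \<open>The choice made in \<open>corr\<close> can always be satisfied. The corrected faces turn
  the pushed simplex into a relative cycle, which bounds by acyclicity below dimension
  \<open>u\<close>, and the bounding chain supplies the next correction.\<close>

lemma corr:
  assumes "j < u" "singular_simplex j X \<rho>" "good (\<rho> ` standard_simplex j)"
  shows "singular_chain (Suc j) (TT (\<rho> ` standard_simplex j)) (corr (Suc j) \<rho>) \<and>
    singular_chain j (subtopology (TT (\<rho> ` standard_simplex j)) N)
      (pushed j (frag_of \<rho>) + chain_boundary (Suc j) (corr (Suc j) \<rho>))"
  using assms
proof (induction j arbitrary: \<rho> rule: less_induct)
  case (less j)
  let ?C = "\<rho> ` standard_simplex j"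
  have \<rho>: "singular_chain j (subtopology X ?C) (frag_of \<rho>)"
    using less.prems by (simp add: singular_chain_of singular_simplex_subtopology)
  have IH: "singular_chain (Suc i) (TT (\<tau> ` standard_simplex i)) (corr (Suc i) \<tau>) \<and>
      singular_chain i (subtopology (TT (\<tau> ` standard_simplex i)) N)
         (pushed i (frag_of \<tau>) + chain_boundary (Suc i) (corr (Suc i) \<tau>))"
    if "j = Suc i" "singular_simplex i (subtopology X ?C) \<tau>" for i \<tau>
    using less.IH[of i \<tau>] that less.prems good_mono[of ?C "\<tau> ` standard_simplex i"]
    by (auto simp: singular_simplex_subtopology)
  have cyc: "singular_relcycle j (TT ?C) N (pushed j (frag_of \<rho>))"
    using pushed_relcycle_aux[OF less.prems(3) _ _ \<rho>] IH by blast
  show ?case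
  proof (cases "?C \<inter> Z = {}")
    case True
    then have c0: "corr (Suc j) \<rho> = 0" by (simp add: corr.simps(2))
    have off: "singular_chain j (subtopology X (- Z)) (frag_of \<rho>)"
      using less.prems True by (auto simp: singular_chain_of singular_simplex_subtopology)
    have "frag_extend (corr j) (chain_boundary j (frag_of \<rho>)) = 0"
      by (intro corr_off_zeros singular_chain_boundary off)
    then have "pushed j (frag_of \<rho>) = chain_map j s (frag_of \<rho>)"
      by (simp add: pushed_def)
    moreover have "continuous_map (subtopology X ?C) (subtopology (TT ?C) N) s"
      using section_cont[OF less.prems(3)] section_nz[OF less.prems(3)] True
      by (auto simp: continuous_map_in_subtopology)
    ultimately show ?thesis
      using singular_chain_chain_map[OF \<rho>] c0 by simp
  next
    case False
    have "singular_relboundary j (TT ?C) N (pushed j (frag_of \<rho>))"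
      using acyclic[OF less.prems(3) simplex_image_nonempty less.prems(1) cyc] .
    then obtain d e where "singular_chain (Suc j) (TT ?C) d" "singular_chain j (subtopology (TT ?C) N) e"
      "chain_boundary (Suc j) d + e = pushed j (frag_of \<rho>)"
      by (auto simp: singular_relboundary)
    \<comment> \<open>The correction is added to the pushed simplex, so it is the negative of the
      bounding chain.\<close>
    then have "singular_chain (Suc j) (TT ?C) (- d) \<and>
      singular_chain j (subtopology (TT ?C) N) (pushed j (frag_of \<rho>) + chain_boundary (Suc j) (- d))"
      unfolding singular_chain_minus chain_boundary_minus by (metis add_diff_cancel_left' add_uminus_conv_diff)
    then have ex: "\<exists>k. singular_chain (Suc j) (TT ?C) k \<and>
      singular_chain j (subtopology (TT ?C) N) (pushed j (frag_of \<rho>) + chain_boundary (Suc j) k)"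
      by blast
    have "corr (Suc j) \<rho> = (SOME k. singular_chain (Suc j) (TT ?C) k \<and>
      singular_chain j (subtopology (TT ?C) N) (pushed j (frag_of \<rho>) + chain_boundary (Suc j) k))"
      using False by (simp add: pushed_def corr.simps(2))
    then show ?thesis
      using someI_ex[OF ex] by simp
  qed
qed

lemma pushed_relcycle:
  assumes "good C" "singular_chain u (subtopology X C) c"
  shows "singular_relcycle u (TT C) N (pushed u c)"
proof (rule pushed_relcycle_aux[OF assms(1) _ _ assms(2)])
  fix i \<rho> assume "u = Suc i" "singular_simplex i (subtopology X C) \<rho>"
  then have "i < u" "singular_simplex i X \<rho>" "good (\<rho> ` standard_simplex i)"
    using good_mono[OF assms(1)] by (auto simp: singular_simplex_subtopology)
  from corr[OF this]
  show "singular_chain (Suc i) (TT (\<rho> ` standard_simplex i)) (corr (Suc i) \<rho>)"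
    "singular_chain i (subtopology (TT (\<rho> ` standard_simplex i)) N)
       (pushed i (frag_of \<rho>) + chain_boundary (Suc i) (corr (Suc i) \<rho>))"
    by auto
qed

text \<open>The obstruction cochain modulo 2. The class is taken over the image of the simplex
  itself, so the value depends on the simplex alone. A simplex without a good image gets the value
  0, which agrees with its parity in the case of interest, where it misses the zeros.\<close>

definition odd_simplex :: "((nat \<Rightarrow> real) \<Rightarrow> 'x) \<Rightarrow> bool" where
  "odd_simplex \<rho> \<longleftrightarrow> good (\<rho> ` standard_simplex u) \<and>
     \<not> halvable u (TT (\<rho> ` standard_simplex u)) N (pushed u (frag_of \<rho>))"

text \<open>Over one good set all parities can be computed in the same group:
  \<open>parity_mono\<close> moves each simplex there, and \<open>parity_diff\<close> makes parity
  additive.\<close>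

lemma weight_good:
  assumes gC: "good C" and ne: "C \<noteq> {}" and c: "singular_chain u (subtopology X C) c"
  shows "even (weight odd_simplex c) \<longleftrightarrow> halvable u (TT C) N (pushed u c)"
proof -
  \<comment> \<open>That \<open>c\<close> is a chain in \<open>C\<close> is carried along, since the
    case of a difference needs it for both parts.\<close>
  have "singular_chain u (subtopology X C) c \<and> (even (weight odd_simplex c) \<longleftrightarrow> halvable u (TT C) N (pushed u c))"
    using c[unfolded singular_chain_def]
  proof (induction rule: frag_induction)
    case zero
    then show ?case
      by (simp add: halvable_relboundary)
  next
    case (one \<rho>)
    then have \<rho>: "singular_simplex u X \<rho>" "\<rho> ` standard_simplex u \<subseteq> C"
      by (auto simp: singular_simplex_subtopology)
    have g: "good (\<rho> ` standard_simplex u)"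
      using good_mono[OF gC \<rho>(2)] .
    have "singular_relcycle u (TT (\<rho> ` standard_simplex u)) N (pushed u (frag_of \<rho>))"
      by (rule pushed_relcycle[OF g]) (use \<rho> in \<open>simp add: singular_chain_of singular_simplex_subtopology\<close>)
    then show ?case
      using parity_mono[OF gC \<rho>(2) simplex_image_nonempty] g \<rho>
      by (simp add: odd_simplex_def singular_chain_of singular_simplex_subtopology)
  next
    case (diff a b)
    then show ?case
      using parity_diff[OF gC ne pushed_relcycle[OF gC] pushed_relcycle[OF gC], of a b]
      by (auto simp: weight_diff pushed_diff singular_chain_diff)
  qed
  then show ?thesis ..
qed

lemma pushed_off_zeros:
  assumes "singular_chain (u - Suc 0) (subtopology X (- Z)) (chain_boundary u c)"
  shows "pushed u c = chain_map u s c"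
  using corr_off_zeros[OF assms] by (simp add: pushed_def)

text \<open>Off the zeros the corrections vanish and the image of a good simplex lies in
  \<open>N\<close>, so its relative class is zero.\<close>

lemma weight_off_zeros:
  assumes "singular_chain u (subtopology X (- Z)) c"
  shows "even (weight odd_simplex c)"
  using assms unfolding singular_chain_def
proof (induction rule: frag_induction)
  case (one \<rho>)
  let ?C = "\<rho> ` standard_simplex u"
  have \<rho>: "singular_simplex u X \<rho>" "?C \<inter> Z = {}"
    using one by (auto simp: singular_simplex_subtopology)
  have "halvable u (TT ?C) N (pushed u (frag_of \<rho>))" if g: "good ?C"
  proof -
    have "singular_chain u (subtopology X ?C) (frag_of \<rho>)"
      using \<rho> by (simp add: singular_chain_of singular_simplex_subtopology)
    moreover have "continuous_map (subtopology X ?C) (subtopology (TT ?C) N) s"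
      using section_cont[OF g] section_nz[OF g] \<rho>
      by (auto simp: continuous_map_in_subtopology)
    ultimately have "singular_chain u (subtopology (TT ?C) N) (chain_map u s (frag_of \<rho>))"
      using singular_chain_chain_map by blast
    moreover have "pushed u (frag_of \<rho>) = chain_map u s (frag_of \<rho>)"
      using one by (intro pushed_off_zeros singular_chain_boundary) (simp add: singular_chain_of)
    ultimately show ?thesis
      by (metis singular_chain_imp_relboundary halvable_relboundary)
  qed
  then show ?case
    by (auto simp: odd_simplex_def)
qed (auto simp: weight_diff)

text \<open>The cocycle property. The boundary of a simplex is itself a cycle, so no corrections are
  left on it, and its pushed chain is the boundary of the image of the simplex. The alternative of
  missing \<open>Z\<close> admits simplices over which no section is available.\<close>

lemma weight_boundary:
  assumes "singular_chain (Suc u) X c"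
    and "\<And>\<rho>. \<rho> \<in> Poly_Mapping.keys c \<Longrightarrow>
       good (\<rho> ` standard_simplex (Suc u)) \<or> \<rho> ` standard_simplex (Suc u) \<inter> Z = {}"
  shows "even (weight odd_simplex (chain_boundary (Suc u) c))"
proof -
  have "Poly_Mapping.keys c \<subseteq> {\<rho>. singular_simplex (Suc u) X \<rho> \<and>
      (good (\<rho> ` standard_simplex (Suc u)) \<or> \<rho> ` standard_simplex (Suc u) \<inter> Z = {})}"
    using assms by (auto simp: singular_chain_def)
  then show ?thesis
  proof (induction rule: frag_induction)
    case (one \<rho>)
    let ?C = "\<rho> ` standard_simplex (Suc u)"
    have \<rho>: "singular_chain (Suc u) (subtopology X ?C) (frag_of \<rho>)"
      using one by (simp add: singular_chain_of singular_simplex_subtopology)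
    have bd: "singular_chain u (subtopology X ?C) (chain_boundary (Suc u) (frag_of \<rho>))"
      using singular_chain_boundary[OF \<rho>] by simp
    consider "good ?C" | "?C \<inter> Z = {}"
      using one by blast
    then show ?case
    proof cases
      case 1
      have "pushed u (chain_boundary (Suc u) (frag_of \<rho>)) =
          chain_boundary (Suc u) (chain_map (Suc u) s (frag_of \<rho>))"
        using chain_boundary_boundary_alt[OF \<rho>] chain_boundary_chain_map[OF \<rho>, of s]
        by (simp add: pushed_def)
      moreover have "singular_chain (Suc u) (TT ?C) (chain_map (Suc u) s (frag_of \<rho>))"
        using singular_chain_chain_map[OF \<rho> section_cont[OF 1]] .
      ultimately have "singular_relboundary u (TT ?C) N (pushed u (chain_boundary (Suc u) (frag_of \<rho>)))"
        using singular_relboundary by fastforce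
      then show ?thesis
        using weight_good[OF 1 simplex_image_nonempty bd] halvable_relboundary by blast
    next
      case 2
      then show ?thesis
        using singular_chain_mono[OF bd, of "- Z"] by (intro weight_off_zeros) blast
    qed
  qed (auto simp: weight_diff chain_boundary_diff)
qed

text \<open>The total boundary and the part \<open>e\<close> have even weight, hence so has
  \<open>a\<close>. The boundary of \<open>a\<close> is that of \<open>-e\<close> and lies off the
  zeros, so no correction remains and the parity found is that of the plain image of
  \<open>a\<close>.\<close>

theorem halvable_section:
  assumes c: "singular_chain (Suc u) X c"
    and small: "\<And>\<rho>. \<rho> \<in> Poly_Mapping.keys c \<Longrightarrow>
       good (\<rho> ` standard_simplex (Suc u)) \<or> \<rho> ` standard_simplex (Suc u) \<inter> Z = {}"
    and C: "good C" "C \<noteq> {}"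
    and a: "singular_chain u (subtopology X C) a"
    and e: "singular_chain u (subtopology X (- Z)) e"
    and ae: "chain_boundary (Suc u) c = a + e"
  shows "halvable u (TT C) N (chain_map u s a)"
proof -
  have "even (weight odd_simplex (a + e))"
    using weight_boundary[OF c small] ae by simp
  then have "even (weight odd_simplex a)"
    using weight_off_zeros[OF e] by (simp add: weight_add)
  moreover have "chain_boundary u a = - chain_boundary u e"
    using chain_boundary_boundary_alt[OF c] ae
    by (simp add: chain_boundary_add eq_neg_iff_add_eq_0)
  then have "singular_chain (u - Suc 0) (subtopology X (- Z)) (chain_boundary u a)"
    using singular_chain_boundary[OF e] by (simp add: singular_chain_minus)
  ultimately show ?thesis
    using weight_good[OF C a] pushed_off_zeros by simp
qed

end

section \<open>Parity in a relative homology group isomorphic to the integers\<close>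

lemma integer_homology_coordinate:
  assumes iso: "relative_homology_group (int p) X S \<cong> integer_group"
  obtains d where
    "\<And>a b. singular_relcycle p X S a \<Longrightarrow> singular_relcycle p X S b \<Longrightarrow> d (a - b) = d a - (d b :: int)"
    "\<And>a. singular_relcycle p X S a \<Longrightarrow> d a = 0 \<longleftrightarrow> singular_relboundary p X S a"
    "\<And>m. \<exists>a. singular_relcycle p X S a \<and> d a = m"
proof -
  obtain h where h: "h \<in> iso (relative_homology_group (int p) X S) integer_group"
    using iso by (auto simp: is_iso_def)
  define d where "d = (\<lambda>z. h (homologous_rel_set p X S z))"
  have hom: "h \<in> hom (relative_homology_group (int p) X S) integer_group"
    and bij: "bij_betw h (carrier (relative_homology_group (int p) X S)) UNIV"
    using h by (auto simp: iso_def)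
  have mem: "homologous_rel_set p X S a \<in> carrier (relative_homology_group (int p) X S)"
    if "singular_relcycle p X S a" for a
    using that by (simp add: carrier_relative_homology_group)
  have add: "d (a + b) = d a + d b" if "singular_relcycle p X S a" "singular_relcycle p X S b" for a b
  proof -
    \<comment> \<open>The product of two classes is the union over all pairs of representatives,
      hence two inclusions.\<close>
    have "homologous_rel_set p X S (a + b) =
        homologous_rel_set p X S a \<otimes>\<^bsub>relative_homology_group (int p) X S\<^esub> homologous_rel_set p X S b"
      (is "?L = ?R")
    proof
      show "?L \<subseteq> ?R"
      proof
        fix c assume "c \<in> ?L"
        then have c: "homologous_rel p X S (a + b) c" by simp
        then have "homologous_rel p X S b (c - a)"
          by (simp add: homologous_rel_def algebra_simps)
        then show "c \<in> ?R"
          unfolding mult_relative_homology_group by (intro UN_I[of a] UN_I[of "c - a"]) auto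
      qed
      show "?R \<subseteq> ?L"
        unfolding mult_relative_homology_group using homologous_rel_add by auto
    qed
    then show ?thesis
      unfolding d_def using hom_mult[OF hom mem[OF that(1)] mem[OF that(2)]] by simp
  qed
  show ?thesis
  proof
    show "d (a - b) = d a - d b" if "singular_relcycle p X S a" "singular_relcycle p X S b" for a b
      using add[of "a - b" b] singular_relcycle_diff[OF that] that by simp
    show "d a = 0 \<longleftrightarrow> singular_relboundary p X S a" if a: "singular_relcycle p X S a" for a
    proof -
      have one: "h (singular_relboundary_set p X S) = 0"
        using hom_one[OF hom] by simp
      have "d a = 0 \<longleftrightarrow> h (homologous_rel_set p X S a) = h (homologous_rel_set p X S 0)"
        using one homologous_rel_set_eq_relboundary[of p X S 0] by (simp add: d_def)
      also have "\<dots> \<longleftrightarrow> homologous_rel_set p X S a = homologous_rel_set p X S 0"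
        using bij mem[OF a] mem[of 0] by (auto simp: bij_betw_def inj_on_def)
      also have "\<dots> \<longleftrightarrow> singular_relboundary p X S a"
        by (metis diff_zero homologous_rel_def homologous_rel_set_eq)
      finally show ?thesis .
    qed
    show "\<exists>a. singular_relcycle p X S a \<and> d a = m" for m
    proof -
      have "m \<in> h ` carrier (relative_homology_group (int p) X S)"
        using bij by (auto simp: bij_betw_def)
      then show ?thesis
        by (auto simp: carrier_relative_homology_group d_def)
    qed
  qed
qed

text \<open>As \<open>d\<close> takes every integer value, a cycle with an even value has a cycle of
  half that value to be compared with. Divisibility by two in homology thus becomes evenness of an
  integer.\<close>

lemma halvable_parity:
  assumes iso: "relative_homology_group (int p) X S \<cong> integer_group"
  obtains d where
    "\<And>a b. singular_relcycle p X S a \<Longrightarrow> singular_relcycle p X S b \<Longrightarrow> d (a - b) = d a - (d b :: int)"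
    "\<And>a. singular_relcycle p X S a \<Longrightarrow> halvable p X S a \<longleftrightarrow> even (d a)"
    "\<And>m. \<exists>a. singular_relcycle p X S a \<and> d a = m"
proof -
  obtain d where diff: "\<And>a b. singular_relcycle p X S a \<Longrightarrow> singular_relcycle p X S b \<Longrightarrow> d (a - b) = d a - (d b :: int)"
    and zero: "\<And>a. singular_relcycle p X S a \<Longrightarrow> d a = 0 \<longleftrightarrow> singular_relboundary p X S a"
    and surj: "\<And>m. \<exists>a. singular_relcycle p X S a \<and> d a = m"
    by (rule integer_homology_coordinate[OF iso]) (rule that)
  have hom: "homologous_rel p X S a (y + y) \<longleftrightarrow> d a = 2 * d y"
    if "singular_relcycle p X S a" "singular_relcycle p X S y" for a y
  proof -
    have "d (a - (y + y)) = d (a - y - y)"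
      by (simp add: algebra_simps)
    also have "\<dots> = d a - 2 * d y"
      using that by (simp add: diff singular_relcycle_diff)
    finally show ?thesis
      using zero[of "a - (y + y)"] that
      by (auto simp: homologous_rel_def singular_relcycle_diff singular_relcycle_add)
  qed
  have "halvable p X S a \<longleftrightarrow> even (d a)" if "singular_relcycle p X S a" for a
    unfolding halvable_def using hom[OF that] surj by (metis dvd_def)
  from that[OF diff this surj] show ?thesis .
qed

lemma halvable_diff_iff:
  assumes iso: "relative_homology_group (int p) X S \<cong> integer_group"
    and a: "singular_relcycle p X S a" and b: "singular_relcycle p X S b"
  shows "halvable p X S (a - b) \<longleftrightarrow> (halvable p X S a \<longleftrightarrow> halvable p X S b)"
proof -
  obtain d where d: "\<And>a b. singular_relcycle p X S a \<Longrightarrow> singular_relcycle p X S b \<Longrightarrow> d (a - b) = d a - (d b :: int)"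
    "\<And>a. singular_relcycle p X S a \<Longrightarrow> halvable p X S a \<longleftrightarrow> even (d a)"
    using halvable_parity[OF iso] by metis
  show ?thesis
    using a b singular_relcycle_diff[OF a b] by (auto simp: d)
qed

lemma not_halvable_exists:
  assumes iso: "relative_homology_group (int p) X S \<cong> integer_group"
  obtains z where "singular_relcycle p X S z" "\<not> halvable p X S z"
proof -
  obtain d :: "'a chain \<Rightarrow> int" where d: "\<And>a. singular_relcycle p X S a \<Longrightarrow> halvable p X S a \<longleftrightarrow> even (d a)"
    "\<And>m. \<exists>a. singular_relcycle p X S a \<and> d a = m"
    by (rule halvable_parity[OF iso]) (rule that)
  obtain z where "singular_relcycle p X S z" "d z = 1"
    using d(2) by blast
  then show ?thesis
    using that d(1) by fastforce
qed

lemma trivial_homology_relboundary: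
  assumes triv: "trivial_group (relative_homology_group (int p) X S)" and z: "singular_relcycle p X S z"
  shows "singular_relboundary p X S z"
proof -
  have "homologous_rel_set p X S z \<in> carrier (relative_homology_group (int p) X S)"
    using z by (simp add: carrier_relative_homology_group)
  then show ?thesis
    using triv homologous_rel_set_eq_relboundary by (auto simp: trivial_group_def)
qed

subsection \<open>Euclidean space and its nonzero vectors\<close>

abbreviation nonzero :: "(nat \<Rightarrow> real) set" where
  "nonzero \<equiv> - {\<lambda>i. 0}"

lemma L2_set_0_iff:
  assumes "x \<in> topspace (Euclidean_space n)"
  shows "L2_set x {..<n} = 0 \<longleftrightarrow> x = (\<lambda>i. 0)"
proof -
  have "L2_set x {..<n} = 0 \<longleftrightarrow> (\<forall>i<n. x i = 0)"
    by (simp add: L2_set_eq_0_iff Ball_def)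
  then show ?thesis
    using assms by (auto simp: topspace_Euclidean_space fun_eq_iff) (meson linorder_not_le)
qed

lemma L2_set_scale: "L2_set (\<lambda>i. c * x i) A = \<bar>c\<bar> * L2_set x A"
proof -
  have "L2_set (\<lambda>i. c * x i) A = L2_set (\<lambda>i. \<bar>c\<bar> * x i) A"
    by (simp add: L2_set_def power_mult_distrib)
  then show ?thesis
    by (simp add: L2_set_right_distrib)
qed

lemma continuous_map_Euclidean_coordinate:
  assumes "continuous_map X (Euclidean_space n) f"
  shows "continuous_map X euclideanreal (\<lambda>x. f x i)"
  using assms unfolding Euclidean_space_def continuous_map_in_subtopology continuous_map_componentwise_UNIV
  by blast

lemma continuous_map_into_Euclidean:
  assumes "\<And>i. i < n \<Longrightarrow> continuous_map X euclideanreal (\<lambda>x. f x i)"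
    and "\<And>x i. x \<in> topspace X \<Longrightarrow> i \<ge> n \<Longrightarrow> f x i = 0"
  shows "continuous_map X (Euclidean_space n) f"
proof -
  have "continuous_map X (Euclidean_space n) (\<lambda>x i. if i < n then f x i else 0)"
    using assms(1) by (simp add: continuous_map_componentwise_Euclidean_space)
  then show ?thesis
    by (rule continuous_map_eq) (use assms(2) in \<open>force simp: fun_eq_iff\<close>)
qed

lemma continuous_map_L2_set:
  assumes "continuous_map X (Euclidean_space n) f"
  shows "continuous_map X euclideanreal (\<lambda>x. L2_set (f x) {..<k})"
proof -
  have "continuous_map X euclideanreal (\<lambda>x. \<Sum>i<k. (f x i)\<^sup>2)"
    using continuous_map_Euclidean_coordinate[OF assms]
    by (intro continuous_map_sum continuous_map_real_pow) auto
  then have "continuous_map X euclideanreal (sqrt \<circ> (\<lambda>x. \<Sum>i<k. (f x i)\<^sup>2))"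
    by (rule continuous_map_compose) (simp add: continuous_on_real_sqrt)
  then show ?thesis
    by (simp add: L2_set_def o_def)
qed

text \<open>Normalization is a retraction onto the sphere. The straight homotopy from
  \<open>x\<close> divided by its norm to \<open>x\<close> runs through positive multiples of
  \<open>x\<close> and so never meets zero.\<close>

lemma Euclidean_nonzero_homotopy_equivalent_sphere:
  "subtopology (Euclidean_space (Suc n)) nonzero homotopy_equivalent_space nsphere n"
proof -
  let ?E = "Euclidean_space (Suc n)"
  let ?Y = "subtopology ?E nonzero"
  let ?norm = "\<lambda>x. L2_set x {..<Suc n}"
  let ?r = "\<lambda>x i. x i / ?norm x"
  have top: "topspace ?Y = topspace ?E \<inter> nonzero" by simp
  have pos: "?norm x > 0" if "x \<in> topspace ?Y" for x
    using that L2_set_0_iff[of x "Suc n"] L2_set_nonneg[of x "{..<Suc n}"]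
    by (metis top IntE ComplD order_less_le singletonI)
  have idY: "continuous_map ?Y ?E (\<lambda>x. x)"
    by (simp add: continuous_map_from_subtopology)
  have sph: "nsphere n = subtopology ?E {x. ?norm x = 1}"
    by (simp add: nsphere_def L2_set_def lessThan_Suc_atMost)
  have nz: "\<And>x. x \<in> topspace ?Y \<Longrightarrow> ?norm x \<noteq> 0"
    using pos by fastforce
  have top0: "\<And>x i. x \<in> topspace ?Y \<Longrightarrow> i \<ge> Suc n \<Longrightarrow> x i = 0"
    by (simp add: topspace_Euclidean_space)
  have rE: "continuous_map ?Y ?E ?r"
  proof (rule continuous_map_into_Euclidean)
    show "continuous_map ?Y euclideanreal (\<lambda>x. ?r x i)" for i
      using nz by (intro continuous_map_real_divide continuous_map_L2_set[OF idY]
          continuous_map_Euclidean_coordinate[OF idY])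
  qed (simp add: top0)
  have r1: "?norm (?r x) = 1" if "x \<in> topspace ?Y" for x
    using pos[OF that] L2_set_scale[of "1 / ?norm x" x "{..<Suc n}"] by simp
  have r: "continuous_map ?Y (nsphere n) ?r"
    unfolding sph continuous_map_in_subtopology using rE r1 by auto
  have id: "continuous_map (nsphere n) ?Y id"
    unfolding sph continuous_map_in_subtopology
    by (auto simp: continuous_map_from_subtopology L2_set_def)
  have rfix: "?r x = x" if "x \<in> topspace (nsphere n)" for x
    using that by (simp add: sph)
  have "homotopic_with (\<lambda>h. True) ?Y ?Y ?r id"
  proof (subst homotopic_with, simp, intro exI conjI ballI)
    let ?h = "\<lambda>(t, x) i. (1 - t) * (x i / ?norm x) + t * (x i :: real)"
    have fstc: "continuous_map (prod_topology (top_of_set {0..1::real}) ?Y) euclideanreal fst"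
      using continuous_map_fst continuous_map_into_fulltopology by blast
    have sndc: "continuous_map (prod_topology (top_of_set {0..1::real}) ?Y) ?E snd"
      by (meson continuous_map_snd continuous_map_into_fulltopology)
    have cont: "continuous_map (prod_topology (top_of_set {0..1}) ?Y) ?E ?h"
      unfolding case_prod_unfold
    proof (rule continuous_map_into_Euclidean)
      fix i
      show "continuous_map (prod_topology (top_of_set {0..1}) ?Y) euclideanreal
          (\<lambda>p. (1 - fst p) * (snd p i / ?norm (snd p)) + fst p * snd p i)"
        by (intro continuous_map_real_divide continuous_map_add continuous_map_real_mult
            continuous_map_diff continuous_map_L2_set[OF sndc] continuous_map_Euclidean_coordinate[OF sndc] fstc)
          (auto simp: nz simp del: topspace_subtopology)
    qed (auto simp: top0 simp del: topspace_subtopology)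
    have hnz: "?h (t, x) \<noteq> (\<lambda>i. 0)" if "t \<in> {0..1}" "x \<in> topspace ?Y" for t x
    proof
      assume z: "?h (t, x) = (\<lambda>i. 0)"
      have p: "(1 - t) / ?norm x + t > 0"
        using pos[OF that(2)] that(1) by (cases "t = 0") (auto intro: add_nonneg_pos)
      have "((1 - t) / ?norm x + t) * x i = 0" for i
        using fun_cong[OF z, of i] by (simp add: algebra_simps)
      then have "x i = 0" for i
        using p by (metis less_irrefl mult_eq_0_iff)
      then show False
        using that(2) by auto
    qed
    show "continuous_map (prod_topology (subtopology euclidean {0..1}) ?Y) ?Y ?h"
    proof -
      have "?h \<in> topspace (prod_topology (top_of_set {0..1}) ?Y) \<rightarrow> nonzero"
        using hnz by (intro funcsetI) (clarsimp simp del: topspace_subtopology split_paired_All)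
      with cont show ?thesis
        unfolding continuous_map_in_subtopology by blast
    qed
  qed auto
  then have "homotopic_with (\<lambda>h. True) ?Y ?Y (id \<circ> ?r) id"
    by simp
  moreover have "homotopic_with (\<lambda>h. True) (nsphere n) (nsphere n) (?r \<circ> id) id"
    using rfix continuous_map_compose[OF id r] by (intro homotopic_with_equal) auto
  ultimately show ?thesis
    unfolding homotopy_equivalent_space_def using r id by blast
qed

text \<open>Euclidean space is contractible, so the connecting map of the pair is an isomorphism
  onto the reduced homology of the nonzero vectors, that is, of a sphere.\<close>

lemma relative_homology_Euclidean_nonzero:
  assumes "n > 0"
  shows "relative_homology_group p (Euclidean_space n) nonzero \<cong>
    reduced_homology_group (p - 1) (nsphere (n - 1))"
proof -
  obtain m where n: "n = Suc m"
    using assms by (cases n) auto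
  \<comment> \<open>The first unit vector: the isomorphism for a contractible space asks for a
    nonempty subspace.\<close>
  have "(\<lambda>i. if i = 0 then 1 else 0) \<in> topspace (Euclidean_space n) \<inter> nonzero"
    using assms by (auto simp: topspace_Euclidean_space fun_eq_iff intro!: exI[of _ 0])
  then have "relative_homology_group p (Euclidean_space n) nonzero \<cong>
      reduced_homology_group (p - 1) (subtopology (Euclidean_space n) nonzero)"
    by (intro isomorphic_group_relative_homology_of_contractible) auto
  also have "\<dots> \<cong> reduced_homology_group (p - 1) (nsphere (n - 1))"
    using Euclidean_nonzero_homotopy_equivalent_sphere[of m] n
    by (intro homotopy_equivalent_space_imp_isomorphic_reduced_homology_groups) simp
  finally show ?thesis .
qed

lemma Euclidean_nonzero_homology_top:
  assumes "n > 0"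
  shows "relative_homology_group (int n) (Euclidean_space n) nonzero \<cong> integer_group"
  using relative_homology_Euclidean_nonzero[OF assms, of "int n"] reduced_homology_group_nsphere(1)[of "n - 1"] assms
  by (metis iso_trans of_nat_1 of_nat_diff Suc_leI One_nat_def)

lemma Euclidean_nonzero_acyclic:
  assumes "j < n" "singular_relcycle j (Euclidean_space n) nonzero z"
  shows "singular_relboundary j (Euclidean_space n) nonzero z"
proof (rule trivial_homology_relboundary[OF _ assms(2)])
  have "trivial_group (reduced_homology_group (int j - 1) (nsphere (n - 1)))"
    using assms(1) by (intro reduced_homology_group_nsphere(2)) auto
  then show "trivial_group (relative_homology_group (int j) (Euclidean_space n) nonzero)"
    using isomorphic_group_triviality[OF relative_homology_Euclidean_nonzero[of n "int j"]] assms(1)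
    by auto
qed

subsection \<open>Charts of a Banach bundle\<close>

abbreviation chart_inv :: "('a, 'e) vbundle \<Rightarrow> 'a set \<Rightarrow> ('e \<Rightarrow> 'a \<times> (nat \<Rightarrow> real)) \<Rightarrow> 'a \<times> (nat \<Rightarrow> real) \<Rightarrow> 'e" where
  "chart_inv B U \<phi> \<equiv> inv_into (bover B U) \<phi>"

lemma continuous_map_in: "continuous_map X Y f \<Longrightarrow> x \<in> topspace X \<Longrightarrow> f x \<in> topspace Y"
  by (auto simp: continuous_map_def)

locale banach_bundle =
  fixes n :: nat and M :: "'a topology" and \<A> :: "'a atlas" and B :: "('a, 'e) vbundle"
  assumes bb: "smooth_banach_bundle n M \<A> B"
begin

abbreviation "rk \<equiv> brank B"
abbreviation "E \<equiv> btop B"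

lemma proj_cont: "continuous_map E M (bproj B)"
  using bb by (simp add: smooth_banach_bundle_def)

lemma proj_in: "e \<in> topspace E \<Longrightarrow> bproj B e \<in> topspace M"
  using proj_cont by (auto simp: continuous_map_def)

lemma chart_ex: "\<theta> \<in> topspace M \<Longrightarrow> \<exists>U \<phi>. (U, \<phi>) \<in> btriv B \<and> \<theta> \<in> U"
proof -
  assume "\<theta> \<in> topspace M"
  moreover have "\<Union> (fst ` btriv B) = topspace M"
    using bb by (simp add: smooth_banach_bundle_def)
  ultimately obtain c where "c \<in> btriv B" "\<theta> \<in> fst c"
    by blast
  then show ?thesis
    by (metis prod.collapse)
qed

context
  fixes U \<phi> assumes chart: "(U, \<phi>) \<in> btriv B"
begin

lemma local_triv: "local_trivialization M B U \<phi>"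
proof -
  have "\<forall>(U, \<phi>)\<in>btriv B. local_trivialization M B U \<phi>"
    using bb by (simp add: smooth_banach_bundle_def)
  then show ?thesis
    using chart by blast
qed

lemma chart_open: "openin M U"
  using local_triv by (simp add: local_trivialization_def)

lemma chart_sub: "U \<subseteq> topspace M"
  using chart_open openin_subset by blast

lemma over_open: "openin E (bover B U)"
  unfolding bover_def using openin_continuous_map_preimage[OF proj_cont chart_open] .

lemma chart_homeo:
  "homeomorphic_map (subtopology E (bover B U)) (prod_topology (subtopology M U) (Euclidean_space rk)) \<phi>"
  using local_triv by (simp add: local_trivialization_def)

lemma over_sub: "bover B U \<subseteq> topspace E"
  by (auto simp: bover_def)

lemma chart_inj: "inj_on \<phi> (bover B U)"
  using homeomorphic_imp_injective_map[OF chart_homeo] over_sub by (simp add: Int_absorb1)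

lemma chart_image: "\<phi> ` bover B U = U \<times> topspace (Euclidean_space rk)"
  using homeomorphic_imp_surjective_map[OF chart_homeo] over_sub chart_sub by (simp add: Int_absorb1)

lemma chart_inv_cont:
  "continuous_map (prod_topology (subtopology M U) (Euclidean_space rk)) (subtopology E (bover B U)) (chart_inv B U \<phi>)"
proof -
  obtain g where g: "homeomorphic_maps (subtopology E (bover B U))
      (prod_topology (subtopology M U) (Euclidean_space rk)) \<phi> g"
    using chart_homeo homeomorphic_map_maps by blast
  have "g y = chart_inv B U \<phi> y" if "y \<in> topspace (prod_topology (subtopology M U) (Euclidean_space rk))" for y
  proof -
    have "continuous_map (prod_topology (subtopology M U) (Euclidean_space rk)) (subtopology E (bover B U)) g"
      "\<phi> (g y) = y"
      using g that by (simp_all only: homeomorphic_maps_def)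
    then have "g y \<in> bover B U" "\<phi> (g y) = y"
      using continuous_map_in[OF _ that] by fastforce+
    then show ?thesis
      using inv_into_f_f[OF chart_inj] by metis
  qed
  then show ?thesis
    using g by (auto simp only: homeomorphic_maps_def elim!: continuous_map_eq)
qed

lemma chart_fst: "v \<in> bover B U \<Longrightarrow> fst (\<phi> v) = bproj B v"
  using local_triv by (simp add: local_trivialization_def)

lemma chart_left: "v \<in> bover B U \<Longrightarrow> chart_inv B U \<phi> (bproj B v, snd (\<phi> v)) = v"
  using chart_fst[of v] inv_into_f_f[OF chart_inj] by (metis prod.collapse)

lemma chart_coord: "v \<in> bover B U \<Longrightarrow> snd (\<phi> v) \<in> topspace (Euclidean_space rk)"
  using chart_image by (metis imageI mem_Times_iff)

lemma chart_coord_cont: "continuous_map (subtopology E (bover B U)) (Euclidean_space rk) (\<lambda>v. snd (\<phi> v))"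
  using homeomorphic_imp_continuous_map[OF chart_homeo] continuous_map_snd_of[unfolded o_def] by blast

lemma
  assumes "\<theta> \<in> U" "x \<in> topspace (Euclidean_space rk)"
  shows chart_right: "\<phi> (chart_inv B U \<phi> (\<theta>, x)) = (\<theta>, x)"
    and chart_inv_over: "chart_inv B U \<phi> (\<theta>, x) \<in> bover B U"
    and chart_inv_proj: "bproj B (chart_inv B U \<phi> (\<theta>, x)) = \<theta>"
    and chart_inv_fiber: "chart_inv B U \<phi> (\<theta>, x) \<in> bfiber B \<theta>"
proof -
  have m: "(\<theta>, x) \<in> \<phi> ` bover B U"
    using assms chart_image by auto
  show 1: "\<phi> (chart_inv B U \<phi> (\<theta>, x)) = (\<theta>, x)"
    using f_inv_into_f[OF m] .
  show 2: "chart_inv B U \<phi> (\<theta>, x) \<in> bover B U"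
    using inv_into_into[OF m] .
  show 3: "bproj B (chart_inv B U \<phi> (\<theta>, x)) = \<theta>"
    using chart_fst[OF 2] 1 by simp
  show "chart_inv B U \<phi> (\<theta>, x) \<in> bfiber B \<theta>"
    using 2 3 by (auto simp: bover_def)
qed

lemma bnorm_chart: "v \<in> bover B U \<Longrightarrow> bnorm B v = L2_set (snd (\<phi> v)) {..<rk}"
  using bnorm_eq[OF bb chart] .

lemma bnorm_0_iff: "v \<in> bover B U \<Longrightarrow> bnorm B v = 0 \<longleftrightarrow> snd (\<phi> v) = (\<lambda>i. 0)"
  using bnorm_chart L2_set_0_iff[OF chart_coord] by simp

lemma chart_linear: "\<theta> \<in> U \<Longrightarrow> linear_on_fiber B \<theta> (\<lambda>v. snd (\<phi> v))"
  using local_triv by (simp add: local_trivialization_def)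

text \<open>Over a contractible base the pullback of \<open>E\<close> along \<open>g\<close>, with
  its nonzero vectors, is a single fiber up to homotopy. The map \<open>f\<close> reads the fiber
  coordinate, \<open>k\<close> puts it into the fiber over the center \<open>a\<close> of the
  contraction, and \<open>H\<close> moves the base point while the coordinate stays fixed.\<close>

lemma pullback_chart:
  fixes Y :: "'y topology"
  assumes g: "continuous_map Y (subtopology M U) g"
    and Y: "contractible_space Y" "topspace Y \<noteq> {}"
    and z: "singular_relcycle p (subtopology (prod_topology Y E) {(w, e). bproj B e = g w})
              {(w, e). bnorm B e \<noteq> 0} z"
  shows pullback_relboundary:
    "singular_relboundary p (Euclidean_space rk) nonzero (chain_map p (\<lambda>(w, e). snd (\<phi> e)) z) \<longleftrightarrow>
     singular_relboundary p (subtopology (prod_topology Y E) {(w, e). bproj B e = g w}) {(w, e). bnorm B e \<noteq> 0} z"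
   and pullback_halvable:
    "halvable p (Euclidean_space rk) nonzero (chain_map p (\<lambda>(w, e). snd (\<phi> e)) z) \<longleftrightarrow>
     halvable p (subtopology (prod_topology Y E) {(w, e). bproj B e = g w}) {(w, e). bnorm B e \<noteq> 0} z"
   and pullback_relcycle:
    "singular_relcycle p (Euclidean_space rk) nonzero (chain_map p (\<lambda>(w, e). snd (\<phi> e)) z)"
proof -
  define P where "P = subtopology (prod_topology Y E) {(w, e). bproj B e = g w}"
  \<comment> \<open>The intersection with the space is taken because the maps are controlled only on
    points of \<open>P\<close>, whereas a map of pairs is required to send all of \<open>N\<close>
    into its target.\<close>
  define N where "N = topspace P \<inter> {(w :: 'y, e). bnorm B e \<noteq> 0}"
  define f where "f = (\<lambda>(w :: 'y, e). snd (\<phi> e))"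
  have NsubP: "N \<subseteq> topspace P"
    by (simp add: N_def)
  have zN: "singular_relcycle p P N z"
    using z unfolding P_def N_def singular_relcycle_restrict .
  have gU: "g w \<in> U" if "w \<in> topspace Y" for w
    using continuous_map_in[OF g that] by simp
  have overP: "e \<in> bover B U" "bproj B e = g w" "w \<in> topspace Y" if "(w, e) \<in> topspace P" for w e
    using that gU[of w] by (simp_all add: P_def bover_def)
  have fstP: "continuous_map P Y fst"
    unfolding P_def by (simp add: continuous_map_from_subtopology continuous_map_fst)
  have sndP: "continuous_map P (subtopology E (bover B U)) snd"
    unfolding continuous_map_in_subtopology
  proof
    show "continuous_map P E snd"
      unfolding P_def by (simp add: continuous_map_from_subtopology continuous_map_snd)
    show "snd \<in> topspace P \<rightarrow> bover B U"
      using overP(1) by (metis funcsetI prod.collapse)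
  qed
  have f: "continuous_map P (Euclidean_space rk) f"
    using continuous_map_compose[OF sndP chart_coord_cont] by (simp add: f_def o_def case_prod_unfold)
  have fN: "f \<in> N \<rightarrow> nonzero"
  proof
    fix q assume "q \<in> N"
    then have q: "(fst q, snd q) \<in> topspace P" "bnorm B (snd q) \<noteq> 0"
      by (auto simp: N_def)
    then show "f q \<in> nonzero"
      using bnorm_0_iff[OF overP(1)[OF q(1)]] by (simp add: f_def case_prod_unfold)
  qed
  obtain a where a: "homotopic_with (\<lambda>_. True) Y Y id (\<lambda>_. a)"
    using Y(1) by (auto simp: contractible_space_def)
  then obtain h where h: "continuous_map (prod_topology (top_of_set {0..1::real}) Y) Y h"
    and h0: "\<And>y. h (0, y) = y" and h1: "\<And>y. h (1, y) = a"
    by (auto simp: homotopic_with_def)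
  have aY: "a \<in> topspace Y"
  proof -
    obtain y where "y \<in> topspace Y"
      using Y(2) by blast
    then have "(1, y) \<in> topspace (prod_topology (top_of_set {0..1::real}) Y)"
      by simp
    then have "h (1, y) \<in> topspace Y"
      by (rule continuous_map_in[OF h])
    then show ?thesis
      by (simp add: h1)
  qed
  define k where "k = (\<lambda>x. (a, chart_inv B U \<phi> (g a, x)))"
  have k: "continuous_map (Euclidean_space rk) P k"
  proof -
    have "continuous_map (Euclidean_space rk) (prod_topology (subtopology M U) (Euclidean_space rk)) (\<lambda>x. (g a, x))"
      using gU[OF aY] chart_sub by (simp add: continuous_map_pairwise o_def subsetD)
    from continuous_map_compose[OF this chart_inv_cont]
    have "continuous_map (Euclidean_space rk) E (\<lambda>x. chart_inv B U \<phi> (g a, x))"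
      by (simp add: o_def continuous_map_in_subtopology)
    then show ?thesis
      unfolding P_def k_def continuous_map_in_subtopology
      using aY chart_inv_proj[OF gU[OF aY]] by (simp add: continuous_map_pairwise o_def)
  qed
  have kN: "k \<in> (topspace (Euclidean_space rk) \<inter> nonzero) \<rightarrow> N"
  proof
    fix x assume x: "x \<in> topspace (Euclidean_space rk) \<inter> nonzero"
    then have "k x \<in> topspace P"
      using continuous_map_in[OF k] by simp
    moreover have "bnorm B (chart_inv B U \<phi> (g a, x)) \<noteq> 0"
      using bnorm_0_iff[OF chart_inv_over[OF gU[OF aY]]] chart_right[OF gU[OF aY]] x by simp
    ultimately show "k x \<in> N"
      by (simp add: N_def k_def)
  qed
  define H where "H = (\<lambda>q :: real \<times> 'y \<times> 'e. (h (fst q, fst (snd q)),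
     chart_inv B U \<phi> (g (h (fst q, fst (snd q))), snd (\<phi> (snd (snd q))))))"
  let ?I = "top_of_set {0..1::real}"
  have hq: "continuous_map (prod_topology ?I P) Y (\<lambda>q. h (fst q, fst (snd q)))"
  proof -
    have "continuous_map (prod_topology ?I P) (prod_topology ?I Y) (\<lambda>q. (fst q, fst (snd q)))"
      using continuous_map_compose[OF continuous_map_snd fstP]
      by (simp add: continuous_map_pairwise o_def continuous_map_fst)
    from continuous_map_compose[OF this h] show ?thesis
      by (simp add: o_def)
  qed
  have Hc: "continuous_map (prod_topology ?I P) (prod_topology Y E) H"
  proof -
    have "continuous_map (prod_topology ?I P) (subtopology M U) (\<lambda>q. g (h (fst q, fst (snd q))))"
      using continuous_map_compose[OF hq g] by (simp add: o_def)
    moreover have "continuous_map (prod_topology ?I P) (Euclidean_space rk) (\<lambda>q. snd (\<phi> (snd (snd q))))"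
      using continuous_map_compose[OF continuous_map_compose[OF continuous_map_snd sndP] chart_coord_cont]
      by (simp add: o_def)
    ultimately have "continuous_map (prod_topology ?I P) (prod_topology (subtopology M U) (Euclidean_space rk))
       (\<lambda>q. (g (h (fst q, fst (snd q))), snd (\<phi> (snd (snd q)))))"
      by (simp add: continuous_map_pairwise o_def)
    from continuous_map_compose[OF this chart_inv_cont]
    have "continuous_map (prod_topology ?I P) E
       (\<lambda>q. chart_inv B U \<phi> (g (h (fst q, fst (snd q))), snd (\<phi> (snd (snd q)))))"
      by (simp add: o_def continuous_map_in_subtopology)
    then show ?thesis
      using hq by (simp add: H_def continuous_map_pairwise o_def)
  qed
  have Hfacts: "bproj B (snd (H (t, w, e))) = g (fst (H (t, w, e)))"
    "bnorm B (snd (H (t, w, e))) = bnorm B e" "H (0, w, e) = (w, e)" "H (1, w, e) = k (f (w, e))"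
    if "t \<in> {0..1}" "(w, e) \<in> topspace P" for t w e
  proof -
    note o = overP[OF that(2)]
    have "(t, w) \<in> topspace (prod_topology (top_of_set {0..1::real}) Y)"
      using that o by simp
    then have "h (t, w) \<in> topspace Y"
      by (rule continuous_map_in[OF h])
    note gh = gU[OF this] and ce = chart_coord[OF o(1)]
    show "bproj B (snd (H (t, w, e))) = g (fst (H (t, w, e)))"
      using chart_inv_proj[OF gh ce] by (simp add: H_def)
    \<comment> \<open>The norm is the Euclidean norm of the coordinate in every fiber over
      \<open>U\<close>. So moving with a fixed coordinate keeps nonzero vectors nonzero.\<close>
    show "bnorm B (snd (H (t, w, e))) = bnorm B e"
      using bnorm_chart[OF chart_inv_over[OF gh ce]] chart_right[OF gh ce] bnorm_chart[OF o(1)]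
      by (simp add: H_def)
    show "H (0, w, e) = (w, e)"
      using chart_left[OF o(1), unfolded o(2)] by (simp add: H_def h0)
    show "H (1, w, e) = k (f (w, e))"
      by (simp add: H_def h1 k_def f_def)
  qed
  have HP: "continuous_map (prod_topology ?I P) P H"
  proof -
    have "H \<in> topspace (prod_topology ?I P) \<rightarrow> {(w, e). bproj B e = g w}"
    proof
      fix q assume "q \<in> topspace (prod_topology ?I P)"
      then have "fst q \<in> {0..1}" "(fst (snd q), snd (snd q)) \<in> topspace P"
        by auto
      from Hfacts(1)[OF this] show "H q \<in> {(w, e). bproj B e = g w}"
        by (simp add: case_prod_unfold)
    qed
    with Hc have "continuous_map (prod_topology ?I P) (subtopology (prod_topology Y E) {(w, e). bproj B e = g w}) H"
      unfolding continuous_map_in_subtopology by blast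
    then show ?thesis
      by (simp only: P_def)
  qed
  have "homotopic_with (\<lambda>h. h \<in> N \<rightarrow> N) P P id (k \<circ> f)"
  proof (subst homotopic_with)
    \<comment> \<open>The side condition of a homotopy has to depend only on values at points of
      \<open>P\<close>; this holds because \<open>N\<close> consists of such points.\<close>
    show "(h1 \<in> N \<rightarrow> N) = (h2 \<in> N \<rightarrow> N)" if "\<And>x. x \<in> topspace P \<Longrightarrow> h1 x = h2 x" for h1 h2
      using that NsubP by (metis (no_types, lifting) Pi_cong subsetD)
    have "(\<lambda>q. H (t, q)) \<in> N \<rightarrow> N" if "t \<in> {0..1}" for t
    proof
      fix q assume q: "q \<in> N"
      obtain w e where [simp]: "q = (w, e)" by (cases q)
      have "(w, e) \<in> topspace P" "bnorm B e \<noteq> 0"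
        using q by (auto simp: N_def)
      moreover from this that have "(t, w, e) \<in> topspace (prod_topology ?I P)"
        by simp
      then have "H (t, w, e) \<in> topspace P"
        by (rule continuous_map_in[OF HP])
      ultimately have "H (t, w, e) \<in> topspace P" "bnorm B (snd (H (t, w, e))) \<noteq> 0"
        using Hfacts(2)[OF that] by simp_all
      then show "H (t, q) \<in> N"
        by (simp add: N_def case_prod_unfold)
    qed
    moreover have "H (0, x) = id x" "H (1, x) = (k \<circ> f) x" if "x \<in> topspace P" for x
      using Hfacts(3)[of 0 "fst x" "snd x"] Hfacts(4)[of 1 "fst x" "snd x"] that by simp_all
    ultimately show "\<exists>h. continuous_map (prod_topology ?I P) P h \<and> (\<forall>x\<in>topspace P. h (0, x) = id x) \<and>
       (\<forall>x\<in>topspace P. h (1, x) = (k \<circ> f) x) \<and> (\<forall>t\<in>{0..1}. (\<lambda>x. h (t, x)) \<in> N \<rightarrow> N)"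
      using HP by blast
  qed
  then have kf: "homotopic_with (\<lambda>h. h \<in> N \<rightarrow> N) P P (k \<circ> f) id"
    by (simp add: homotopic_with_sym)
  have fN': "f \<in> N \<rightarrow> topspace (Euclidean_space rk) \<inter> nonzero"
  proof
    fix q assume q: "q \<in> N"
    show "f q \<in> topspace (Euclidean_space rk) \<inter> nonzero"
      using funcset_mem[OF fN q] continuous_map_in[OF f subsetD[OF NsubP q]] by (rule IntI[rotated])
  qed
  have NP: "halvable p P N z \<longleftrightarrow> halvable p P {(w, e). bnorm B e \<noteq> 0} z"
    by (simp only: halvable_def homologous_rel_restrict singular_relcycle_restrict N_def)
  have NE: "halvable p (Euclidean_space rk) (topspace (Euclidean_space rk) \<inter> nonzero) y \<longleftrightarrow>
      halvable p (Euclidean_space rk) nonzero y" for y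
    by (simp only: halvable_def homologous_rel_restrict singular_relcycle_restrict)
  show "singular_relboundary p (Euclidean_space rk) nonzero (chain_map p (\<lambda>(w, e). snd (\<phi> e)) z) \<longleftrightarrow>
     singular_relboundary p (subtopology (prod_topology Y E) {(w, e). bproj B e = g w}) {(w, e). bnorm B e \<noteq> 0} z"
    using relboundary_homotopy_equivalence[OF f fN' k kN kf zN]
    by (simp only: f_def P_def N_def singular_relboundary_restrict)
  show "halvable p (Euclidean_space rk) nonzero (chain_map p (\<lambda>(w, e). snd (\<phi> e)) z) \<longleftrightarrow>
     halvable p (subtopology (prod_topology Y E) {(w, e). bproj B e = g w}) {(w, e). bnorm B e \<noteq> 0} z"
    using halvable_homotopy_equivalence[OF f fN' k kN kf zN] NP NE
    by (simp only: f_def P_def)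
  show "singular_relcycle p (Euclidean_space rk) nonzero (chain_map p (\<lambda>(w, e). snd (\<phi> e)) z)"
    using singular_relcycle_chain_map[OF zN f fN] by (simp add: f_def)
qed

end

lemma bnorm_nonneg: "e \<in> topspace E \<Longrightarrow> bnorm B e \<ge> 0"
proof -
  assume e: "e \<in> topspace E"
  obtain U \<phi> where U: "(U, \<phi>) \<in> btriv B" "bproj B e \<in> U"
    using chart_ex[OF proj_in[OF e]] by blast
  then show ?thesis
    using bnorm_chart[OF U(1), of e] e by (simp add: bover_def L2_set_nonneg)
qed

lemma bnorm_cont: "continuous_map E euclideanreal (bnorm B)"
proof (rule pasting_lemma[where I = "btriv B" and T = "\<lambda>(U, \<phi>). bover B U" and f = "\<lambda>_. bnorm B"])
  show "openin E (case i of (U, \<phi>) \<Rightarrow> bover B U)" if "i \<in> btriv B" for i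
    using that over_open by (cases i) auto
  show "continuous_map (subtopology E (case i of (U, \<phi>) \<Rightarrow> bover B U)) euclideanreal (bnorm B)"
    if i: "i \<in> btriv B" for i
  proof -
    obtain U \<phi> where U: "(U, \<phi>) \<in> btriv B" "i = (U, \<phi>)"
      using i by (cases i) auto
    have "continuous_map (subtopology E (bover B U)) euclideanreal (bnorm B)"
      by (rule continuous_map_eq[OF continuous_map_L2_set[OF chart_coord_cont[OF U(1)], of rk]])
        (simp add: bnorm_chart[OF U(1)])
    then show ?thesis
      by (simp add: U(2))
  qed
  show "\<exists>j. j \<in> btriv B \<and> x \<in> (case j of (U, \<phi>) \<Rightarrow> bover B U) \<and> bnorm B x = bnorm B x"
    if "x \<in> topspace E" for x
    using chart_ex[OF proj_in[OF that]] that by (force simp: bover_def)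
qed auto

end

subsection \<open>Convex subsets of the domain of a homotopy\<close>

definition mix :: "real \<Rightarrow> real \<times> (nat \<Rightarrow> real) \<Rightarrow> real \<times> (nat \<Rightarrow> real) \<Rightarrow> real \<times> (nat \<Rightarrow> real)" where
  "mix t p q = ((1 - t) * fst p + t * fst q, \<lambda>i. (1 - t) * snd p i + t * snd q i)"

definition mconvex :: "(real \<times> (nat \<Rightarrow> real)) set \<Rightarrow> bool" where
  "mconvex K \<longleftrightarrow> (\<forall>p\<in>K. \<forall>q\<in>K. \<forall>t\<in>{0..1}. mix t p q \<in> K)"

text \<open>Hulls serve as carriers: they grow with \<open>C\<close>, remain in every convex set
  around \<open>C\<close> and are contractible, whereas the image of a simplex itself need not
  be.\<close>

definition mhull :: "(real \<times> (nat \<Rightarrow> real)) set \<Rightarrow> (real \<times> (nat \<Rightarrow> real)) set" where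
  "mhull C = \<Inter>{K. mconvex K \<and> C \<subseteq> K}"

lemma mconvex_mhull: "mconvex (mhull C)"
  unfolding mhull_def mconvex_def by blast

lemma subset_mhull: "C \<subseteq> mhull C"
  unfolding mhull_def by blast

lemma mhull_minimal: "mconvex K \<Longrightarrow> C \<subseteq> K \<Longrightarrow> mhull C \<subseteq> K"
  unfolding mhull_def by blast

lemma mhull_mono: "C \<subseteq> D \<Longrightarrow> mhull C \<subseteq> mhull D"
  unfolding mhull_def by blast

lemma mconvex_Int: "mconvex K \<Longrightarrow> mconvex L \<Longrightarrow> mconvex (K \<inter> L)"
  unfolding mconvex_def by blast

lemma mconvex_Times:
  assumes "convex I" and "\<And>x y t. x \<in> S \<Longrightarrow> y \<in> S \<Longrightarrow> t \<in> {0..1} \<Longrightarrow> (\<lambda>i. (1 - t) * x i + t * y i) \<in> S"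
  shows "mconvex (I \<times> S)"
  unfolding mconvex_def mix_def
proof (intro ballI)
  fix p q t assume a: "p \<in> I \<times> S" "q \<in> I \<times> S" "t \<in> {0..1 :: real}"
  have "(1 - t) * fst p + t * fst q \<in> I"
    using convexD_alt[OF assms(1), of "fst p" "fst q" t] a by auto
  then show "((1 - t) * fst p + t * fst q, \<lambda>i. (1 - t) * snd p i + t * snd q i) \<in> I \<times> S"
    using assms(2)[of "snd p" "snd q" t] a by auto
qed

lemma contractible_mconvex:
  assumes K: "mconvex K" "K \<subseteq> UNIV \<times> topspace (Euclidean_space n)"
  shows "contractible_space (subtopology (prod_topology euclideanreal (Euclidean_space n)) K)"
proof (cases "K = {}")
  case True
  then show ?thesis
    by (simp add: contractible_space_empty)
next
  case False
  then obtain c where c: "c \<in> K" by blast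
  let ?X = "prod_topology euclideanreal (Euclidean_space n)"
  let ?Y = "subtopology ?X K"
  let ?I = "top_of_set {0..1::real}"
  have snd0: "snd p i = 0" if "p \<in> K" "i \<ge> n" for p i
    using K(2) that by (auto simp: topspace_Euclidean_space)
  have tf: "continuous_map (prod_topology ?I ?Y) euclideanreal fst"
    by (meson continuous_map_fst continuous_map_into_fulltopology)
  have sY: "continuous_map (prod_topology ?I ?Y) ?X snd"
    by (meson continuous_map_snd continuous_map_into_fulltopology)
  have f: "continuous_map (prod_topology ?I ?Y) euclideanreal (\<lambda>q. fst (snd q))"
    using continuous_map_compose[OF sY continuous_map_fst] by (simp add: o_def)
  have s: "continuous_map (prod_topology ?I ?Y) (Euclidean_space n) (\<lambda>q. snd (snd q))"
    using continuous_map_compose[OF sY continuous_map_snd] by (simp add: o_def)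
  have topY: "topspace ?Y = K"
    using K(2) by auto
  have 1: "continuous_map (prod_topology ?I ?Y) euclideanreal (\<lambda>q. (1 - fst q) * fst (snd q) + fst q * fst c)"
    by (intro continuous_map_add continuous_map_real_mult continuous_map_diff tf f) auto
  have 2: "continuous_map (prod_topology ?I ?Y) (Euclidean_space n)
     (\<lambda>q i. (1 - fst q) * snd (snd q) i + fst q * snd c i)"
  proof (rule continuous_map_into_Euclidean)
    show "continuous_map (prod_topology ?I ?Y) euclideanreal
       (\<lambda>q. (1 - fst q) * snd (snd q) i + fst q * snd c i)" for i
      by (intro continuous_map_add continuous_map_real_mult continuous_map_diff tf
          continuous_map_Euclidean_coordinate[OF s]) auto
    show "(1 - fst q) * snd (snd q) i + fst q * snd c i = 0"
      if "q \<in> topspace (prod_topology ?I ?Y)" "n \<le> i" for q i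
    proof -
      have "snd q \<in> K"
        using that(1) topY by (metis mem_Times_iff topspace_prod_topology)
      then show ?thesis
        using snd0[OF _ that(2)] c by simp
    qed
  qed
  have "continuous_map (prod_topology ?I ?Y) ?X (\<lambda>q. mix (fst q) (snd q) c)"
    unfolding mix_def using 1 2 by (simp add: continuous_map_pairwise o_def)
  moreover have "mix (fst q) (snd q) c \<in> K" if "q \<in> topspace (prod_topology ?I ?Y)" for q
  proof -
    have "fst q \<in> {0..1}" "snd q \<in> K"
      using that topY by (metis mem_Times_iff topspace_prod_topology topspace_euclidean_subtopology)+
    then show ?thesis
      using K(1) c unfolding mconvex_def by blast
  qed
  ultimately have "continuous_map (prod_topology ?I ?Y) ?Y (\<lambda>q. mix (fst q) (snd q) c)"
    unfolding continuous_map_in_subtopology by blast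
  then have "homotopic_with (\<lambda>_. True) ?Y ?Y id (\<lambda>_. c)"
    unfolding homotopic_with_def by (intro exI[of _ "\<lambda>q. mix (fst q) (snd q) c"]) (simp add: mix_def)
  then show ?thesis
    unfolding contractible_space_def by blast
qed

text \<open>A basic open set of the product topology restricts finitely many coordinates, each of
  which can be narrowed to an interval around that of \<open>x\<close>.\<close>

lemma convex_box_nbhd:
  assumes "openin (powertop_real UNIV) S" "x \<in> S"
  obtains V where "openin (powertop_real UNIV) V" "x \<in> V" "V \<subseteq> S"
    "\<And>y z t. y \<in> V \<Longrightarrow> z \<in> V \<Longrightarrow> t \<in> {0..1} \<Longrightarrow> (\<lambda>i. (1 - t) * y i + t * z i) \<in> V"
proof -
  obtain U where U: "finite {i. U i \<noteq> (UNIV :: real set)}" "\<And>i. open (U i)" "x \<in> Pi\<^sub>E UNIV U" "Pi\<^sub>E UNIV U \<subseteq> S"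
    using assms unfolding openin_product_topology_alt by auto
  have "\<exists>e>0. ball (x i) e \<subseteq> U i" for i
    using U(2,3) by (auto simp: open_contains_ball PiE_iff)
  then obtain e where e: "\<And>i. e i > 0" "\<And>i. ball (x i) (e i) \<subseteq> U i"
    by metis
  \<comment> \<open>Coordinates that \<open>U\<close> leaves free stay free, so that again only
    finitely many are restricted.\<close>
  define B where "B = (\<lambda>i. if U i = UNIV then UNIV else ball (x i) (e i))"
  have cB: "convex (B i)" for i
    by (simp add: B_def)
  show ?thesis
  proof
    have "finite {i. B i \<noteq> UNIV}"
      by (rule finite_subset[OF _ U(1)]) (auto simp: B_def)
    then show "openin (powertop_real UNIV) (Pi\<^sub>E UNIV B)"
      unfolding openin_product_topology_alt by (auto simp: B_def intro!: exI[of _ B])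
    show "x \<in> Pi\<^sub>E UNIV B"
      using e(1) by (auto simp: B_def)
    have "Pi\<^sub>E UNIV B \<subseteq> Pi\<^sub>E UNIV U"
      using e(2) by (intro PiE_mono) (auto simp: B_def)
    then show "Pi\<^sub>E UNIV B \<subseteq> S"
      using U(4) by blast
    show "(\<lambda>i. (1 - t) * y i + t * z i) \<in> Pi\<^sub>E UNIV B"
      if "y \<in> Pi\<^sub>E UNIV B" "z \<in> Pi\<^sub>E UNIV B" "t \<in> {0..1}" for y z t
      using that convexD_alt[OF cB] by (auto simp: PiE_iff)
  qed
qed

lemma mconvex_nbhd:
  assumes O: "openin (prod_topology euclideanreal (Euclidean_space n)) S" and p: "p \<in> S"
  obtains V where "openin (prod_topology euclideanreal (Euclidean_space n)) V" "p \<in> V" "V \<subseteq> S" "mconvex V"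
proof -
  obtain A C where AC: "open A" "openin (Euclidean_space n) C" "fst p \<in> A" "snd p \<in> C" "A \<times> C \<subseteq> S"
    using O p unfolding openin_prod_topology_alt by (metis open_openin prod.collapse)
  obtain e where e: "e > 0" "ball (fst p) e \<subseteq> A"
    using AC by (auto simp: open_contains_ball)
  obtain C' where C': "openin (powertop_real UNIV) C'" "C = C' \<inter> {x. \<forall>i\<ge>n. x i = 0}"
    using AC(2) unfolding Euclidean_space_def openin_subtopology by auto
  obtain V where V: "openin (powertop_real UNIV) V" "snd p \<in> V" "V \<subseteq> C'"
    "\<And>y z t. y \<in> V \<Longrightarrow> z \<in> V \<Longrightarrow> t \<in> {0..1} \<Longrightarrow> (\<lambda>i. (1 - t) * y i + t * z i) \<in> V"
    using convex_box_nbhd[OF C'(1), of "snd p"] AC(4) C'(2) by blast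
  let ?V = "V \<inter> {x. \<forall>i\<ge>n. x i = 0}"
  show ?thesis
  proof
    have "openin (Euclidean_space n) ?V"
      unfolding Euclidean_space_def openin_subtopology using V(1) by blast
    then show "openin (prod_topology euclideanreal (Euclidean_space n)) (ball (fst p) e \<times> ?V)"
      by (simp add: openin_prod_Times_iff)
    show "p \<in> ball (fst p) e \<times> ?V"
      using e V(2) AC(4) C'(2) by (auto simp: mem_Times_iff)
    show "ball (fst p) e \<times> ?V \<subseteq> S"
      using e V(3) AC(5) C'(2) by blast
    show "mconvex (ball (fst p) e \<times> ?V)"
      by (rule mconvex_Times) (auto intro: V(4))
  qed
qed

subsection \<open>Iterated subdivision\<close>

lemma singular_chain_iterated_subdivision:
  "singular_chain p X c \<Longrightarrow> singular_chain p X ((singular_subdivision p ^^ m) c)"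
  by (induction m) (auto simp: singular_chain_singular_subdivision)

lemma chain_boundary_iterated_subdivision:
  "singular_chain p X c \<Longrightarrow>
    chain_boundary p ((singular_subdivision p ^^ m) c) = (singular_subdivision (p - Suc 0) ^^ m) (chain_boundary p c)"
  by (induction m)
    (simp_all add: chain_boundary_singular_subdivision[OF singular_chain_iterated_subdivision])

lemma naturality_iterated_subdivision:
  "singular_chain p X c \<Longrightarrow>
    (singular_subdivision p ^^ m) (chain_map p g c) = chain_map p g ((singular_subdivision p ^^ m) c)"
  by (induction m)
    (simp_all add: naturality_singular_subdivision[OF singular_chain_iterated_subdivision])

lemma homologous_rel_iterated_subdivision:
  assumes "singular_relcycle p X S c"
  shows "homologous_rel p X S ((singular_subdivision p ^^ m) c) c"
proof (induction m)
  case (Suc m)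
  then have "singular_relcycle p X S ((singular_subdivision p ^^ m) c)"
    using assms homologous_rel_singular_relcycle by blast
  from homologous_rel_singular_subdivision[OF this] Suc show ?case
    by (simp add: homologous_rel_trans)
qed simp

subsection \<open>A generator in the unit ball\<close>

definition ball_n :: "nat \<Rightarrow> (nat \<Rightarrow> real) set" where
  "ball_n n = {x \<in> topspace (Euclidean_space n). L2_set x {..<n} \<le> 1}"

definition sphere_n :: "nat \<Rightarrow> (nat \<Rightarrow> real) set" where
  "sphere_n n = {x \<in> topspace (Euclidean_space n). L2_set x {..<n} = 1}"

text \<open>A simplex is compact, so the norm attains a positive minimum on its image, and a chain
  involves finitely many simplices.\<close>

lemma singular_chain_norm_bound:
  assumes c: "singular_chain p (subtopology (Euclidean_space n) nonzero) c"
  obtains r where "r > 0" "singular_chain p (subtopology (Euclidean_space n) {x. L2_set x {..<n} \<ge> r}) c"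
proof -
  have simp_bound: "\<exists>r>0. \<forall>x\<in>f ` standard_simplex p. L2_set x {..<n} \<ge> r"
    if "f \<in> Poly_Mapping.keys c" for f
  proof -
    have f: "singular_simplex p (Euclidean_space n) f" "f ` standard_simplex p \<subseteq> nonzero"
      using c that by (auto simp: singular_chain_def singular_simplex_subtopology)
    let ?D = "subtopology (powertop_real UNIV) (standard_simplex p)"
    have cf: "continuous_map ?D (Euclidean_space n) f"
      using f(1) by (simp add: singular_simplex_def)
    have "compactin ?D (standard_simplex p)"
      using compactin_standard_simplex by (simp add: compactin_subtopology)
    then have "compactin euclideanreal ((\<lambda>x. L2_set (f x) {..<n}) ` standard_simplex p)"
      using image_compactin continuous_map_L2_set[OF cf] by blast
    then have cpt: "compact ((\<lambda>x. L2_set (f x) {..<n}) ` standard_simplex p)"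
      by simp
    then obtain m where m: "m \<in> standard_simplex p" "\<And>x. x \<in> standard_simplex p \<Longrightarrow> L2_set (f m) {..<n} \<le> L2_set (f x) {..<n}"
      using compact_attains_inf[OF cpt] nonempty_standard_simplex by auto
    have "f m \<in> topspace (Euclidean_space n)"
      using continuous_map_in[OF cf] m(1) by simp
    then have "L2_set (f m) {..<n} \<noteq> 0"
      using L2_set_0_iff f(2) m(1) by blast
    then have "L2_set (f m) {..<n} > 0"
      using L2_set_nonneg[of "f m" "{..<n}"] by linarith
    then show ?thesis
      using m(2) by blast
  qed
  then obtain r where r: "\<And>f. f \<in> Poly_Mapping.keys c \<Longrightarrow> r f > 0 \<and> (\<forall>x\<in>f ` standard_simplex p. L2_set x {..<n} \<ge> r f)"
    by metis
  \<comment> \<open>The element 1 keeps the minimum meaningful when the chain is 0.\<close>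
  define r0 where "r0 = Min (insert 1 (r ` Poly_Mapping.keys c))"
  have fin: "finite (insert 1 (r ` Poly_Mapping.keys c))" by simp
  have "r0 > 0"
    unfolding r0_def using r by (subst Min_gr_iff[OF fin]) auto
  moreover have "L2_set x {..<n} \<ge> r0" if "f \<in> Poly_Mapping.keys c" "x \<in> f ` standard_simplex p" for f x
  proof -
    have "r0 \<le> r f"
      unfolding r0_def using that by (intro Min_le fin) auto
    also have "\<dots> \<le> L2_set x {..<n}"
      using r that by blast
    finally show ?thesis .
  qed
  then have "singular_chain p (subtopology (Euclidean_space n) {x. L2_set x {..<n} \<ge> r0}) c"
    using c unfolding singular_chain_subtopology by blast
  ultimately show ?thesis
    using that by blast
qed

text \<open>Divisibility is a homotopy invariant. So a cycle that is not halvable can be squeezed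
  into the ball by a map that is homotopic to the identity through maps preserving the nonzero
  vectors.\<close>

lemma generator_in_ball:
  assumes n: "n > 0"
  obtains b where "singular_chain n (subtopology (Euclidean_space n) (ball_n n)) b"
    "singular_chain (n - Suc 0) (subtopology (Euclidean_space n) (sphere_n n)) (chain_boundary n b)"
    "\<not> halvable n (Euclidean_space n) nonzero b"
proof -
  let ?E = "Euclidean_space n"
  obtain z where z: "singular_relcycle n ?E nonzero z" "\<not> halvable n ?E nonzero z"
    using not_halvable_exists[OF Euclidean_nonzero_homology_top[OF n]] by blast
  have zc: "singular_chain n ?E z" and zb: "singular_chain (n - Suc 0) (subtopology ?E nonzero) (chain_boundary n z)"
    using z(1) by (auto simp: singular_relcycle)
  obtain r where r: "r > 0" "singular_chain (n - Suc 0) (subtopology ?E {x. L2_set x {..<n} \<ge> r}) (chain_boundary n z)"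
    using singular_chain_norm_bound[OF zb] by blast
  \<comment> \<open>Division by the larger of \<open>r\<close> and the norm is continuous at zero,
    sends everything into the ball, and normalizes wherever the norm is at least \<open>r\<close>,
    as it is on the boundary of \<open>z\<close>.\<close>
  define c where "c = (\<lambda>x. 1 / max r (L2_set x {..<n}))"
  define f where "f = (\<lambda>x i. c x * x i :: real)"
  have cpos: "c x > 0" for x
    using r(1) by (simp add: c_def less_max_iff_disj)
  have idc: "continuous_map ?E ?E (\<lambda>x. x)"
    by simp
  have mpos: "max r (L2_set x {..<n}) > 0" for x
    using r(1) by (meson less_le_trans max.cobounded1)
  have cc: "continuous_map ?E euclideanreal c"
    unfolding c_def using mpos
    by (intro continuous_map_real_divide continuous_map_real_max continuous_map_L2_set[OF idc])
      (auto simp: less_imp_neq[symmetric])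
  have fE: "continuous_map ?E ?E f"
    unfolding f_def
    by (intro continuous_map_into_Euclidean continuous_map_real_mult cc continuous_map_Euclidean_coordinate[OF idc])
      (simp add: topspace_Euclidean_space)
  have fnorm: "L2_set (f x) {..<n} = L2_set x {..<n} / max r (L2_set x {..<n})" for x
    using L2_set_scale[of "c x" x "{..<n}"] by (simp add: f_def abs_of_pos[OF cpos]) (simp add: c_def)
  have fball: "continuous_map ?E (subtopology ?E (ball_n n)) f"
    unfolding continuous_map_in_subtopology
  proof (intro conjI fE funcsetI)
    fix x assume "x \<in> topspace ?E"
    moreover have "L2_set (f x) {..<n} \<le> 1"
      using mpos[of x] by (simp add: fnorm)
    ultimately show "f x \<in> ball_n n"
      using continuous_map_in[OF fE] by (simp add: ball_n_def)
  qed
  have fsph: "continuous_map (subtopology ?E {x. L2_set x {..<n} \<ge> r}) (subtopology ?E (sphere_n n)) f"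
    unfolding continuous_map_in_subtopology
  proof (intro conjI continuous_map_from_subtopology fE funcsetI)
    fix x assume x: "x \<in> topspace (subtopology ?E {x. L2_set x {..<n} \<ge> r})"
    then have "L2_set (f x) {..<n} = 1"
      using r(1) by (auto simp: fnorm max_def)
    then show "f x \<in> sphere_n n"
      using continuous_map_in[OF fE] x by (simp add: sphere_n_def)
  qed
  have "homotopic_with (\<lambda>h. h \<in> nonzero \<rightarrow> nonzero) ?E ?E f id"
    unfolding homotopic_with_def
  proof (intro exI conjI allI ballI)
    let ?I = "top_of_set {0..1::real}"
    let ?h = "\<lambda>q i. (1 - fst q) * f (snd q) i + fst q * (snd q i :: real)"
    have tf: "continuous_map (prod_topology ?I ?E) euclideanreal fst"
      by (meson continuous_map_fst continuous_map_into_fulltopology)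
    show "continuous_map (prod_topology ?I ?E) ?E ?h"
    proof (rule continuous_map_into_Euclidean)
      show "continuous_map (prod_topology ?I ?E) euclideanreal (\<lambda>q. (1 - fst q) * f (snd q) i + fst q * snd q i)" for i
        by (intro continuous_map_add continuous_map_real_mult continuous_map_diff tf
          continuous_map_Euclidean_coordinate[OF continuous_map_snd]
          continuous_map_Euclidean_coordinate[OF continuous_map_compose[OF continuous_map_snd fE, unfolded o_def]]) auto
    qed (auto simp: f_def topspace_Euclidean_space)
    show "?h (0, x) = f x" "?h (1, x) = id x" for x
      by simp_all
    fix t :: real assume t: "t \<in> {0..1}"
    show "(\<lambda>x. ?h (t, x)) \<in> nonzero \<rightarrow> nonzero"
    proof
      fix x :: "nat \<Rightarrow> real" assume x: "x \<in> nonzero"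
      have "(1 - t) * c x + t > 0"
        using t cpos[of x] by (cases "t = 0") (auto intro: add_nonneg_pos)
      moreover have "?h (t, x) i = ((1 - t) * c x + t) * x i" for i
        by (simp add: f_def algebra_simps)
      ultimately show "?h (t, x) \<in> nonzero"
        using x by (auto simp: fun_eq_iff)
    qed
  qed
  then have "homologous_rel n ?E nonzero (chain_map n f z) z"
    by (rule homotopic_id_chain_map[OF _ z(1)])
  then have "\<not> halvable n ?E nonzero (chain_map n f z)"
    using halvable_cong z(2) by blast
  moreover have "singular_chain n (subtopology ?E (ball_n n)) (chain_map n f z)"
    by (rule singular_chain_chain_map[OF zc fball])
  moreover have "singular_chain (n - Suc 0) (subtopology ?E (sphere_n n)) (chain_boundary n (chain_map n f z))"
    using singular_chain_chain_map[OF r(2) fsph] chain_boundary_chain_map[OF zc, of f] by simp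
  ultimately show ?thesis
    using that by blast
qed

subsection \<open>Zeros of a section over the cylinder\<close>

abbreviation cylinder :: "nat \<Rightarrow> (real \<times> (nat \<Rightarrow> real)) topology" where
  "cylinder n \<equiv> prod_topology (top_of_set {0..1}) (subtopology (Euclidean_space n) (ball_n n))"

lemma ball_n_sub: "ball_n n \<subseteq> topspace (Euclidean_space n)"
  by (auto simp: ball_n_def)

lemma topspace_cylinder: "topspace (cylinder n) = {0..1} \<times> ball_n n"
  using ball_n_sub by auto

lemma cylinder_subtopology:
  "cylinder n = subtopology (prod_topology euclideanreal (Euclidean_space n)) ({0..1} \<times> ball_n n)"
  by (simp add: prod_topology_subtopology(1) subtopology_subtopology prod_topology_subtopology(2) Times_Int_Times
      Int_absorb1[OF ball_n_sub])

lemma ball_n_convex: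
  assumes "x \<in> ball_n n" "y \<in> ball_n n" "t \<in> {0..1}"
  shows "(\<lambda>i. (1 - t) * x i + t * y i) \<in> ball_n n"
proof -
  have "L2_set (\<lambda>i. (1 - t) * x i + t * y i) {..<n} \<le> L2_set (\<lambda>i. (1 - t) * x i) {..<n} + L2_set (\<lambda>i. t * y i) {..<n}"
    by (rule L2_set_triangle_ineq)
  also have "\<dots> = (1 - t) * L2_set x {..<n} + t * L2_set y {..<n}"
    using assms(3) by (simp add: L2_set_scale)
  also have "\<dots> \<le> (1 - t) * 1 + t * 1"
    using assms by (intro add_mono mult_left_mono) (auto simp: ball_n_def)
  finally show ?thesis
    using assms by (simp add: ball_n_def topspace_Euclidean_space)
qed

lemma mconvex_cylinder: "convex I \<Longrightarrow> mconvex (I \<times> ball_n n)"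
  by (rule mconvex_Times) (auto intro: ball_n_convex)

lemma prod_topology_subtopology_left:
  "prod_topology (subtopology X K) Y = subtopology (prod_topology X Y) (K \<times> UNIV)"
proof -
  have "topspace (prod_topology X Y) \<inter> K \<times> topspace Y = topspace (prod_topology X Y) \<inter> K \<times> UNIV"
    by auto
  then show ?thesis
    unfolding prod_topology_subtopology(1) by (metis subtopology_restrict)
qed

locale bundle_map = banach_bundle n M \<A> B
  for n :: nat and M :: "'a topology" and \<A> :: "'a atlas" and B :: "('a, 'e) vbundle" +
  fixes W :: "(real \<times> (nat \<Rightarrow> real)) set" and G :: "real \<times> (nat \<Rightarrow> real) \<Rightarrow> 'e"
  assumes W: "W \<subseteq> {0..1} \<times> ball_n rk"
    and G: "continuous_map (subtopology (cylinder rk) W) E G"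
    and rk_pos: "rk > 0"
begin

definition zeros :: "(real \<times> (nat \<Rightarrow> real)) set" where
  "zeros = {w \<in> W. bnorm B (G w) = 0}"

text \<open>The pullback over \<open>W\<close> of \<open>E\<close> along the projection of
  \<open>G\<close>. The map from \<open>w\<close> to \<open>(w, G w)\<close> is a section of it, so
  a map that wanders between fibers becomes a section of a bundle over its own domain.\<close>

definition total :: "((real \<times> (nat \<Rightarrow> real)) \<times> 'e) topology" where
  "total = subtopology (prod_topology (cylinder rk) E) {(w, e). w \<in> W \<and> bproj B e = bproj B (G w)}"

text \<open>The condition is put on the hull, since the contractible carrier of \<open>C\<close> is
  the part of the pullback over its hull.\<close>

definition good :: "(real \<times> (nat \<Rightarrow> real)) set \<Rightarrow> bool" where
  "good C \<longleftrightarrow> mhull C \<subseteq> W \<and> (\<exists>(U, \<phi>)\<in>btriv B. \<forall>w\<in>mhull C. bproj B (G w) \<in> U)"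

abbreviation nz :: "((real \<times> (nat \<Rightarrow> real)) \<times> 'e) set" where
  "nz \<equiv> {(w, e). bnorm B e \<noteq> 0}"

abbreviation part :: "(real \<times> (nat \<Rightarrow> real)) set \<Rightarrow> ((real \<times> (nat \<Rightarrow> real)) \<times> 'e) topology" where
  "part C \<equiv> subtopology total (mhull C \<times> UNIV)"

lemma goodD:
  assumes "good C"
  obtains U \<phi> where "(U, \<phi>) \<in> btriv B" "mhull C \<subseteq> W" "\<forall>w\<in>mhull C. bproj B (G w) \<in> U"
  using assms unfolding good_def by blast

text \<open>Restricting the pullback to a hull is the same as pulling back along the restricted map,
  which is the form that \<open>pullback_chart\<close> deals with.\<close>

lemma part_eq:
  assumes "mhull C \<subseteq> W"
  shows "part C = subtopology (prod_topology (subtopology (cylinder rk) (mhull C)) E)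
     {(w, e). bproj B e = (bproj B \<circ> G) w}"
proof -
  have "prod_topology (subtopology (cylinder rk) (mhull C)) E =
      subtopology (prod_topology (cylinder rk) E) (mhull C \<times> UNIV)"
    by (rule prod_topology_subtopology_left)
  then show ?thesis
    unfolding total_def using assms
    by (simp only: subtopology_subtopology) (rule arg_cong[where f = "subtopology _"], auto)
qed

lemma G_in: "w \<in> W \<Longrightarrow> G w \<in> topspace E"
  using continuous_map_in[OF G, of w] W topspace_cylinder by auto

context
  fixes C U \<phi>
  assumes chart: "(U, \<phi>) \<in> btriv B" and CW: "mhull C \<subseteq> W"
    and CU: "\<forall>w\<in>mhull C. bproj B (G w) \<in> U"
begin

lemma part_proj_cont: "continuous_map (subtopology (cylinder rk) (mhull C)) (subtopology M U) (bproj B \<circ> G)"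
proof -
  have "continuous_map (subtopology (cylinder rk) (mhull C)) E G"
    using G CW continuous_map_from_subtopology_mono by blast
  from continuous_map_compose[OF this proj_cont] show ?thesis
    unfolding continuous_map_in_subtopology using CU by auto
qed

lemma part_contractible:
  assumes "C \<noteq> {}"
  shows "contractible_space (subtopology (cylinder rk) (mhull C))"
    "topspace (subtopology (cylinder rk) (mhull C)) \<noteq> {}"
proof -
  have sub: "mhull C \<subseteq> {0..1} \<times> ball_n rk"
    using CW W by blast
  have "subtopology (cylinder rk) (mhull C) =
      subtopology (prod_topology euclideanreal (Euclidean_space rk)) (mhull C)"
    using sub by (simp only: cylinder_subtopology subtopology_subtopology Int_absorb1)
  then show "contractible_space (subtopology (cylinder rk) (mhull C))"
    using contractible_mconvex[OF mconvex_mhull, of C rk] sub ball_n_sub by fastforce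
  show "topspace (subtopology (cylinder rk) (mhull C)) \<noteq> {}"
  proof -
    have "topspace (subtopology (cylinder rk) (mhull C)) = mhull C"
      using sub unfolding topspace_subtopology topspace_cylinder by blast
    then show ?thesis
      using assms subset_mhull[of C] by auto
  qed
qed

lemma part_transfer:
  assumes "C \<noteq> {}" "singular_relcycle p (part C) nz z"
  shows "singular_relboundary p (Euclidean_space rk) nonzero (chain_map p (\<lambda>(w, e). snd (\<phi> e)) z) \<longleftrightarrow>
      singular_relboundary p (part C) nz z"
    and "halvable p (Euclidean_space rk) nonzero (chain_map p (\<lambda>(w, e). snd (\<phi> e)) z) \<longleftrightarrow>
      halvable p (part C) nz z"
    and "singular_relcycle p (Euclidean_space rk) nonzero (chain_map p (\<lambda>(w, e). snd (\<phi> e)) z)"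
  using pullback_chart[OF chart part_proj_cont part_contractible[OF assms(1)], of p z] assms(2)
  by (simp_all only: part_eq[OF CW])

lemma part_chart_cont:
  shows "continuous_map (part C) (Euclidean_space rk) (\<lambda>(w, e). snd (\<phi> e))"
    and "(\<lambda>(w, e). snd (\<phi> e)) \<in> topspace (part C) \<inter> nz \<rightarrow> nonzero"
proof -
  have over: "snd q \<in> bover B U" if "q \<in> topspace (part C)" for q
  proof -
    have "fst q \<in> mhull C" "snd q \<in> topspace E" "bproj B (snd q) = bproj B (G (fst q))"
      using that by (auto simp: total_def)
    then show ?thesis
      using CU by (simp add: bover_def)
  qed
  have sndc: "continuous_map (part C) (subtopology E (bover B U)) snd"
    unfolding continuous_map_in_subtopology
  proof
    show "continuous_map (part C) E snd"
      unfolding total_def by (intro continuous_map_from_subtopology continuous_map_snd)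
  qed (use over in blast)
  show "continuous_map (part C) (Euclidean_space rk) (\<lambda>(w, e). snd (\<phi> e))"
    using continuous_map_compose[OF sndc chart_coord_cont[OF chart]] by (simp add: o_def case_prod_unfold)
  show "(\<lambda>(w, e). snd (\<phi> e)) \<in> topspace (part C) \<inter> nz \<rightarrow> nonzero"
  proof
    fix q assume q: "q \<in> topspace (part C) \<inter> nz"
    then have "bnorm B (snd q) \<noteq> 0"
      by (simp add: case_prod_unfold)
    then show "(\<lambda>(w, e). snd (\<phi> e)) q \<in> nonzero"
      using bnorm_0_iff[OF chart over] q by (simp add: case_prod_unfold)
  qed
qed

end

text \<open>The homological requirements are checked in a chart over the hull, where the pair
  becomes Euclidean space with its nonzero vectors.\<close>

sublocale acyclic_carrier rk "cylinder rk" zeros total nz "\<lambda>w. (w, G w)" "\<lambda>C. mhull C \<times> UNIV" good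
proof
  show "good C'" if "good C" "C' \<subseteq> C" for C C'
    using that mhull_mono unfolding good_def by blast
  show "mhull C' \<times> UNIV \<subseteq> mhull C \<times> (UNIV :: 'e set)" if "C' \<subseteq> C" for C C'
    using mhull_mono[OF that] by blast
  show "continuous_map (subtopology (cylinder rk) C) (part C) (\<lambda>w. (w, G w))" if "good C" for C
  proof -
    have CW: "C \<subseteq> W" "mhull C \<subseteq> W"
      using that subset_mhull by (auto simp: good_def)
    have "continuous_map (subtopology (cylinder rk) C) E G"
      using G CW(1) continuous_map_from_subtopology_mono by blast
    then have "continuous_map (subtopology (cylinder rk) C) (prod_topology (cylinder rk) E) (\<lambda>w. (w, G w))"
      by (intro continuous_map_pairedI continuous_map_from_subtopology[OF continuous_map_id[unfolded id_def]])
    then show ?thesis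
      unfolding total_def subtopology_subtopology continuous_map_in_subtopology
      using CW subset_mhull[of C] by auto
  qed
  show "(w, G w) \<in> nz" if "good C" "w \<in> C" "w \<in> topspace (cylinder rk)" "w \<notin> zeros" for C w
    using that subset_mhull[of C] by (auto simp: good_def zeros_def)
  show "singular_relboundary j (part C) nz z"
    if C: "good C" "C \<noteq> {}" "j < rk" "singular_relcycle j (part C) nz z" for C j z
  proof -
    obtain U \<phi> where U: "(U, \<phi>) \<in> btriv B" "mhull C \<subseteq> W" "\<forall>w\<in>mhull C. bproj B (G w) \<in> U"
      using goodD[OF C(1)] by blast
    show ?thesis
      using part_transfer(1,3)[OF U C(2,4)] Euclidean_nonzero_acyclic[OF C(3)] by blast
  qed
  show "halvable rk (part C) nz (a - b) \<longleftrightarrow> (halvable rk (part C) nz a \<longleftrightarrow> halvable rk (part C) nz b)"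
    if C: "good C" "C \<noteq> {}" and ab: "singular_relcycle rk (part C) nz a" "singular_relcycle rk (part C) nz b" for C a b
  proof -
    obtain U \<phi> where U: "(U, \<phi>) \<in> btriv B" "mhull C \<subseteq> W" "\<forall>w\<in>mhull C. bproj B (G w) \<in> U"
      using goodD[OF C(1)] by blast
    note tr = part_transfer(2)[OF U C(2)] part_transfer(3)[OF U C(2)]
    show ?thesis
      using tr(1)[OF ab(1)] tr(1)[OF ab(2)] tr(1)[OF singular_relcycle_diff[OF ab]]
        halvable_diff_iff[OF Euclidean_nonzero_homology_top[OF rk_pos] tr(2)[OF ab(1)] tr(2)[OF ab(2)]]
      by (simp add: chain_map_diff)
  qed
  \<comment> \<open>A chart over the larger hull also serves the smaller one, and both sides are the
    parity of the same chain of coordinates.\<close>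
  show "halvable rk (part C') nz z \<longleftrightarrow> halvable rk (part C) nz z"
    if C: "good C" "C' \<subseteq> C" "C' \<noteq> {}" and z: "singular_relcycle rk (part C') nz z" for C C' z
  proof -
    obtain U \<phi> where U: "(U, \<phi>) \<in> btriv B" "mhull C \<subseteq> W" "\<forall>w\<in>mhull C. bproj B (G w) \<in> U"
      using goodD[OF C(1)] by blast
    have sub: "mhull C' \<subseteq> mhull C"
      by (rule mhull_mono[OF C(2)])
    then have U': "mhull C' \<subseteq> W" "\<forall>w\<in>mhull C'. bproj B (G w) \<in> U"
      using U by auto
    have "singular_relcycle rk (part C) nz z"
    proof -
      have "continuous_map (part C') (part C) id"
        by (rule continuous_map_from_subtopology_mono[OF continuous_map_id]) (use sub in blast)
      then have "singular_relcycle rk (part C) nz (chain_map rk id z)"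
        by (rule singular_relcycle_chain_map[OF z]) simp
      moreover have "chain_map rk id z = z"
        using z unfolding singular_relcycle by (intro chain_map_ident) blast
      ultimately show ?thesis
        by simp
    qed
    then show ?thesis
      using part_transfer(2)[OF U, of rk z] part_transfer(2)[OF U(1) U' C(3) z] C by blast
  qed
qed

text \<open>The zeros of \<open>G\<close> meet the boundary of the cylinder only in its top, where
  \<open>G\<close> is in a chart the homeomorphism \<open>L\<close> fixing zero. As the remainder of
  a boundary, the image of the top has even parity. But \<open>L\<close> preserves parity, and the
  ball is represented by an odd chain \<open>b\<close>.\<close>

theorem no_null_homotopy:
  assumes Wopen: "openin (cylinder rk) W" and Zclosed: "closedin (cylinder rk) zeros"
    and z0: "\<And>x. (0, x) \<notin> zeros" and zS: "\<And>t x. x \<in> sphere_n rk \<Longrightarrow> (t, x) \<notin> zeros"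
    and W1: "{1} \<times> ball_n rk \<subseteq> W"
    and chart: "(U, \<phi>) \<in> btriv B" and GU: "\<And>x. x \<in> ball_n rk \<Longrightarrow> bproj B (G (1, x)) \<in> U"
    and GL: "\<And>x. x \<in> ball_n rk \<Longrightarrow> snd (\<phi> (G (1, x))) = L x"
    and L: "homeomorphic_maps (Euclidean_space rk) (Euclidean_space rk) L L'" and L0: "L (\<lambda>i. 0) = (\<lambda>i. 0)"
  shows False
proof -
  let ?R = "Euclidean_space rk"
  let ?X = "cylinder rk"
  let ?B = "subtopology ?R (ball_n rk)"
  obtain b where b: "singular_chain rk ?B b"
    "singular_chain (rk - Suc 0) (subtopology ?R (sphere_n rk)) (chain_boundary rk b)"
    "\<not> halvable rk ?R nonzero b"
    using generator_in_ball[OF rk_pos] by blast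
  have sb: "sphere_n rk \<subseteq> ball_n rk"
    by (auto simp: sphere_n_def ball_n_def)
  have bcyc: "singular_relcycle rk ?B (sphere_n rk) b"
    using b sb by (simp add: singular_relcycle subtopology_subtopology Int_absorb1)
  have i: "continuous_map ?B ?X (Pair t)" if "t \<in> {0..1}" for t
    using that by (simp add: continuous_map_pairwise o_def)
  \<comment> \<open>The homotopy runs from time 1 back to time 0, which gives the top a positive
    sign in the boundary of \<open>d\<close>.\<close>
  have "homotopic_with (\<lambda>h. h \<in> sphere_n rk \<rightarrow> {0..1} \<times> sphere_n rk) ?B ?X (Pair 1) (Pair 0)"
    unfolding homotopic_with_def
  proof (intro exI[of _ "\<lambda>q. (1 - fst q, snd q)"] conjI allI ballI)
    have "continuous_map (prod_topology (top_of_set {0..1::real}) ?B) euclideanreal fst"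
      by (meson continuous_map_fst continuous_map_into_fulltopology)
    then have "continuous_map (prod_topology (top_of_set {0..1::real}) ?B) euclideanreal (\<lambda>q. 1 - fst q)"
      by (intro continuous_map_diff) auto
    then have "continuous_map (prod_topology (top_of_set {0..1::real}) ?B) (top_of_set {0..1}) (\<lambda>q. 1 - fst q)"
      unfolding continuous_map_in_subtopology by auto
    then show "continuous_map (prod_topology (top_of_set {0..1::real}) ?B) ?X (\<lambda>q. (1 - fst q, snd q))"
      by (simp add: continuous_map_pairwise o_def continuous_map_snd)
  qed auto
  from homotopic_imp_homologous_rel_chain_maps[OF this bcyc]
  obtain d e where d: "singular_chain (Suc rk) ?X d"
    and e: "singular_chain rk (subtopology ?X ({0..1} \<times> sphere_n rk)) e"
    and de: "chain_boundary (Suc rk) d + e = chain_map rk (Pair 1) b - chain_map rk (Pair 0) b"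
    unfolding homologous_rel_def singular_relboundary by blast
  \<comment> \<open>The members are either free of zeros or contained in \<open>W\<close> and over
    one chart. Their convexity keeps the hull of a small simplex in the same member.\<close>
  define \<C> where "\<C> = {V. openin ?X V \<and> mconvex V \<and>
      (V \<inter> zeros = {} \<or> V \<subseteq> W \<and> (\<exists>(U, \<phi>)\<in>btriv B. \<forall>w\<in>V. bproj B (G w) \<in> U))}"
  have cover: "topspace ?X \<subseteq> \<Union>\<C>"
  proof
    fix w assume w: "w \<in> topspace ?X"
    have small: "\<exists>V\<in>\<C>. w \<in> V" if O: "openin ?X S" "w \<in> S"
      "S \<inter> zeros = {} \<or> S \<subseteq> W \<and> (\<exists>(U, \<phi>)\<in>btriv B. \<forall>w\<in>S. bproj B (G w) \<in> U)" for S
    proof -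
      obtain S' where S': "openin (prod_topology euclideanreal ?R) S'" "S = S' \<inter> {0..1} \<times> ball_n rk"
        using O(1) unfolding cylinder_subtopology openin_subtopology by blast
      obtain V where V: "openin (prod_topology euclideanreal ?R) V" "w \<in> V" "V \<subseteq> S'" "mconvex V"
        using mconvex_nbhd[OF S'(1), of w] O(2) S'(2) by blast
      let ?V = "V \<inter> {0..1} \<times> ball_n rk"
      have "openin ?X ?V"
        unfolding cylinder_subtopology openin_subtopology using V(1) by blast
      moreover have "mconvex ?V"
        using V(4) by (intro mconvex_Int mconvex_cylinder) auto
      moreover have "?V \<subseteq> S"
        using V(3) S'(2) by blast
      ultimately have "?V \<in> \<C>"
        unfolding \<C>_def using O(3) by blast
      then show ?thesis
        using V(2) w topspace_cylinder by blast
    qed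
    show "w \<in> \<Union>\<C>"
    proof (cases "w \<in> zeros")
      case False
      then show ?thesis
        using small[of "topspace ?X - zeros"] w Zclosed by (auto simp: closedin_def)
    next
      case True
      then have wW: "w \<in> W"
        by (simp add: zeros_def)
      then obtain U \<phi> where U: "(U, \<phi>) \<in> btriv B" "bproj B (G w) \<in> U"
        using chart_ex[OF proj_in[OF G_in]] by blast
      have "continuous_map (subtopology ?X W) M (bproj B \<circ> G)"
        by (rule continuous_map_compose[OF G proj_cont])
      from openin_continuous_map_preimage[OF this chart_open[OF U(1)]]
      have "openin (subtopology ?X W) {w \<in> W. bproj B (G w) \<in> U}"
        using W topspace_cylinder by (auto simp: Int_absorb1 cong: conj_cong elim!: back_subst[where P = "openin _"])
      then have "openin ?X {w \<in> W. bproj B (G w) \<in> U}"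
        using Wopen openin_trans_full by blast
      from small[OF this] show ?thesis
        using wW U by blast
    qed
  qed
  obtain m where m: "\<And>\<rho>. \<rho> \<in> Poly_Mapping.keys ((singular_subdivision (Suc rk) ^^ m) d) \<Longrightarrow>
      \<exists>V\<in>\<C>. \<rho> \<in> standard_simplex (Suc rk) \<rightarrow> V"
  proof -
    have "openin ?X V" if "V \<in> \<C>" for V
      using that by (simp add: \<C>_def)
    from sufficient_iterated_singular_subdivision_exists[OF this cover d] show ?thesis
      using that by (metis order_refl)
  qed
  define c where "c = (singular_subdivision (Suc rk) ^^ m) d"
  have cX: "singular_chain (Suc rk) ?X c"
    unfolding c_def by (rule singular_chain_iterated_subdivision[OF d])
  have small: "good (\<rho> ` standard_simplex (Suc rk)) \<or> \<rho> ` standard_simplex (Suc rk) \<inter> zeros = {}"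
    if \<rho>: "\<rho> \<in> Poly_Mapping.keys c" for \<rho>
  proof -
    obtain V where V: "V \<in> \<C>" "\<rho> ` standard_simplex (Suc rk) \<subseteq> V"
      using m[OF \<rho>[unfolded c_def]] by (auto simp: image_subset_iff_funcset)
    then have h: "mhull (\<rho> ` standard_simplex (Suc rk)) \<subseteq> V"
      by (intro mhull_minimal) (auto simp: \<C>_def)
    consider "V \<inter> zeros = {}" | "V \<subseteq> W" "\<exists>(U, \<phi>)\<in>btriv B. \<forall>w\<in>V. bproj B (G w) \<in> U"
      using V(1) by (auto simp: \<C>_def)
    then show ?thesis
    proof cases
      case 1
      then show ?thesis
        using V(2) by blast
    next
      case 2
      then show ?thesis
        unfolding good_def using h by blast
    qed
  qed
  let ?C = "{1} \<times> ball_n rk"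
  \<comment> \<open>The top is convex, hence its own carrier, and the given chart covers all of
    it.\<close>
  have hC: "mhull ?C = ?C"
    using mhull_minimal[OF mconvex_cylinder, of "{1}" ?C rk] subset_mhull[of ?C] by auto
  have ballne: "?C \<noteq> {}"
    by (auto simp: ball_n_def topspace_Euclidean_space L2_set_def intro!: exI[of _ "\<lambda>i. 0"])
  have gC: "good ?C"
    unfolding good_def hC using W1 chart GU by auto
  have i1: "continuous_map ?B (subtopology ?X ?C) (Pair 1)"
    unfolding continuous_map_in_subtopology using i[of 1] by auto
  have i0: "continuous_map ?B (subtopology ?X (- zeros)) (Pair 0)"
    unfolding continuous_map_in_subtopology using i[of 0] z0 by auto
  have b1: "singular_chain rk (subtopology ?X ?C) (chain_map rk (Pair 1) b)"
    by (rule singular_chain_chain_map[OF b(1) i1])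
  then have a: "singular_chain rk (subtopology ?X ?C) ((singular_subdivision rk ^^ m) (chain_map rk (Pair 1) b))"
    by (rule singular_chain_iterated_subdivision)
  have "singular_chain rk (subtopology ?X (- zeros)) e"
    using singular_chain_mono[OF e, of "- zeros"] zS by blast
  \<comment> \<open>All of the boundary except the top is free of zeros: the bottom by
    \<open>z0\<close> and the side by \<open>zS\<close>.\<close>
  then have e': "singular_chain rk (subtopology ?X (- zeros)) (- (singular_subdivision rk ^^ m) (chain_map rk (Pair 0) b + e))"
    unfolding singular_chain_minus
    by (intro singular_chain_iterated_subdivision singular_chain_add singular_chain_chain_map[OF b(1) i0])
  have "chain_boundary (Suc rk) c = (singular_subdivision rk ^^ m) (chain_boundary (Suc rk) d)"
    unfolding c_def using chain_boundary_iterated_subdivision[OF d] by simp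
  also have "chain_boundary (Suc rk) d = chain_map rk (Pair 1) b - (chain_map rk (Pair 0) b + e)"
    using de by (simp add: algebra_simps)
  finally have bd: "chain_boundary (Suc rk) c = (singular_subdivision rk ^^ m) (chain_map rk (Pair 1) b) + (- (singular_subdivision rk ^^ m) (chain_map rk (Pair 0) b + e))"
    unfolding singular_subdivision_power_diff by simp
  have "halvable rk (part ?C) nz (chain_map rk (\<lambda>w. (w, G w)) ((singular_subdivision rk ^^ m) (chain_map rk (Pair 1) b)))"
    by (rule halvable_section[OF cX small gC ballne a e' bd])
  then have "halvable rk (part ?C) (topspace (part ?C) \<inter> nz) (chain_map rk (\<lambda>w. (w, G w)) ((singular_subdivision rk ^^ m) (chain_map rk (Pair 1) b)))"
    by (simp only: halvable_def homologous_rel_restrict singular_relcycle_restrict)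
  moreover have hCW: "mhull ?C \<subseteq> W" "\<forall>w\<in>mhull ?C. bproj B (G w) \<in> U"
    using W1 GU unfolding hC by auto
  ultimately have "halvable rk ?R nonzero
     (chain_map rk (\<lambda>(w, e). snd (\<phi> e)) (chain_map rk (\<lambda>w. (w, G w)) ((singular_subdivision rk ^^ m) (chain_map rk (Pair 1) b))))"
    by (intro halvable_chain_map[OF _ part_chart_cont[OF chart hCW]])
  \<comment> \<open>Subdivision is natural, so it can be moved outside the chart and the section;
    what remains inside is the image of \<open>b\<close> under \<open>L\<close>.\<close>
  also have "chain_map rk (\<lambda>(w, e). snd (\<phi> e)) (chain_map rk (\<lambda>w. (w, G w)) ((singular_subdivision rk ^^ m) (chain_map rk (Pair 1) b))) =
      (singular_subdivision rk ^^ m) (chain_map rk L b)"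
  proof -
    have "chain_map rk (\<lambda>(w, e). snd (\<phi> e)) (chain_map rk (\<lambda>w. (w, G w)) ((singular_subdivision rk ^^ m) (chain_map rk (Pair 1) b))) =
        chain_map rk (\<lambda>w. snd (\<phi> (G w))) ((singular_subdivision rk ^^ m) (chain_map rk (Pair 1) b))"
      using chain_map_compose[of rk "\<lambda>(w, e). snd (\<phi> e)" "\<lambda>w. (w, G w)"] by (simp add: o_def fun_eq_iff)
    also have "\<dots> = chain_map rk (\<lambda>w. snd (\<phi> (G w))) (chain_map rk (Pair 1) ((singular_subdivision rk ^^ m) b))"
      by (simp add: naturality_iterated_subdivision[OF b(1)])
    also have "\<dots> = chain_map rk (\<lambda>x. snd (\<phi> (G (1, x)))) ((singular_subdivision rk ^^ m) b)"
      using chain_map_compose[of rk "\<lambda>w. snd (\<phi> (G w))" "Pair 1"] by (simp add: o_def fun_eq_iff)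
    also have "\<dots> = chain_map rk L ((singular_subdivision rk ^^ m) b)"
      by (rule chain_map_eq[of rk ?B]) (use singular_chain_iterated_subdivision[OF b(1)] GL in \<open>auto\<close>)
    also have "\<dots> = (singular_subdivision rk ^^ m) (chain_map rk L b)"
      by (simp add: naturality_iterated_subdivision[OF b(1)])
    finally show ?thesis .
  qed
  finally have "halvable rk ?R nonzero ((singular_subdivision rk ^^ m) (chain_map rk L b))" .
  have Lc: "continuous_map ?R ?R L" "continuous_map ?R ?R L'"
    and LL: "\<And>x. x \<in> topspace ?R \<Longrightarrow> L' (L x) = x" "\<And>x. x \<in> topspace ?R \<Longrightarrow> L (L' x) = x"
    using L by (auto simp: homeomorphic_maps_def)
  have zR: "(\<lambda>i. 0) \<in> topspace ?R"
    by (simp add: topspace_Euclidean_space)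
  have LE: "L x \<in> topspace ?R" "L' x \<in> topspace ?R" if "x \<in> topspace ?R" for x
    using continuous_map_in[OF Lc(1) that] continuous_map_in[OF Lc(2) that] .
  let ?N = "topspace ?R \<inter> nonzero"
  have Ln: "L \<in> ?N \<rightarrow> ?N"
  proof
    fix x assume x: "x \<in> ?N"
    have "L x \<noteq> (\<lambda>i. 0)"
      using LL(1)[of x] LL(1)[OF zR] L0 x by auto
    then show "L x \<in> ?N"
      using LE x by blast
  qed
  have Ln': "L' \<in> ?N \<rightarrow> ?N"
  proof
    fix x assume x: "x \<in> ?N"
    have "L' x \<noteq> (\<lambda>i. 0)"
      using LL(2)[of x] L0 x by auto
    then show "L' x \<in> ?N"
      using LE x by blast
  qed
  have bR: "singular_chain rk ?R b"
    using b(1) by (simp add: singular_chain_subtopology)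
  have "sphere_n rk \<subseteq> ?N"
    by (auto simp: sphere_n_def L2_set_def)
  then have brel: "singular_relcycle rk ?R ?N b"
    using bR singular_chain_mono[OF b(2)] unfolding singular_relcycle One_nat_def by blast
  have Lrel: "singular_relcycle rk ?R ?N (chain_map rk L b)"
    by (rule singular_relcycle_chain_map[OF brel Lc(1) Ln])
  have hN: "halvable rk ?R ?N y \<longleftrightarrow> halvable rk ?R nonzero y" for y
    by (simp only: halvable_def homologous_rel_restrict singular_relcycle_restrict)
  have "halvable rk ?R ?N (chain_map rk L b)"
    using \<open>halvable rk ?R nonzero ((singular_subdivision rk ^^ m) (chain_map rk L b))\<close>
      halvable_cong[OF homologous_rel_iterated_subdivision[OF Lrel]] hN by blast
  \<comment> \<open>Since \<open>L\<close> fixes zero, its inverse respects the nonzero vectors too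
    and carries the parity back to \<open>b\<close>.\<close>
  then have "halvable rk ?R ?N (chain_map rk L' (chain_map rk L b))"
    by (rule halvable_chain_map[OF _ Lc(2) Ln'])
  also have "chain_map rk L' (chain_map rk L b) = chain_map rk (L' \<circ> L) b"
    by (simp add: chain_map_compose)
  also have "\<dots> = b"
    using LL(1) by (intro chain_map_id_gen[OF bR]) simp
  finally have "halvable rk ?R nonzero b"
    using hN by blast
  then show False
    using b(3) by simp
qed

end

subsection \<open>Linear maps of Euclidean space\<close>

locale Euclidean_linear =
  fixes n :: nat and L :: "(nat \<Rightarrow> real) \<Rightarrow> nat \<Rightarrow> real"
  assumes into: "\<And>x. x \<in> topspace (Euclidean_space n) \<Longrightarrow> L x \<in> topspace (Euclidean_space n)"
    and add: "\<And>x y. x \<in> topspace (Euclidean_space n) \<Longrightarrow> y \<in> topspace (Euclidean_space n) \<Longrightarrow>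
       L (\<lambda>i. x i + y i) = (\<lambda>i. L x i + L y i)"
    and scale: "\<And>c x. x \<in> topspace (Euclidean_space n) \<Longrightarrow> L (\<lambda>i. c * x i) = (\<lambda>i. c * L x i)"
begin

lemma zero: "L (\<lambda>i. 0) = (\<lambda>i. 0)"
  using scale[of "\<lambda>i. 0" 0] by (simp add: topspace_Euclidean_space)

text \<open>Additivity is given for two vectors at a time, so the coordinates are switched on one
  after another.\<close>

lemma expand:
  assumes "x \<in> topspace (Euclidean_space n)"
  shows "L x j = (\<Sum>i<n. x i * L (\<lambda>l. if l = i then 1 else 0) j)"
proof -
  have "L (\<lambda>l. if l < m then x l else 0) j = (\<Sum>i<m. x i * L (\<lambda>l. if l = i then 1 else 0) j)" if "m \<le> n" for m
    using that
  proof (induction m)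
    case 0
    then show ?case by (simp add: zero)
  next
    case (Suc m)
    have "(\<lambda>l. if l < Suc m then x l else 0) =
        (\<lambda>l. (if l < m then x l else 0) + x m * (if l = m then 1 else 0))"
      by (auto simp: fun_eq_iff less_Suc_eq)
    then have "L (\<lambda>l. if l < Suc m then x l else 0) =
        (\<lambda>j. L (\<lambda>l. if l < m then x l else 0) j + x m * L (\<lambda>l. if l = m then 1 else 0) j)"
      using Suc.prems by (simp add: add scale topspace_Euclidean_space)
    then show ?case
      using Suc by simp
  qed
  from this[OF order_refl] have "L (\<lambda>l. if l < n then x l else 0) j = (\<Sum>i<n. x i * L (\<lambda>l. if l = i then 1 else 0) j)" .
  moreover have "(\<lambda>l. if l < n then x l else 0) = x"
    using assms by (auto simp: topspace_Euclidean_space fun_eq_iff)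
  ultimately show ?thesis
    by (simp only:)
qed

lemma cont: "continuous_map (Euclidean_space n) (Euclidean_space n) L"
proof (rule continuous_map_into_Euclidean)
  fix j
  have "continuous_map (Euclidean_space n) euclideanreal (\<lambda>x. \<Sum>i<n. x i * L (\<lambda>l. if l = i then 1 else 0) j)"
    by (intro continuous_map_sum continuous_map_real_mult
        continuous_map_Euclidean_coordinate[OF continuous_map_id[unfolded id_def]]) auto
  then show "continuous_map (Euclidean_space n) euclideanreal (\<lambda>x. L x j)"
    by (rule continuous_map_eq) (simp add: expand)
qed (use into in \<open>auto simp: topspace_Euclidean_space\<close>)

text \<open>A linear map without kernel is injective, hence open by invariance of domain. Its image
  is then a neighbourhood of zero closed under scaling, which is the whole space.\<close>

lemma homeomorphic:
  assumes ker: "\<And>x. x \<in> topspace (Euclidean_space n) \<Longrightarrow> L x = (\<lambda>i. 0) \<Longrightarrow> x = (\<lambda>i. 0)"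
  obtains L' where "homeomorphic_maps (Euclidean_space n) (Euclidean_space n) L L'"
proof -
  let ?E = "Euclidean_space n"
  have sm: "(\<lambda>i. c * x i) \<in> topspace ?E" if "x \<in> topspace ?E" for c x
    using that by (simp add: topspace_Euclidean_space)
  have inj: "inj_on L (topspace ?E)"
  proof (rule inj_onI)
    fix x y assume x: "x \<in> topspace ?E" "y \<in> topspace ?E" "L x = L y"
    have "L (\<lambda>i. x i + (- 1) * y i) = (\<lambda>i. 0)"
      using x add[OF x(1) sm[OF x(2), of "- 1"]] scale[OF x(2), of "- 1"] by simp
    moreover have "(\<lambda>i. x i + (- 1) * y i) \<in> topspace ?E"
      using x by (simp add: topspace_Euclidean_space)
    ultimately have "(\<lambda>i. x i + (- 1) * y i) = (\<lambda>i. 0)"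
      using ker by blast
    then show "x = y"
      by (auto simp: fun_eq_iff)
  qed
  have opn: "openin ?E (L ` S)" if "openin ?E S" for S
    using invariance_of_domain_Euclidean_space[OF that continuous_map_from_subtopology[OF cont]]
      inj_on_subset[OF inj] openin_subset[OF that] by blast
  have surj: "L ` topspace ?E = topspace ?E"
  proof
    show "L ` topspace ?E \<subseteq> topspace ?E"
      using into by blast
    show "topspace ?E \<subseteq> L ` topspace ?E"
    proof
      fix y assume y: "y \<in> topspace ?E"
      have "continuous_map euclideanreal ?E (\<lambda>t i. t * y i)"
        using y by (intro continuous_map_into_Euclidean continuous_map_real_mult) (auto simp: topspace_Euclidean_space)
      from openin_continuous_map_preimage[OF this opn[OF openin_topspace]]
      have "open {t. (\<lambda>i. t * y i) \<in> L ` topspace ?E}"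
        by simp
      moreover have "0 \<in> {t. (\<lambda>i. t * y i) \<in> L ` topspace ?E}"
      proof -
        have "(\<lambda>i. 0) \<in> topspace ?E"
          by (simp add: topspace_Euclidean_space)
        then show ?thesis
          using zero by (auto simp: image_iff intro!: bexI[of _ "\<lambda>i. 0"])
      qed
      ultimately obtain e where e: "e > 0" "ball 0 e \<subseteq> {t. (\<lambda>i. t * y i) \<in> L ` topspace ?E}"
        unfolding open_contains_ball by blast
      then have "e / 2 \<in> {t. (\<lambda>i. t * y i) \<in> L ` topspace ?E}"
        by (intro subsetD[OF e(2)]) simp
      then obtain x where x: "x \<in> topspace ?E" "(\<lambda>i. e / 2 * y i) = L x"
        by auto
      have "L (\<lambda>i. 2 / e * x i) = (\<lambda>i. 2 / e * (e / 2 * y i))"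
        using scale[OF x(1), of "2 / e"] fun_cong[OF x(2)] by simp
      then have "L (\<lambda>i. 2 / e * x i) = y"
        using e(1) by simp
      then show "y \<in> L ` topspace ?E"
        using sm[OF x(1)] by (metis image_eqI)
    qed
  qed
  have "homeomorphic_map ?E ?E L"
    using cont opn inj surj by (intro bijective_open_imp_homeomorphic_map) (auto simp: open_map_def)
  then show ?thesis
    using that homeomorphic_map_maps by blast
qed

end

text \<open>The ball is closed in the full product space and lies in the cube with all sides
  [-1, 1], which is compact as a product of compact intervals.\<close>

lemma compactin_ball_n: "compactin (Euclidean_space n) (ball_n n)"
proof -
  have "closedin (Euclidean_space n) (ball_n n)"
  proof -
    have "closedin (Euclidean_space n) {x \<in> topspace (Euclidean_space n). L2_set x {..<n} \<in> {..1}}"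
      by (rule closedin_continuous_map_preimage[OF continuous_map_L2_set[OF continuous_map_id[unfolded id_def]]]) auto
    then show ?thesis
      by (simp add: ball_n_def)
  qed
  then have "closedin (powertop_real UNIV) (ball_n n)"
    using closedin_Euclidean_space closedin_trans_full
    by (metis Euclidean_space_def topspace_Euclidean_space)
  moreover have "ball_n n \<subseteq> UNIV \<rightarrow>\<^sub>E {-1..1}"
  proof
    fix x assume x: "x \<in> ball_n n"
    have "\<bar>x i\<bar> \<le> 1" for i
    proof (cases "i < n")
      case True
      then have "\<bar>x i\<bar> \<le> L2_set x {..<n}"
        using member_le_L2_set[of "{..<n}" i "\<lambda>i. \<bar>x i\<bar>"] by (simp add: L2_set_def)
      then show ?thesis
        using x by (simp add: ball_n_def)
    next
      case False
      then show ?thesis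
        using x by (simp add: ball_n_def topspace_Euclidean_space)
    qed
    then show "x \<in> UNIV \<rightarrow>\<^sub>E {-1..1}"
      by (auto simp: PiE_iff abs_le_iff minus_le_iff)
  qed
  moreover have "compactin (powertop_real UNIV) (UNIV \<rightarrow>\<^sub>E {-1..1 :: real})"
    by (simp add: compactin_PiE)
  ultimately have "compactin (powertop_real UNIV) (ball_n n)"
    using closed_compactin by blast
  then show ?thesis
    unfolding Euclidean_space_def compactin_subtopology
    by (auto simp: ball_n_def topspace_Euclidean_space)
qed

subsection \<open>Partial maps into \<open>D\<close>\<close>

locale whitney_sum = u: banach_bundle n M \<A> Eu + s: banach_bundle n M \<A> Es
  for n :: nat and M :: "'a topology" and \<A> :: "'a atlas"
    and Eu :: "('a, 'e) vbundle" and Es :: "('a, 'f) vbundle"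
begin

abbreviation "V \<equiv> whitney Eu Es"
abbreviation "D \<equiv> Dset Eu Es"

definition nu :: "'e \<times> 'f \<Rightarrow> real" where "nu p = bnorm Eu (fst p)"
definition ns :: "'e \<times> 'f \<Rightarrow> real" where "ns p = bnorm Es (snd p)"

lemma fst_cont: "continuous_map V (btop Eu) fst" and snd_cont: "continuous_map V (btop Es) snd"
  unfolding whitney_def by (intro continuous_map_from_subtopology continuous_map_fst continuous_map_snd)+

lemma nu_cont: "continuous_map V euclideanreal nu" and ns_cont: "continuous_map V euclideanreal ns"
  using continuous_map_compose[OF fst_cont u.bnorm_cont] continuous_map_compose[OF snd_cont s.bnorm_cont]
  by (simp_all add: nu_def[abs_def] ns_def[abs_def] o_def)

lemma D_eq: "D = {p \<in> topspace V. nu p \<le> 1 \<and> ns p \<le> 1}"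
  by (auto simp: Dset_def nu_def ns_def)

lemma Dplus_eq: "Dplus Eu Es = {p \<in> topspace V. nu p \<le> 1 \<and> ns p = 1}"
  by (auto simp: Dplus_def nu_def ns_def)

lemma Dminus_eq: "Dminus Eu Es = {p \<in> topspace V. nu p = 1 \<and> ns p \<le> 1}"
  by (auto simp: Dminus_def nu_def ns_def)

lemma D_sub: "D \<subseteq> topspace V"
  by (auto simp: D_eq)

lemma D_closed: "closedin V D"
proof -
  have "closedin V {p \<in> topspace V. nu p \<in> {..1}}" "closedin V {p \<in> topspace V. ns p \<in> {..1}}"
    using closedin_continuous_map_preimage[OF nu_cont, of "{..1}"]
      closedin_continuous_map_preimage[OF ns_cont, of "{..1}"] by auto
  then have "closedin V ({p \<in> topspace V. nu p \<in> {..1}} \<inter> {p \<in> topspace V. ns p \<in> {..1}})"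
    by (rule closedin_Int)
  moreover have "{p \<in> topspace V. nu p \<in> {..1}} \<inter> {p \<in> topspace V. ns p \<in> {..1}} = D"
    by (auto simp: D_eq)
  ultimately show ?thesis by simp
qed

lemma D_interior: "openin V {p \<in> topspace V. nu p < 1 \<and> ns p < 1}"
proof -
  have "openin V {p \<in> topspace V. nu p \<in> {..<1}}" "openin V {p \<in> topspace V. ns p \<in> {..<1}}"
    using openin_continuous_map_preimage[OF nu_cont, of "{..<1}"]
      openin_continuous_map_preimage[OF ns_cont, of "{..<1}"] by auto
  then have "openin V ({p \<in> topspace V. nu p \<in> {..<1}} \<inter> {p \<in> topspace V. ns p \<in> {..<1}})"
    by (rule openin_Int)
  moreover have "{p \<in> topspace V. nu p \<in> {..<1}} \<inter> {p \<in> topspace V. ns p \<in> {..<1}} =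
      {p \<in> topspace V. nu p < 1 \<and> ns p < 1}"
    by auto
  ultimately show ?thesis by simp
qed

definition pdom :: "'x topology \<Rightarrow> ('x \<Rightarrow> ('e \<times> 'f) option) \<Rightarrow> 'x set" where
  "pdom X q = {x \<in> topspace X. q x \<noteq> None}"

text \<open>The points whose value is away from the collapsed point. If all values lie in
  \<open>D\<close>, then at any other point the map is undefined or has its value in D^-.\<close>

definition inside :: "'x topology \<Rightarrow> ('x \<Rightarrow> ('e \<times> 'f) option) \<Rightarrow> 'x set" where
  "inside X q = {x \<in> topspace X. q x \<noteq> None \<and> nu (the (q x)) < 1}"

text \<open>
  Partial maps to \<open>D\<close> that become continuous when \<open>D\<^sup>-\<close> is collapsed to a point, which then also
  serves as the value where the map is undefined.
\<close>

definition pmap :: "'x topology \<Rightarrow> ('x \<Rightarrow> ('e \<times> 'f) option) \<Rightarrow> bool" where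
  "pmap X q \<longleftrightarrow> closedin X (pdom X q) \<and> openin X (inside X q) \<and>
     continuous_map (subtopology X (pdom X q)) V (\<lambda>x. the (q x)) \<and> (\<forall>x\<in>pdom X q. the (q x) \<in> D)"

lemma pdom_sub: "pdom X q \<subseteq> topspace X" and inside_pdom: "inside X q \<subseteq> pdom X q"
  by (auto simp: pdom_def inside_def)

lemma pmap_Some:
  assumes g: "continuous_map X V g" "\<And>x. x \<in> topspace X \<Longrightarrow> g x \<in> D"
  shows "pmap X (\<lambda>x. Some (g x))"
proof -
  have d: "pdom X (\<lambda>x. Some (g x)) = topspace X"
    by (simp add: pdom_def)
  have "openin X {x \<in> topspace X. (nu \<circ> g) x \<in> {..<1}}"
    by (rule openin_continuous_map_preimage[OF continuous_map_compose[OF g(1) nu_cont]]) simp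
  then have "openin X (inside X (\<lambda>x. Some (g x)))"
    by (simp add: inside_def)
  then show ?thesis
    unfolding pmap_def d using g by simp
qed

lemma pmap_cong:
  assumes "pmap X q" "\<And>x. x \<in> topspace X \<Longrightarrow> q x = q' x"
  shows "pmap X q'"
proof -
  have e: "pdom X q' = pdom X q" "inside X q' = inside X q"
    using assms(2) by (auto simp: pdom_def inside_def)
  have "continuous_map (subtopology X (pdom X q)) V (\<lambda>x. the (q' x))"
    by (rule continuous_map_eq[where f = "\<lambda>x. the (q x)"]) (use assms in \<open>auto simp: pmap_def\<close>)
  then show ?thesis
    using assms(1) unfolding pmap_def e using assms(2) pdom_sub by (metis subsetD)
qed

lemma pmap_compose:
  assumes q: "pmap X q" and g: "continuous_map Y X g"
  shows "pmap Y (\<lambda>y. q (g y))"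
proof -
  have gt: "g y \<in> topspace X" if "y \<in> topspace Y" for y
    by (rule continuous_map_in[OF g that])
  have d: "pdom Y (\<lambda>y. q (g y)) = {y \<in> topspace Y. g y \<in> pdom X q}"
    and i: "inside Y (\<lambda>y. q (g y)) = {y \<in> topspace Y. g y \<in> inside X q}"
    using gt by (auto simp: pdom_def inside_def)
  have 1: "closedin X (pdom X q)" "openin X (inside X q)"
    and 2: "continuous_map (subtopology X (pdom X q)) V (\<lambda>x. the (q x))" "\<forall>x\<in>pdom X q. the (q x) \<in> D"
    using q unfolding pmap_def by auto
  have "continuous_map (subtopology Y (pdom Y (\<lambda>y. q (g y)))) (subtopology X (pdom X q)) g"
    unfolding continuous_map_in_subtopology d by (auto intro: continuous_map_from_subtopology g)
  from continuous_map_compose[OF this 2(1)]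
  have "continuous_map (subtopology Y (pdom Y (\<lambda>y. q (g y)))) V (\<lambda>y. the (q (g y)))"
    by (simp add: o_def)
  moreover have "closedin Y (pdom Y (\<lambda>y. q (g y)))" "openin Y (inside Y (\<lambda>y. q (g y)))"
    unfolding d i using closedin_continuous_map_preimage[OF g 1(1)] openin_continuous_map_preimage[OF g 1(2)] .
  ultimately show ?thesis
    unfolding pmap_def using 2(2) d by simp
qed

definition pstep :: "('x \<Rightarrow> ('e \<times> 'f) option) \<Rightarrow> ('x \<Rightarrow> 'e \<times> 'f \<Rightarrow> 'e \<times> 'f) \<Rightarrow> 'x \<Rightarrow> ('e \<times> 'f) option" where
  "pstep q k x = (case q x of None \<Rightarrow> None | Some p \<Rightarrow> if k x p \<in> D then Some (k x p) else None)"

text \<open>The new map is inside exactly where the old one is inside and the new value is interior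
  to \<open>D\<close>: by \<open>km\<close> values on D^- are thrown out, and by \<open>kp\<close> a
  new value in \<open>D\<close> has stable norm below one. Being interior is an open condition,
  which gives an open \<open>inside\<close>; the new domain is closed because \<open>D\<close>
  is.\<close>

lemma pmap_pstep:
  assumes q: "pmap X q"
    and k: "continuous_map (subtopology X (pdom X q)) V (\<lambda>x. k x (the (q x)))"
    and kp: "\<And>x. x \<in> pdom X q \<Longrightarrow> k x (the (q x)) \<notin> Dplus Eu Es"
    and km: "\<And>x. x \<in> pdom X q \<Longrightarrow> nu (the (q x)) = 1 \<Longrightarrow> k x (the (q x)) \<notin> D"
  shows "pmap X (pstep q k)"
proof -
  let ?N = "pdom X q" and ?I = "inside X q" and ?g = "\<lambda>x. k x (the (q x))"
  have 1: "closedin X ?N" "openin X ?I" "\<forall>x\<in>?N. the (q x) \<in> D"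
    using q unfolding pmap_def by auto
  have val: "pstep q k x = (if x \<in> ?N \<and> ?g x \<in> D then Some (?g x) else None)" if "x \<in> topspace X" for x
    using that by (auto simp: pstep_def pdom_def split: option.splits)
  have d: "pdom X (pstep q k) = {x \<in> ?N. ?g x \<in> D}"
  proof -
    have "pstep q k x \<noteq> None \<longleftrightarrow> x \<in> ?N \<and> ?g x \<in> D" if "x \<in> topspace X" for x
      unfolding val[OF that] by simp
    then show ?thesis
      using pdom_sub[of X q] unfolding pdom_def[of X "pstep q k"] by blast
  qed
  have "closedin (subtopology X ?N) {x \<in> topspace (subtopology X ?N). ?g x \<in> D}"
    by (rule closedin_continuous_map_preimage[OF k D_closed])
  moreover have "topspace (subtopology X ?N) = ?N"
    using pdom_sub[of X q] by auto
  ultimately have closed: "closedin X (pdom X (pstep q k))"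
    using 1(1) closedin_trans_full unfolding d by fastforce
  have thD: "\<forall>x\<in>?N. the (q x) \<in> D"
    using 1(3) .
  have i: "inside X (pstep q k) = {x \<in> ?I. ?g x \<in> {p \<in> topspace V. nu p < 1 \<and> ns p < 1}}"
  proof -
    have 1: "nu (the (q x)) < 1" if "x \<in> ?N" "?g x \<in> D" for x
      using km[OF that(1)] that thD by (force simp: D_eq)
    have 2: "ns (?g x) < 1" if "x \<in> ?N" "?g x \<in> D" for x
      using kp[OF that(1)] that by (force simp: D_eq Dplus_eq)
    have 3: "x \<in> inside X (pstep q k) \<longleftrightarrow> x \<in> ?N \<and> ?g x \<in> D \<and> nu (?g x) < 1" for x
    proof (cases "x \<in> topspace X")
      case True
      then show ?thesis
        by (cases "x \<in> ?N \<and> ?g x \<in> D") (simp_all add: inside_def val, blast)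
    next
      case False
      then show ?thesis
        using pdom_sub[of X q] by (auto simp: inside_def)
    qed
    have 4: "x \<in> ?I \<longleftrightarrow> x \<in> ?N \<and> nu (the (q x)) < 1" for x
      by (simp add: inside_def pdom_def)
    have 5: "p \<in> D \<longleftrightarrow> p \<in> topspace V \<and> nu p \<le> 1 \<and> ns p \<le> 1" for p
      by (simp add: D_eq)
    have "x \<in> inside X (pstep q k) \<longleftrightarrow> x \<in> ?I \<and> ?g x \<in> topspace V \<and> nu (?g x) < 1 \<and> ns (?g x) < 1" for x
      using 1[of x] 2[of x] 5[of "?g x"] unfolding 3[of x] 4[of x] by (meson less_imp_le)
    then show ?thesis
      by blast
  qed
  have kI: "continuous_map (subtopology X ?I) V ?g"
    by (rule continuous_map_from_subtopology_mono[OF k inside_pdom])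
  have "openin (subtopology X ?I) {x \<in> topspace (subtopology X ?I). ?g x \<in> {p \<in> topspace V. nu p < 1 \<and> ns p < 1}}"
    by (rule openin_continuous_map_preimage[OF kI D_interior])
  moreover have "topspace (subtopology X ?I) = ?I"
    using openin_subset[OF 1(2)] by auto
  ultimately have opn: "openin X (inside X (pstep q k))"
    using 1(2) openin_trans_full unfolding i by fastforce
  have "continuous_map (subtopology X (pdom X (pstep q k))) V ?g"
    by (rule continuous_map_from_subtopology_mono[OF k]) (auto simp: d)
  then have "continuous_map (subtopology X (pdom X (pstep q k))) V (\<lambda>x. the (pstep q k x))"
    by (rule continuous_map_eq) (auto simp: d val)
  then show ?thesis
    unfolding pmap_def using closed opn d val pdom_sub[of X q] by auto
qed

lemma pmap_glue_closed:
  assumes C: "closedin X C1" "closedin X C2" "topspace X \<subseteq> C1 \<union> C2"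
    and q: "pmap (subtopology X C1) q" "pmap (subtopology X C2) q"
  shows "pmap X q"
proof -
  define C where "C = (\<lambda>b. if b then C1 else C2)"
  have Cc: "closedin X (C b)" and Cq: "pmap (subtopology X (C b)) q" for b
    using C q by (auto simp: C_def)
  have cov: "\<exists>b. x \<in> C b" if "x \<in> topspace X" for x
    using C(3) that by (auto simp: C_def)
  have pd: "pdom (subtopology X (C b)) q = pdom X q \<inter> C b" for b
    by (auto simp: pdom_def)
  have inn: "inside (subtopology X (C b)) q = inside X q \<inter> C b" for b
    by (auto simp: inside_def)
  have N: "closedin X (pdom X q \<inter> C b)" for b
    using Cq[of b] Cc[of b] closedin_trans_full unfolding pmap_def pd by blast
  have "pdom X q = (pdom X q \<inter> C True) \<union> (pdom X q \<inter> C False)"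
    using cov pdom_sub[of X q] by (metis (full_types) Int_Un_distrib Int_absorb2 UnCI subsetD subsetI)
  then have closed: "closedin X (pdom X q)"
    using closedin_Un[OF N[of True] N[of False]] by simp
  \<comment> \<open>The pieces are closed, so openness cannot be glued directly; the complements of
    \<open>inside\<close> in the two pieces are united instead.\<close>
  have co: "closedin X (C b - inside X q)" for b
  proof -
    have "openin (subtopology X (C b)) (inside X q \<inter> C b)"
      using Cq[of b] unfolding pmap_def inn by blast
    then have "closedin (subtopology X (C b)) (topspace (subtopology X (C b)) - inside X q \<inter> C b)"
      by blast
    moreover have "topspace (subtopology X (C b)) - inside X q \<inter> C b = C b - inside X q"
      using closedin_subset[OF Cc[of b]] by auto
    ultimately show ?thesis
      using Cc closedin_trans_full by metis
  qed
  have "topspace X - inside X q = (C True - inside X q) \<union> (C False - inside X q)"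
    using cov closedin_subset[OF Cc] by (auto, metis (full_types))
  then have "closedin X (topspace X - inside X q)"
    using closedin_Un[OF co[of True] co[of False]] by simp
  then have opn: "openin X (inside X q)"
    using openin_closedin_eq[of X "inside X q"] inside_pdom[of X q] pdom_sub[of X q] by blast
  have "continuous_map (subtopology X (pdom X q)) V (\<lambda>x. the (q x))"
  proof (rule pasting_lemma_closed[where I = UNIV and T = "\<lambda>b. pdom X q \<inter> C b" and f = "\<lambda>_ x. the (q x)"])
    show "closedin (subtopology X (pdom X q)) (pdom X q \<inter> C b)" for b
      using N closedin_subset_topspace by blast
    show "continuous_map (subtopology (subtopology X (pdom X q)) (pdom X q \<inter> C b)) V (\<lambda>x. the (q x))" for b
    proof -
      have "subtopology (subtopology X (C b)) (pdom X q \<inter> C b) = subtopology X (pdom X q \<inter> C b)"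
        "subtopology (subtopology X (pdom X q)) (pdom X q \<inter> C b) = subtopology X (pdom X q \<inter> C b)"
        by (auto simp: subtopology_subtopology Int_commute Int_left_commute)
      then show ?thesis
        using Cq[of b] unfolding pmap_def pd by metis
    qed
    show "\<exists>j. j \<in> UNIV \<and> x \<in> pdom X q \<inter> C j \<and> the (q x) = the (q x)"
      if "x \<in> topspace (subtopology X (pdom X q))" for x
      using that cov by auto
  qed auto
  moreover have "the (q x) \<in> D" if "x \<in> pdom X q" for x
    using Cq that cov pdom_sub[of X q] pd unfolding pmap_def by (metis IntI subsetD)
  ultimately show ?thesis
    unfolding pmap_def using closed opn by blast
qed

lemma pmap_concat:
  assumes q: "pmap (prod_topology (top_of_set {0..1::real}) X) q1" "pmap (prod_topology (top_of_set {0..1::real}) X) q2"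
    and eq: "\<And>x. x \<in> topspace X \<Longrightarrow> q1 (1, x) = q2 (0, x)"
  shows "pmap (prod_topology (top_of_set {0..1}) X) (\<lambda>(t, x). if t \<le> 1 / 2 then q1 (2 * t, x) else q2 (2 * t - 1, x))"
    (is "pmap ?Y ?q")
proof (rule pmap_glue_closed[where ?C1.0 = "{p \<in> topspace ?Y. fst p \<in> {..1/2}}" and ?C2.0 = "{p \<in> topspace ?Y. fst p \<in> {1/2..}}"])
  have f: "continuous_map ?Y euclideanreal fst"
    by (meson continuous_map_fst continuous_map_into_fulltopology)
  show "closedin ?Y {p \<in> topspace ?Y. fst p \<in> {..1/2}}" "closedin ?Y {p \<in> topspace ?Y. fst p \<in> {1/2..}}"
    using closedin_continuous_map_preimage[OF f, of "{..1/2}"]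
      closedin_continuous_map_preimage[OF f, of "{1/2..}"] by (simp_all only: closed_atMost closed_atLeast closed_closedin[symmetric])
  have f': "continuous_map (subtopology ?Y S) euclideanreal fst" for S
    by (rule continuous_map_from_subtopology[OF f])
  have s': "continuous_map (subtopology ?Y S) X snd" for S
    by (rule continuous_map_from_subtopology[OF continuous_map_snd])
  have g: "continuous_map (subtopology ?Y S) ?Y (\<lambda>p. (g (fst p), snd p))"
    if "continuous_map euclideanreal euclideanreal g" "\<And>p. p \<in> topspace ?Y \<Longrightarrow> p \<in> S \<Longrightarrow> g (fst p) \<in> {0..1}" for g S
  proof -
    have "continuous_map (subtopology ?Y S) euclideanreal (\<lambda>p. g (fst p))"
      using continuous_map_compose[OF f' that(1)] by (simp add: o_def)
    then have "continuous_map (subtopology ?Y S) (top_of_set {0..1}) (\<lambda>p. g (fst p))"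
      unfolding continuous_map_in_subtopology using that(2) by (auto simp del: topspace_prod_topology)
    then show ?thesis
      by (intro continuous_map_pairedI s')
  qed
  have g1: "continuous_map euclideanreal euclideanreal (\<lambda>t. 2 * t)"
    and g2: "continuous_map euclideanreal euclideanreal (\<lambda>t. 2 * t - 1)"
    by (auto intro!: continuous_intros)
  show "pmap (subtopology ?Y {p \<in> topspace ?Y. fst p \<in> {..1/2}}) ?q"
    by (rule pmap_cong[OF pmap_compose[OF q(1) g[OF g1]]]) (auto simp: case_prod_unfold)
  show "pmap (subtopology ?Y {p \<in> topspace ?Y. fst p \<in> {1/2..}}) ?q"
  proof (rule pmap_cong[OF pmap_compose[OF q(2) g[OF g2]]])
    fix p assume p: "p \<in> topspace (subtopology ?Y {p \<in> topspace ?Y. fst p \<in> {1/2..}})"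
    show "q2 (2 * fst p - 1, snd p) = ?q p"
    proof (cases "fst p = 1 / 2")
      case True
      then show ?thesis
        using eq[of "snd p"] p by (simp add: case_prod_unfold mem_Times_iff True del: field_sum_of_halves)
    next
      case False
      then show ?thesis
        using p by (simp add: case_prod_unfold)
    qed
  qed auto
qed auto

end

subsection \<open>Linear maps between fibers\<close>

context banach_bundle
begin

lemma fiber_zero: "\<theta> \<in> topspace M \<Longrightarrow> bzero B \<theta> \<in> bfiber B \<theta>"
  and fiber_add: "\<theta> \<in> topspace M \<Longrightarrow> v \<in> bfiber B \<theta> \<Longrightarrow> w \<in> bfiber B \<theta> \<Longrightarrow> badd B v w \<in> bfiber B \<theta>"
  and fiber_scale: "\<theta> \<in> topspace M \<Longrightarrow> v \<in> bfiber B \<theta> \<Longrightarrow> bscale B c v \<in> bfiber B \<theta>"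
  using bb unfolding smooth_banach_bundle_def by blast+

lemma fiber_over: "v \<in> bfiber B \<theta> \<Longrightarrow> \<theta> \<in> U \<Longrightarrow> v \<in> bover B U"
  by (auto simp: bover_def)

lemma
  assumes "(U, \<phi>) \<in> btriv B" "\<theta> \<in> U"
  shows chart_add: "v \<in> bfiber B \<theta> \<Longrightarrow> w \<in> bfiber B \<theta> \<Longrightarrow> snd (\<phi> (badd B v w)) = (\<lambda>i. snd (\<phi> v) i + snd (\<phi> w) i)"
    and chart_scale: "v \<in> bfiber B \<theta> \<Longrightarrow> snd (\<phi> (bscale B c v)) = (\<lambda>i. c * snd (\<phi> v) i)"
    and chart_zero: "snd (\<phi> (bzero B \<theta>)) = (\<lambda>i. 0)"
  using chart_linear[OF assms] unfolding linear_on_fiber_def by blast+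

lemma bnorm_zero: "\<theta> \<in> topspace M \<Longrightarrow> bnorm B (bzero B \<theta>) = 0"
proof -
  assume \<theta>: "\<theta> \<in> topspace M"
  obtain U \<phi> where U: "(U, \<phi>) \<in> btriv B" "\<theta> \<in> U"
    using chart_ex[OF \<theta>] by blast
  show ?thesis
    using bnorm_0_iff[OF U(1) fiber_over[OF fiber_zero[OF \<theta>] U(2)]] chart_zero[OF U] by simp
qed

lemma bnorm_scale:
  assumes \<theta>: "\<theta> \<in> topspace M" and v: "v \<in> bfiber B \<theta>"
  shows "bnorm B (bscale B c v) = \<bar>c\<bar> * bnorm B v"
proof -
  obtain U \<phi> where U: "(U, \<phi>) \<in> btriv B" "\<theta> \<in> U"
    using chart_ex[OF \<theta>] by blast
  show ?thesis
    unfolding bnorm_chart[OF U(1) fiber_over[OF fiber_scale[OF \<theta> v] U(2)]] bnorm_chart[OF U(1) fiber_over[OF v U(2)]]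
      chart_scale[OF U v]
    by (rule L2_set_scale)
qed

text \<open>The ray through \<open>v\<close> leaves the ball at \<open>v\<close>. As
  \<open>unit_ball_boundary\<close> is a topological frontier in the fiber, this is what lets the
  covering hypothesis be applied to vectors of norm one.\<close>

lemma unit_vector_boundary:
  assumes \<theta>: "\<theta> \<in> topspace M" and v: "v \<in> bfiber B \<theta>" "bnorm B v = 1"
  shows "v \<in> unit_ball_boundary B \<theta>"
proof -
  let ?X = "subtopology E (bfiber B \<theta>)"
  have S: "unit_ball B \<theta> \<subseteq> topspace ?X"
    by (auto simp: unit_ball_def bover_def)
  have vS: "v \<in> unit_ball B \<theta>"
    using v by (simp add: unit_ball_def)
  obtain U \<phi> where U: "(U, \<phi>) \<in> btriv B" "\<theta> \<in> U"
    using chart_ex[OF \<theta>] by blast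
  let ?x = "snd (\<phi> v)"
  have vo: "v \<in> bover B U"
    by (rule fiber_over[OF v(1) U(2)])
  have x: "?x \<in> topspace (Euclidean_space rk)"
    by (rule chart_coord[OF U(1) vo])
  then have tx: "(\<lambda>i. t * ?x i) \<in> topspace (Euclidean_space rk)" for t
    by (simp add: topspace_Euclidean_space)
  define g where "g = (\<lambda>t. chart_inv B U \<phi> (\<theta>, \<lambda>i. t * ?x i))"
  have gn: "bnorm B (g t) = \<bar>t\<bar>" for t
  proof -
    have "bnorm B v = L2_set ?x {..<rk}"
      by (rule bnorm_chart[OF U(1) vo])
    then show ?thesis
      unfolding g_def bnorm_chart[OF U(1) chart_inv_over[OF U tx]] chart_right[OF U tx]
      using v(2) by (simp add: L2_set_scale)
  qed
  have g1: "g 1 = v"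
    using chart_left[OF U(1) vo] v(1) by (simp add: g_def bover_def)
  have "continuous_map euclideanreal (prod_topology (subtopology M U) (Euclidean_space rk)) (\<lambda>t. (\<theta>, \<lambda>i. t * ?x i))"
    using \<theta> U(2) x
    by (intro continuous_map_pairedI continuous_map_into_Euclidean continuous_map_real_mult)
      (auto simp: topspace_Euclidean_space)
  from continuous_map_compose[OF this chart_inv_cont[OF U(1)]]
  have "continuous_map euclideanreal E g"
    by (simp add: g_def o_def continuous_map_in_subtopology)
  then have g: "continuous_map euclideanreal ?X g"
    unfolding continuous_map_in_subtopology using chart_inv_fiber[OF U tx] by (auto simp: g_def)
  have "v \<notin> ?X interior_of unit_ball B \<theta>"
  proof
    assume "v \<in> ?X interior_of unit_ball B \<theta>"
    then obtain T where T: "openin ?X T" "v \<in> T" "T \<subseteq> unit_ball B \<theta>"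
      unfolding interior_of_def by blast
    have "open {t. g t \<in> T}"
      using openin_continuous_map_preimage[OF g T(1)] by simp
    moreover have "1 \<in> {t. g t \<in> T}"
      using T(2) g1 by simp
    ultimately obtain e where e: "e > 0" "ball 1 e \<subseteq> {t. g t \<in> T}"
      unfolding open_contains_ball by blast
    have "1 + e / 2 \<in> ball 1 e"
      using e(1) by (simp add: dist_real_def)
    then have "g (1 + e / 2) \<in> unit_ball B \<theta>"
      using e(2) T(3) by blast
    then have "bnorm B (g (1 + e / 2)) \<le> 1"
      by (simp add: unit_ball_def)
    then show False
      using gn[of "1 + e / 2"] e(1) by simp
  qed
  then show ?thesis
    using closure_of_subset[OF S] vS unfolding unit_ball_boundary_def frontier_of_def by blast
qed

text \<open>The expansion in the covering relation, extended from vectors of norm one by scaling. In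
  this form it can be iterated, and it forces the kernel to be trivial.\<close>

lemma bnorm_expand:
  assumes \<theta>: "\<theta> \<in> topspace M" and \<Theta>: "\<Theta> \<in> topspace M" and A: "fiber_linear B \<theta> \<Theta> A"
    and out: "A ` unit_ball_boundary B \<theta> \<subseteq> bfiber B \<Theta> - unit_ball B \<Theta>"
    and v: "v \<in> bfiber B \<theta>"
  shows "bnorm B (A v) \<ge> bnorm B v"
proof (cases "bnorm B v = 0")
  case True
  have "A v \<in> bfiber B \<Theta>"
    using A v unfolding fiber_linear_def by blast
  then show ?thesis
    using True bnorm_nonneg by (simp add: bover_def)
next
  case False
  then have r: "bnorm B v > 0"
    using bnorm_nonneg[of v] v by (simp add: bover_def)
  let ?w = "bscale B (1 / bnorm B v) v"
  have Av: "A v \<in> bfiber B \<Theta>"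
    using A v unfolding fiber_linear_def by blast
  have "bnorm B ?w = 1"
    using bnorm_scale[OF \<theta> v] r by simp
  then have "?w \<in> unit_ball_boundary B \<theta>"
    by (rule unit_vector_boundary[OF \<theta> fiber_scale[OF \<theta> v]])
  then have "A ?w \<in> bfiber B \<Theta> - unit_ball B \<Theta>"
    using out by blast
  moreover have "A ?w = bscale B (1 / bnorm B v) (A v)"
    using A v unfolding fiber_linear_def by blast
  ultimately have "bnorm B (bscale B (1 / bnorm B v) (A v)) > 1"
    by (auto simp: unit_ball_def)
  then show ?thesis
    using bnorm_scale[OF \<Theta> Av] r by (simp add: field_simps)
qed

text \<open>Linear maps from Euclidean space into a fiber. The maps obtained along a sequence of
  fibers are kept in this form, so that their source stays the same.\<close>

definition lin_into :: "'a \<Rightarrow> ((nat \<Rightarrow> real) \<Rightarrow> 'e) \<Rightarrow> bool" where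
  "lin_into \<Theta> l \<longleftrightarrow> (\<forall>x\<in>topspace (Euclidean_space rk). l x \<in> bfiber B \<Theta>) \<and>
     (\<forall>x\<in>topspace (Euclidean_space rk). \<forall>y\<in>topspace (Euclidean_space rk). l (\<lambda>i. x i + y i) = badd B (l x) (l y)) \<and>
     (\<forall>c. \<forall>x\<in>topspace (Euclidean_space rk). l (\<lambda>i. c * x i) = bscale B c (l x))"

lemma lin_into_chart_inv:
  assumes U: "(U, \<phi>) \<in> btriv B" "\<theta> \<in> U"
  shows "lin_into \<theta> (\<lambda>x. chart_inv B U \<phi> (\<theta>, x))"
proof -
  let ?E = "topspace (Euclidean_space rk)"
  let ?l = "\<lambda>x. chart_inv B U \<phi> (\<theta>, x)"
  have \<theta>: "\<theta> \<in> topspace M"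
    using chart_sub[OF U(1)] U(2) by blast
  have fib: "?l x \<in> bfiber B \<theta>" and co: "snd (\<phi> (?l x)) = x" if "x \<in> ?E" for x
    using chart_inv_fiber[OF U that] chart_right[OF U that] by auto
  have inj: "v = ?l (snd (\<phi> v))" if "v \<in> bfiber B \<theta>" for v
    using chart_left[OF U(1) fiber_over[OF that U(2)]] that by (simp add: bover_def)
  have "?l (\<lambda>i. x i + y i) = badd B (?l x) (?l y)" if "x \<in> ?E" "y \<in> ?E" for x y
    using inj[OF fiber_add[OF \<theta> fib[OF that(1)] fib[OF that(2)]]]
    by (simp add: chart_add[OF U fib[OF that(1)] fib[OF that(2)]] co[OF that(1)] co[OF that(2)])
  moreover have "?l (\<lambda>i. c * x i) = bscale B c (?l x)" if "x \<in> ?E" for x c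
    using inj[OF fiber_scale[OF \<theta> fib[OF that]]]
    by (simp add: chart_scale[OF U fib[OF that]] co[OF that])
  ultimately show ?thesis
    unfolding lin_into_def using fib by blast
qed

lemma lin_into_compose:
  assumes "lin_into \<theta> l" "fiber_linear B \<theta> \<Theta> A"
  shows "lin_into \<Theta> (\<lambda>x. A (l x))"
  using assms unfolding lin_into_def fiber_linear_def by (simp add: image_subset_iff)

lemma lin_into_rescale:
  assumes "lin_into \<theta> l"
  shows "lin_into \<theta> (\<lambda>x. l (\<lambda>i. c * x i))"
proof -
  have sm: "(\<lambda>i. c * x i) \<in> topspace (Euclidean_space rk)" if "x \<in> topspace (Euclidean_space rk)" for x
    using that by (simp add: topspace_Euclidean_space)
  have add: "l (\<lambda>i. c * (x i + y i)) = badd B (l (\<lambda>i. c * x i)) (l (\<lambda>i. c * y i))"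
    if "x \<in> topspace (Euclidean_space rk)" "y \<in> topspace (Euclidean_space rk)" for x y
    using assms sm[OF that(1)] sm[OF that(2)] unfolding lin_into_def by (simp add: distrib_left)
  have scale: "l (\<lambda>i. c * (d * x i)) = bscale B d (l (\<lambda>i. c * x i))"
    if "x \<in> topspace (Euclidean_space rk)" for d x
    using assms sm[OF that] unfolding lin_into_def by (simp add: mult.left_commute[of c d])
  have fib: "l (\<lambda>i. c * x i) \<in> bfiber B \<theta>" if "x \<in> topspace (Euclidean_space rk)" for x
    using assms sm[OF that] unfolding lin_into_def by simp
  show ?thesis
    unfolding lin_into_def by (intro conjI ballI allI add scale fib)
qed

lemma lin_into_Euclidean:
  assumes l: "lin_into \<theta> l" and U: "(U, \<phi>) \<in> btriv B" "\<theta> \<in> U"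
  shows "Euclidean_linear rk (\<lambda>x. snd (\<phi> (l x)))"
proof
  have fib: "l x \<in> bfiber B \<theta>" if "x \<in> topspace (Euclidean_space rk)" for x
    using l that unfolding lin_into_def by blast
  show "snd (\<phi> (l x)) \<in> topspace (Euclidean_space rk)" if "x \<in> topspace (Euclidean_space rk)" for x
    by (rule chart_coord[OF U(1) fiber_over[OF fib[OF that] U(2)]])
  show "snd (\<phi> (l (\<lambda>i. x i + y i))) = (\<lambda>i. snd (\<phi> (l x)) i + snd (\<phi> (l y)) i)"
    if "x \<in> topspace (Euclidean_space rk)" "y \<in> topspace (Euclidean_space rk)" for x y
    using l that chart_add[OF U fib[OF that(1)] fib[OF that(2)]] unfolding lin_into_def by simp
  show "snd (\<phi> (l (\<lambda>i. c * x i))) = (\<lambda>i. c * snd (\<phi> (l x)) i)"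
    if "x \<in> topspace (Euclidean_space rk)" for c x
    using l that chart_scale[OF U fib[OF that]] unfolding lin_into_def by simp
qed

end

subsection \<open>Covering relations\<close>

locale covering = whitney_sum n M \<A> Eu Es
  for n :: nat and M :: "'a topology" and \<A> :: "'a atlas"
    and Eu :: "('a, 'e) vbundle" and Es :: "('a, 'f) vbundle" +
  fixes f :: "'e \<times> 'f \<Rightarrow> 'e \<times> 'f"
  assumes f_cont: "continuous_map (subtopology V D) V f"
    and cov: "\<And>\<theta>. \<theta> \<in> topspace M \<Longrightarrow> covers M Eu Es f \<theta>"
begin

lemma V_point: "p \<in> topspace V \<longleftrightarrow> fst p \<in> topspace (btop Eu) \<and> snd p \<in> topspace (btop Es) \<and> bproj Eu (fst p) = bproj Es (snd p)"
  by (cases p) (auto simp: whitney_def)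

lemma D_fiber:
  assumes "p \<in> D"
  obtains \<theta> where "\<theta> \<in> topspace M" "p \<in> Dfib Eu Es \<theta>"
proof -
  have "p \<in> topspace V"
    using assms D_sub by blast
  then have p: "fst p \<in> topspace (btop Eu)" "snd p \<in> topspace (btop Es)" "bproj Es (snd p) = bproj Eu (fst p)"
    by (auto simp: V_point)
  show ?thesis
    using that[OF u.proj_in[OF p(1)]] p assms by (simp add: Dfib_def bover_def mem_Times_iff)
qed

lemma covers_homotopy:
  assumes "\<theta> \<in> topspace M"
  obtains h where
    "continuous_map (prod_topology (top_of_set {0..1 :: real}) (subtopology V (Dfib Eu Es \<theta>))) V h"
    "\<forall>v\<in>Dfib Eu Es \<theta>. h (0, v) = f v"
    "h ` ({0..1} \<times> Dminus_fib Eu Es \<theta>) \<inter> D = {}"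
    "h ` ({0..1} \<times> Dfib Eu Es \<theta>) \<inter> Dplus Eu Es = {}"
    "if brank Eu > 0 then
       (\<exists>\<Theta>\<in>topspace M. \<exists>A. fiber_linear Eu \<theta> \<Theta> A \<and>
          A ` unit_ball_boundary Eu \<theta> \<subseteq> bfiber Eu \<Theta> - unit_ball Eu \<Theta> \<and>
          (\<forall>(x, y)\<in>Dfib Eu Es \<theta>. h (1, (x, y)) = (A x, bzero Es \<Theta>)))
     else (\<exists>\<Theta>\<in>topspace M. \<forall>v\<in>Dfib Eu Es \<theta>. h (1, v) = (bzero Eu \<Theta>, bzero Es \<Theta>))"
  using cov[OF assms] unfolding covers_def by (elim exE conjE) (rule that)

text \<open>The homotopy of the covering relation over the fiber of \<open>p\<close> starts at
  \<open>f\<close>, so \<open>f\<close> inherits both of its avoidance properties.\<close>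

lemma f_image:
  assumes p: "p \<in> D"
  shows "f p \<notin> Dplus Eu Es" and "nu p = 1 \<Longrightarrow> f p \<notin> D"
proof -
  obtain \<theta> where \<theta>: "\<theta> \<in> topspace M" "p \<in> Dfib Eu Es \<theta>"
    using D_fiber[OF p] .
  obtain h where h: "\<forall>v\<in>Dfib Eu Es \<theta>. h (0 :: real, v) = f v"
    "h ` ({0..1} \<times> Dminus_fib Eu Es \<theta>) \<inter> D = {}" "h ` ({0..1} \<times> Dfib Eu Es \<theta>) \<inter> Dplus Eu Es = {}"
    by (rule covers_homotopy[OF \<theta>(1)])
  have mem: "(0 :: real, v) \<in> {0..1} \<times> S \<longleftrightarrow> v \<in> S" for v :: "'e \<times> 'f" and S
    by auto
  have "f p = h (0, p)"
    using h(1) \<theta>(2) by simp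
  then show "f p \<notin> Dplus Eu Es"
    using h(3) \<theta>(2) mem[of p] by (metis IntI empty_iff imageI)
  assume "nu p = 1"
  then have "p \<in> Dminus_fib Eu Es \<theta>"
    using p \<theta>(2) by (auto simp: Dminus_fib_def Dfib_def Dminus_eq D_eq)
  then show "f p \<notin> D"
    using h(2) \<open>f p = h (0, p)\<close> mem[of p] by (metis IntI empty_iff imageI)
qed

text \<open>Here \<open>None\<close> is absorbing, so an iterate is defined only if the orbit has
  been in \<open>D\<close> all along. This also keeps \<open>f\<close> from being applied outside
  \<open>D\<close>.\<close>

definition f_opt :: "('e \<times> 'f) option \<Rightarrow> ('e \<times> 'f) option" where
  "f_opt o' = (case o' of None \<Rightarrow> None | Some p \<Rightarrow> if f p \<in> D then Some (f p) else None)"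

lemma f_opt_simps [simp]: "f_opt None = None" "f_opt (Some p) = (if f p \<in> D then Some (f p) else None)"
  by (simp_all add: f_opt_def)

lemma f_opt_orbit:
  assumes "v \<in> D"
  shows "(f_opt ^^ k) (Some v) = (if \<forall>i\<le>k. (f ^^ i) v \<in> D then Some ((f ^^ k) v) else None)"
proof (induction k)
  case 0
  then show ?case using assms by simp
next
  case (Suc k)
  then show ?case
    by (auto simp: le_Suc_eq)
qed

lemma pmap_f_opt:
  assumes q: "pmap X q"
  shows "pmap X (\<lambda>x. f_opt (q x))"
proof -
  have qc: "continuous_map (subtopology X (pdom X q)) V (\<lambda>x. the (q x))" and qD: "\<And>x. x \<in> pdom X q \<Longrightarrow> the (q x) \<in> D"
    using q unfolding pmap_def by auto
  have "continuous_map (subtopology X (pdom X q)) (subtopology V D) (\<lambda>x. the (q x))"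
    unfolding continuous_map_in_subtopology using qc qD by auto
  from continuous_map_compose[OF this f_cont]
  have "pmap X (pstep q (\<lambda>_. f))"
    using f_image qD by (intro pmap_pstep[OF q]) (auto simp: o_def)
  moreover have "pstep q (\<lambda>_. f) = (\<lambda>x. f_opt (q x))"
    by (auto simp: pstep_def f_opt_def fun_eq_iff)
  ultimately show ?thesis by simp
qed

lemma pmap_f_opt_iterate: "pmap X q \<Longrightarrow> pmap X (\<lambda>x. (f_opt ^^ k) (q x))"
  by (induction k) (auto intro: pmap_f_opt)

lemma pair_in_V:
  assumes "\<theta> \<in> topspace M" "v \<in> bfiber Eu \<theta>"
  shows "(v, bzero Es \<theta>) \<in> topspace V" "nu (v, bzero Es \<theta>) = bnorm Eu v"
    "(v, bzero Es \<theta>) \<in> D \<longleftrightarrow> bnorm Eu v \<le> 1"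
    "bnorm Eu v \<le> 1 \<Longrightarrow> (v, bzero Es \<theta>) \<in> Dfib Eu Es \<theta>"
proof -
  show 1: "(v, bzero Es \<theta>) \<in> topspace V"
    using s.fiber_zero[OF assms(1)] assms(2) by (auto simp: V_point bover_def)
  show 2: "nu (v, bzero Es \<theta>) = bnorm Eu v"
    by (simp add: nu_def)
  show 3: "(v, bzero Es \<theta>) \<in> D \<longleftrightarrow> bnorm Eu v \<le> 1"
    using 1 s.bnorm_zero[OF assms(1)] by (simp add: D_eq nu_def ns_def)
  show "(v, bzero Es \<theta>) \<in> Dfib Eu Es \<theta>" if "bnorm Eu v \<le> 1"
    using 3 that assms s.fiber_zero by (simp add: Dfib_def)
qed

text \<open>
  The homotopies of the covering relation are concatenated: the iterate \<open>f\<^sup>k\<close> on a disc is deformed to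
  a linear expansion into another fiber, and then \<open>f\<close> is applied and deformed once more.
\<close>

lemma deform_iterate:
  assumes \<theta>: "\<theta> \<in> topspace M" and U: "(U, \<phi>) \<in> btriv Eu" "\<theta> \<in> U" and pos: "brank Eu > 0"
  shows "\<exists>H l \<Theta>. pmap (cylinder (brank Eu)) H \<and>
     (\<forall>x\<in>ball_n (brank Eu). H (0, x) = (f_opt ^^ k) (Some (chart_inv Eu U \<phi> (\<theta>, x), bzero Es \<theta>))) \<and>
     \<Theta> \<in> topspace M \<and> u.lin_into \<Theta> l \<and>
     (\<forall>x\<in>topspace (Euclidean_space (brank Eu)). L2_set x {..<brank Eu} \<le> bnorm Eu (l x)) \<and>
     (\<forall>x\<in>ball_n (brank Eu). H (1, x) = (if bnorm Eu (l x) \<le> 1 then Some (l x, bzero Es \<Theta>) else None)) \<and>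
     (\<forall>t. \<forall>x\<in>sphere_n (brank Eu). (t, x) \<notin> inside (cylinder (brank Eu)) H)"
proof (induction k)
  let ?r = "brank Eu"
  let ?e = "\<lambda>x. chart_inv Eu U \<phi> (\<theta>, x)"
  case 0
  have ex: "?e x \<in> bfiber Eu \<theta>" "bnorm Eu (?e x) = L2_set x {..<?r}" if "x \<in> topspace (Euclidean_space ?r)" for x
    using u.chart_inv_fiber[OF U that] u.bnorm_chart[OF U(1) u.chart_inv_over[OF U that]] u.chart_right[OF U that]
    by simp_all
  have cs: "continuous_map (cylinder ?r) (Euclidean_space ?r) snd"
    by (meson continuous_map_snd continuous_map_into_fulltopology)
  have "continuous_map (cylinder ?r) (prod_topology (subtopology M U) (Euclidean_space ?r)) (\<lambda>p. (\<theta>, snd p))"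
    using \<theta> U(2) by (intro continuous_map_pairedI cs) auto
  from continuous_map_compose[OF this u.chart_inv_cont[OF U(1)]]
  have "continuous_map (cylinder ?r) (btop Eu) (\<lambda>p. ?e (snd p))"
    by (simp add: o_def continuous_map_in_subtopology)
  moreover have "continuous_map (cylinder ?r) (btop Es) (\<lambda>p. bzero Es \<theta>)"
    using s.fiber_zero[OF \<theta>] by (simp add: bover_def)
  ultimately have "continuous_map (cylinder ?r) (prod_topology (btop Eu) (btop Es)) (\<lambda>p. (?e (snd p), bzero Es \<theta>))"
    by (rule continuous_map_pairedI)
  moreover have inV: "(?e (snd p), bzero Es \<theta>) \<in> topspace V" if "p \<in> topspace (cylinder ?r)" for p
    using pair_in_V(1)[OF \<theta> ex(1)] continuous_map_in[OF cs that] by blast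
  ultimately have "continuous_map (cylinder ?r) V (\<lambda>p. (?e (snd p), bzero Es \<theta>))"
    unfolding whitney_def continuous_map_in_subtopology by (force simp: V_point simp del: topspace_prod_topology)
  then have pm: "pmap (cylinder ?r) (\<lambda>p. Some (?e (snd p), bzero Es \<theta>))"
  proof (rule pmap_Some)
    fix p assume p: "p \<in> topspace (cylinder ?r)"
    then have "snd p \<in> ball_n ?r"
      unfolding topspace_cylinder by (simp add: mem_Times_iff)
    then show "(?e (snd p), bzero Es \<theta>) \<in> D"
      using pair_in_V(3)[OF \<theta> ex(1)] ex(2) by (simp add: ball_n_def)
  qed
  show ?case
  proof (intro exI[of _ "\<lambda>p. Some (?e (snd p), bzero Es \<theta>)"] exI[of _ ?e] exI[of _ \<theta>] conjI ballI allI)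
    show "u.lin_into \<theta> ?e"
      by (rule u.lin_into_chart_inv[OF U])
    show "(t, x) \<notin> inside (cylinder ?r) (\<lambda>p. Some (?e (snd p), bzero Es \<theta>))" if "x \<in> sphere_n ?r" for t x
      using that ex(2)[of x] by (simp add: inside_def nu_def sphere_n_def)
  qed (use pm \<theta> ex in \<open>auto simp: ball_n_def\<close>)
next
  let ?r = "brank Eu"
  let ?Y = "cylinder ?r"
  let ?B = "ball_n ?r"
  case (Suc k)
  then obtain H l \<Theta> where H: "pmap ?Y H"
    and H0: "\<And>x. x \<in> ?B \<Longrightarrow> H (0, x) = (f_opt ^^ k) (Some (chart_inv Eu U \<phi> (\<theta>, x), bzero Es \<theta>))"
    and \<Theta>: "\<Theta> \<in> topspace M" and l: "u.lin_into \<Theta> l"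
    and lx: "\<And>x. x \<in> topspace (Euclidean_space ?r) \<Longrightarrow> L2_set x {..<?r} \<le> bnorm Eu (l x)"
    and H1: "\<And>x. x \<in> ?B \<Longrightarrow> H (1, x) = (if bnorm Eu (l x) \<le> 1 then Some (l x, bzero Es \<Theta>) else None)"
    and HS: "\<And>t x. x \<in> sphere_n ?r \<Longrightarrow> (t, x) \<notin> inside ?Y H"
    by blast
  have lfib: "l x \<in> bfiber Eu \<Theta>" if "x \<in> ?B" for x
    using l that ball_n_sub unfolding u.lin_into_def by blast
  obtain h where hc: "continuous_map (prod_topology (top_of_set {0..1 :: real}) (subtopology V (Dfib Eu Es \<Theta>))) V h"
    and h0': "\<forall>v\<in>Dfib Eu Es \<Theta>. h (0, v) = f v"
    and hm: "h ` ({0..1} \<times> Dminus_fib Eu Es \<Theta>) \<inter> D = {}"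
    and hp: "h ` ({0..1} \<times> Dfib Eu Es \<Theta>) \<inter> Dplus Eu Es = {}"
    and h1: "if brank Eu > 0 then
       (\<exists>\<Theta>'\<in>topspace M. \<exists>A. fiber_linear Eu \<Theta> \<Theta>' A \<and>
          A ` unit_ball_boundary Eu \<Theta> \<subseteq> bfiber Eu \<Theta>' - unit_ball Eu \<Theta>' \<and>
          (\<forall>(x, y)\<in>Dfib Eu Es \<Theta>. h (1, (x, y)) = (A x, bzero Es \<Theta>')))
     else (\<exists>\<Theta>'\<in>topspace M. \<forall>v\<in>Dfib Eu Es \<Theta>. h (1, v) = (bzero Eu \<Theta>', bzero Es \<Theta>'))"
    by (rule covers_homotopy[OF \<Theta>])
  have h0: "h (0, v) = f v" if "v \<in> Dfib Eu Es \<Theta>" for v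
    using h0' that by blast
  obtain \<Theta>' A where \<Theta>': "\<Theta>' \<in> topspace M" and A: "fiber_linear Eu \<Theta> \<Theta>' A"
    and out: "A ` unit_ball_boundary Eu \<Theta> \<subseteq> bfiber Eu \<Theta>' - unit_ball Eu \<Theta>'"
    and hA': "\<forall>(x, y)\<in>Dfib Eu Es \<Theta>. h (1, (x, y)) = (A x, bzero Es \<Theta>')"
    using h1[unfolded if_P[OF pos]] by (elim bexE exE conjE) (rule that)
  have hA: "h (1, (x, y)) = (A x, bzero Es \<Theta>')" if "(x, y) \<in> Dfib Eu Es \<Theta>" for x y
    using bspec[OF hA' that] by simp
  have "l x \<in> bfiber Eu \<Theta>" if "x \<in> topspace (Euclidean_space ?r)" for x
    using l that unfolding u.lin_into_def by blast
  from u.bnorm_expand[OF \<Theta> \<Theta>' A out this]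
  have grow: "bnorm Eu (l x) \<le> bnorm Eu (A (l x))" if "x \<in> topspace (Euclidean_space ?r)" for x
    using that .
  \<comment> \<open>The end of \<open>H\<close>, made constant in time, is the input of the next
    homotopy.\<close>
  define q where "q = (\<lambda>p :: real \<times> (nat \<Rightarrow> real). H (1, snd p))"
  have qv: "q p = (if bnorm Eu (l (snd p)) \<le> 1 then Some (l (snd p), bzero Es \<Theta>) else None)"
    and pB: "snd p \<in> ?B" "fst p \<in> {0..1}" if "p \<in> topspace ?Y" for p
    using that H1[of "snd p"] unfolding topspace_cylinder q_def by (auto simp: mem_Times_iff)
  have qm: "pmap ?Y q"
    unfolding q_def by (rule pmap_compose[OF H]) (auto intro!: continuous_map_pairedI continuous_map_snd)
  have qF: "the (q p) \<in> Dfib Eu Es \<Theta>" "p \<in> topspace ?Y" if "p \<in> pdom ?Y q" for p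
  proof -
    show p: "p \<in> topspace ?Y"
      using that by (simp add: pdom_def)
    then show "the (q p) \<in> Dfib Eu Es \<Theta>"
      using that qv[OF p] pair_in_V(4)[OF \<Theta> lfib[OF pB(1)[OF p]]] by (auto simp: pdom_def split: if_splits)
  qed
  \<comment> \<open>The homotopy \<open>h\<close> acts at the time given by the cylinder. So
    \<open>K\<close> runs from \<open>f\<close> applied to the end of \<open>H\<close> to the next
    linear map.\<close>
  define K where "K = pstep q (\<lambda>p v. h (fst p, v))"
  have Kpm: "pmap ?Y K"
    unfolding K_def
  proof (rule pmap_pstep[OF qm])
    have "continuous_map (subtopology ?Y (pdom ?Y q)) (subtopology V (Dfib Eu Es \<Theta>)) (\<lambda>p. the (q p))"
      unfolding continuous_map_in_subtopology using qm qF by (auto simp: pmap_def)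
    moreover have "continuous_map (subtopology ?Y (pdom ?Y q)) (top_of_set {0..1}) fst"
      by (intro continuous_map_from_subtopology continuous_map_fst)
    ultimately have "continuous_map (subtopology ?Y (pdom ?Y q))
       (prod_topology (top_of_set {0..1}) (subtopology V (Dfib Eu Es \<Theta>))) (\<lambda>p. (fst p, the (q p)))"
      by (intro continuous_map_pairedI)
    from continuous_map_compose[OF this hc]
    show "continuous_map (subtopology ?Y (pdom ?Y q)) V (\<lambda>p. h (fst p, the (q p)))"
      by (simp add: o_def)
  next
    fix p assume p: "p \<in> pdom ?Y q"
    show "h (fst p, the (q p)) \<notin> Dplus Eu Es"
      using hp qF(1)[OF p] pB(2)[OF qF(2)[OF p]] by blast
    assume "nu (the (q p)) = 1"
    then have "the (q p) \<in> Dminus_fib Eu Es \<Theta>"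
      using qF(1)[OF p] by (auto simp: Dminus_fib_def Dfib_def Dminus_eq D_eq)
    then show "h (fst p, the (q p)) \<notin> D"
      using hm pB(2)[OF qF(2)[OF p]] by blast
  qed
  have F: "pmap ?Y (\<lambda>p. f_opt (H p))"
    by (rule pmap_f_opt[OF H])
  have top01: "(t, x) \<in> topspace ?Y" if "x \<in> ?B" "t \<in> {0..1}" for t x
    using that unfolding topspace_cylinder by simp
  have K0: "f_opt (H (1, x)) = K (0, x)" if "x \<in> ?B" for x
    using h0[OF pair_in_V(4)[OF \<Theta> lfib[OF that]]]
    by (auto simp: K_def pstep_def q_def H1[OF that] simp del: topspace_prod_topology)
  \<comment> \<open>\<open>K\<close> is defined here where both \<open>l x\<close> and
    \<open>A (l x)\<close> are in the unit ball; by expansion the second condition implies the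
    first.\<close>
  have K1: "K (1, x) = (if bnorm Eu (A (l x)) \<le> 1 then Some (A (l x), bzero Es \<Theta>') else None)" if "x \<in> ?B" for x
  proof -
    have Afib: "A (l x) \<in> bfiber Eu \<Theta>'"
      using A lfib[OF that] unfolding fiber_linear_def by blast
    have g: "bnorm Eu (l x) \<le> bnorm Eu (A (l x))"
      using grow that ball_n_sub by blast
    have "q (1, x) = (if bnorm Eu (l x) \<le> 1 then Some (l x, bzero Es \<Theta>) else None)"
      by (simp add: q_def H1[OF that])
    then show ?thesis
      using g hA[OF pair_in_V(4)[OF \<Theta> lfib[OF that]]] pair_in_V(3)[OF \<Theta>' Afib]
      by (auto simp: K_def pstep_def)
  qed
  let ?G = "\<lambda>(t, x). if t \<le> 1 / 2 then f_opt (H (2 * t, x)) else K (2 * t - 1, x)"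
  show ?case
  proof (intro exI[of _ ?G] exI[of _ "\<lambda>x. A (l x)"] exI[of _ \<Theta>'] conjI ballI allI)
    have "\<And>x. x \<in> topspace (subtopology (Euclidean_space ?r) ?B) \<Longrightarrow> f_opt (H (1, x)) = K (0, x)"
      using K0 by auto
    from pmap_concat[OF F Kpm this] show "pmap ?Y ?G" .
    show "u.lin_into \<Theta>' (\<lambda>x. A (l x))"
      by (rule u.lin_into_compose[OF l A])
    show "L2_set x {..<?r} \<le> bnorm Eu (A (l x))" if "x \<in> topspace (Euclidean_space ?r)" for x
      using lx[OF that] grow[OF that] by linarith
    \<comment> \<open>In the first half, a value of \<open>H\<close> over the sphere lies on D^-, so
      \<open>f\<close> throws it out of \<open>D\<close>. In the second half, \<open>l x\<close> has
      norm at least one, so if \<open>q\<close> is defined its value lies on D^- and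
      \<open>h\<close> throws it out.\<close>
    show "(t, x) \<notin> inside ?Y ?G" if x: "x \<in> sphere_n ?r" for t x
    proof
      assume i: "(t, x) \<in> inside ?Y ?G"
      then have tx: "(t, x) \<in> topspace ?Y"
        by (simp add: inside_def)
      then have t: "t \<in> {0..1}" and xB: "x \<in> ?B"
        unfolding topspace_cylinder by auto
      show False
      proof (cases "t \<le> 1 / 2")
        case True
        then have "f_opt (H (2 * t, x)) \<noteq> None"
          using i by (simp add: inside_def)
        then obtain v where v: "H (2 * t, x) = Some v" "f v \<in> D"
          by (cases "H (2 * t, x)") (auto split: if_splits)
        have "(2 * t, x) \<in> topspace ?Y"
          by (rule top01[OF xB]) (use True t in auto)
        then have d: "(2 * t, x) \<in> pdom ?Y H" and nv: "\<not> nu v < 1"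
          using HS[OF x, of "2 * t"] v by (simp_all add: pdom_def inside_def del: topspace_prod_topology)
        have "the (H (2 * t, x)) \<in> D"
          using H d unfolding pmap_def by blast
        then have vD: "v \<in> D"
          by (simp add: v(1))
        with nv have "nu v = 1"
          by (simp add: D_eq)
        then show False
          using f_image(2)[OF vD] v(2) by blast
      next
        case False
        then have Kn: "K (2 * t - 1, x) \<noteq> None"
          using i by (simp add: inside_def)
        have qx: "q (2 * t - 1, x) = (if bnorm Eu (l x) \<le> 1 then Some (l x, bzero Es \<Theta>) else None)"
          by (simp add: q_def H1[OF xB])
        have le: "bnorm Eu (l x) \<le> 1" and hD: "h (2 * t - 1, (l x, bzero Es \<Theta>)) \<in> D"
          using Kn qx by (auto simp: K_def pstep_def split: if_splits)
        have "bnorm Eu (l x) = 1"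
          using le lx[of x] x by (simp add: sphere_n_def)
        then have "(l x, bzero Es \<Theta>) \<in> Dminus_fib Eu Es \<Theta>"
          using pair_in_V[OF \<Theta> lfib[OF xB]] le by (auto simp: Dminus_fib_def Dfib_def Dminus_eq D_eq)
        moreover have "2 * t - 1 \<in> {0..1}"
          using False t by auto
        ultimately have "h (2 * t - 1, (l x, bzero Es \<Theta>)) \<in> h ` ({0..1} \<times> Dminus_fib Eu Es \<Theta>)"
          by blast
        then show False
          using hm hD by blast
      qed
    qed
  qed (use H0 K1 \<Theta>' in auto)
qed

end

section \<open>Finite and infinite orbits in \<open>D\<close>\<close>

context covering
begin

text \<open>Without such an orbit the deformation starts nowhere defined, against
  \<open>no_null_homotopy\<close>. That theorem asks for a top defined on the whole ball with norm
  below one, while \<open>H\<close> ends with a map defined only where \<open>l\<close> stays in the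
  unit ball. So a contraction of the argument is appended.\<close>

lemma finite_orbit_unstable:
  assumes \<theta>: "\<theta> \<in> topspace M" and pos: "brank Eu > 0"
  shows "\<exists>v\<in>Dfib Eu Es \<theta>. \<forall>i\<le>k. (f ^^ i) v \<in> D"
proof (rule ccontr)
  assume contra: "\<not> ?thesis"
  let ?r = "brank Eu"
  let ?E = "Euclidean_space ?r"
  let ?Y = "cylinder ?r"
  let ?B = "ball_n ?r"
  obtain U \<phi> where U: "(U, \<phi>) \<in> btriv Eu" "\<theta> \<in> U"
    using u.chart_ex[OF \<theta>] by blast
  obtain H l \<Theta> where H: "pmap ?Y H"
    and H0: "\<forall>x\<in>?B. H (0, x) = (f_opt ^^ k) (Some (chart_inv Eu U \<phi> (\<theta>, x), bzero Es \<theta>))"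
    and \<Theta>: "\<Theta> \<in> topspace M" and l: "u.lin_into \<Theta> l"
    and lx: "\<forall>x\<in>topspace ?E. L2_set x {..<?r} \<le> bnorm Eu (l x)"
    and H1: "\<forall>x\<in>?B. H (1, x) = (if bnorm Eu (l x) \<le> 1 then Some (l x, bzero Es \<Theta>) else None)"
    and HS: "\<forall>t. \<forall>x\<in>sphere_n ?r. (t, x) \<notin> inside ?Y H"
    using deform_iterate[OF \<theta> U pos, of k] by (elim exE conjE) (rule that)
  have H0None: "H (0, x) = None" if "x \<in> ?B" for x
  proof -
    let ?v = "(chart_inv Eu U \<phi> (\<theta>, x), bzero Es \<theta>)"
    have xE: "x \<in> topspace ?E" and "L2_set x {..<?r} \<le> 1"
      using that by (auto simp: ball_n_def)
    then have "bnorm Eu (fst ?v) \<le> 1"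
      using u.bnorm_chart[OF U(1) u.chart_inv_over[OF U xE]] u.chart_right[OF U xE] by simp
    then have v: "?v \<in> Dfib Eu Es \<theta>"
      using pair_in_V(4)[OF \<theta> u.chart_inv_fiber[OF U xE]] by simp
    then have "?v \<in> D"
      by (simp add: Dfib_def)
    from f_opt_orbit[OF this, of k] show ?thesis
      using contra v H0 that by (metis (full_types))
  qed
  obtain U1 \<phi>1 where U1: "(U1, \<phi>1) \<in> btriv Eu" "\<Theta> \<in> U1"
    using u.chart_ex[OF \<Theta>] by blast
  interpret L: Euclidean_linear ?r "\<lambda>x. snd (\<phi>1 (l x))"
    by (rule u.lin_into_Euclidean[OF l U1])
  have lfib: "l x \<in> bfiber Eu \<Theta>" if "x \<in> topspace ?E" for x
    using l that unfolding u.lin_into_def by blast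
  have ln: "bnorm Eu (l x) = L2_set (snd (\<phi>1 (l x))) {..<?r}" if "x \<in> topspace ?E" for x
    by (rule u.bnorm_chart[OF U1(1) u.fiber_over[OF lfib[OF that] U1(2)]])
  obtain C where C: "C \<ge> 0" "\<And>x. x \<in> ?B \<Longrightarrow> L2_set (snd (\<phi>1 (l x))) {..<?r} \<le> C"
  proof -
    have "compactin euclideanreal ((\<lambda>x. L2_set (snd (\<phi>1 (l x))) {..<?r}) ` ?B)"
      by (rule image_compactin[OF compactin_ball_n continuous_map_L2_set[OF L.cont]])
    then have "bounded ((\<lambda>x. L2_set (snd (\<phi>1 (l x))) {..<?r}) ` ?B)"
      by (simp add: compact_imp_bounded)
    then obtain C where "\<And>x. x \<in> ?B \<Longrightarrow> \<bar>L2_set (snd (\<phi>1 (l x))) {..<?r}\<bar> \<le> C"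
      unfolding bounded_iff by auto
    then show ?thesis
      by (intro that[of "\<bar>C\<bar>"]) force+
  qed
  \<comment> \<open>With \<open>C\<close> a bound for \<open>l\<close> on the ball, \<open>l\<close>
    applied to \<open>c\<close> times \<open>x\<close> has norm at most \<open>C / (1 + C)\<close>,
    which is below one.\<close>
  define c where "c = 1 / (1 + C)"
  have c: "0 < c" "c \<le> 1"
    using C(1) by (simp_all add: c_def)
  have sm: "(\<lambda>i. t * x i) \<in> topspace ?E" if "x \<in> topspace ?E" for t x
    using that by (simp add: topspace_Euclidean_space)
  have smB: "(\<lambda>i. t * x i) \<in> ?B" if "x \<in> ?B" "0 \<le> t" "t \<le> 1" for t x
    using that sm mult_mono[of t 1 "L2_set x {..<?r}" 1] by (simp add: ball_n_def L2_set_scale)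
  have small: "bnorm Eu (l (\<lambda>i. c * x i)) < 1" if "x \<in> ?B" for x
  proof -
    have xE: "x \<in> topspace ?E"
      using that ball_n_sub by blast
    have "bnorm Eu (l (\<lambda>i. c * x i)) = c * L2_set (snd (\<phi>1 (l x))) {..<?r}"
      using c by (simp add: ln[OF sm[OF xE]] L.scale[OF xE] L2_set_scale)
    also have "\<dots> \<le> c * C"
      using C(2)[OF that] c by simp
    also have "\<dots> < 1"
      using C(1) by (simp add: c_def)
    finally show ?thesis .
  qed
  \<comment> \<open>The factor falls from 1 to \<open>c\<close>. It stays positive, so that no zeros
    arise over the sphere.\<close>
  define \<mu> where "\<mu> = (\<lambda>t. 1 - t + t * c)"
  have \<mu>: "0 < \<mu> t" "\<mu> t \<le> 1" if "t \<in> {0..1}" for t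
  proof -
    show "\<mu> t \<le> 1"
      using that c mult_left_mono[of c 1 t] by (simp add: \<mu>_def)
    have "\<mu> t = (1 - t) * 1 + t * c"
      by (simp add: \<mu>_def)
    then show "0 < \<mu> t"
      using that c by (cases "t = 1") (auto intro!: add_pos_nonneg simp: \<mu>_def)
  qed
  have topB: "topspace ?Y = {0..1} \<times> ?B"
    by (rule topspace_cylinder)
  let ?K = "\<lambda>p :: real \<times> (nat \<Rightarrow> real). H (1, \<lambda>i. \<mu> (fst p) * snd p i)"
  have Kc: "continuous_map ?Y ?Y (\<lambda>p. (1, \<lambda>i. \<mu> (fst p) * snd p i))"
  proof (rule continuous_map_pairedI)
    have f: "continuous_map ?Y euclideanreal fst"
      by (meson continuous_map_fst continuous_map_into_fulltopology)
    have s: "continuous_map ?Y ?E snd"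
      by (meson continuous_map_snd continuous_map_into_fulltopology)
    have in_B: "fst p \<in> {0..1}" "snd p \<in> ?B" if "p \<in> topspace ?Y" for p
      using that unfolding topB by auto
    have "continuous_map ?Y ?E (\<lambda>p i. \<mu> (fst p) * snd p i)"
    proof (rule continuous_map_into_Euclidean)
      show "continuous_map ?Y euclideanreal (\<lambda>p. \<mu> (fst p) * snd p i)" for i
        unfolding \<mu>_def
        by (intro continuous_map_add continuous_map_diff continuous_map_real_mult f
            continuous_map_Euclidean_coordinate[OF s]) auto
      show "\<mu> (fst p) * snd p i = 0" if "p \<in> topspace ?Y" "?r \<le> i" for p i
        using in_B(2)[OF that(1)] that(2) by (simp add: ball_n_def topspace_Euclidean_space)
    qed
    moreover have "(\<lambda>i. \<mu> (fst p) * snd p i) \<in> ?B" if "p \<in> topspace ?Y" for p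
      using smB[OF in_B(2)[OF that]] \<mu>[OF in_B(1)[OF that]] by simp
    ultimately show "continuous_map ?Y (subtopology ?E ?B) (\<lambda>p i. \<mu> (fst p) * snd p i)"
      unfolding continuous_map_in_subtopology by blast
  qed simp
  have K: "pmap ?Y ?K"
    by (rule pmap_compose[OF H Kc])
  define J where "J = (\<lambda>(t :: real, x). if t \<le> 1 / 2 then H (2 * t, x) else ?K (2 * t - 1, x))"
  have J: "pmap ?Y J"
    unfolding J_def by (rule pmap_concat[OF H K]) (simp add: \<mu>_def)
  have J_late: "J (t, x) = (if bnorm Eu (l (\<lambda>i. \<mu> (2 * t - 1) * x i)) \<le> 1
      then Some (l (\<lambda>i. \<mu> (2 * t - 1) * x i), bzero Es \<Theta>) else None)"
    if "x \<in> ?B" "1 / 2 < t" "t \<le> 1" for t x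
  proof -
    have m: "0 < \<mu> (2 * t - 1)" "\<mu> (2 * t - 1) \<le> 1"
      using \<mu>[of "2 * t - 1"] that by auto
    have "J (t, x) = H (1, \<lambda>i. \<mu> (2 * t - 1) * x i)"
      using that(2) by (simp add: J_def)
    then show ?thesis
      using H1 smB[OF that(1)] m by simp
  qed
  define W where "W = inside ?Y J"
  define G where "G = (\<lambda>w. fst (the (J w)))"
  have Jd: "closedin ?Y (pdom ?Y J)" "openin ?Y W" "continuous_map (subtopology ?Y (pdom ?Y J)) V (\<lambda>w. the (J w))"
    using J unfolding pmap_def W_def by auto
  have Wd: "W \<subseteq> pdom ?Y J" "W \<subseteq> {0..1} \<times> ?B"
  proof -
    show "W \<subseteq> pdom ?Y J"
      unfolding W_def by (rule inside_pdom)
    then show "W \<subseteq> {0..1} \<times> ?B"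
      using pdom_sub[of ?Y J] unfolding topB by (rule subset_trans)
  qed
  have Gc: "continuous_map (subtopology ?Y (pdom ?Y J)) (btop Eu) G"
    using continuous_map_compose[OF Jd(3) fst_cont] by (simp add: G_def o_def)
  interpret N: bundle_map n M \<A> Eu W G
  proof
    show "W \<subseteq> {0..1} \<times> ball_n (brank Eu)"
      by (rule Wd(2))
    show "continuous_map (subtopology ?Y W) (btop Eu) G"
      by (rule continuous_map_from_subtopology_mono[OF Gc Wd(1)])
  qed (rule pos)
  \<comment> \<open>A zero has norm below one, so passing to the open set \<open>W\<close> loses
    none of the zeros on the closed domain of \<open>J\<close>. This makes them closed in the whole
    cylinder.\<close>
  have zer: "N.zeros = {w \<in> pdom ?Y J. bnorm Eu (G w) = 0}"
  proof -
    have "w \<in> W \<and> bnorm Eu (G w) = 0 \<longleftrightarrow> w \<in> pdom ?Y J \<and> bnorm Eu (G w) = 0" for w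
      unfolding W_def inside_def pdom_def nu_def G_def by auto
    then show ?thesis
      unfolding N.zeros_def by blast
  qed
  have zclosed: "closedin ?Y N.zeros"
  proof -
    have "closedin (subtopology ?Y (pdom ?Y J)) {w \<in> topspace (subtopology ?Y (pdom ?Y J)). (bnorm Eu \<circ> G) w \<in> {0}}"
      by (rule closedin_continuous_map_preimage[OF continuous_map_compose[OF Gc u.bnorm_cont]]) simp
    moreover have "{w \<in> topspace (subtopology ?Y (pdom ?Y J)). (bnorm Eu \<circ> G) w \<in> {0}} = N.zeros"
      unfolding zer using pdom_sub[of ?Y J] by (auto simp del: topspace_prod_topology)
    ultimately show ?thesis
      using Jd(1) closedin_trans_full by metis
  qed
  have z0: "(0, x) \<notin> N.zeros" for x
  proof
    assume "(0, x) \<in> N.zeros"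
    then have "(0, x) \<in> pdom ?Y J"
      unfolding zer by blast
    then have "x \<in> ?B" "J (0, x) \<noteq> None"
      using pdom_sub[of ?Y J] topB by (auto simp: pdom_def)
    then show False
      using H0None by (simp add: J_def)
  qed
  \<comment> \<open>In the first half \<open>H\<close> is not inside over the sphere; in the second
    half \<open>l\<close> is applied to a nonzero vector, whose norm it does not decrease.\<close>
  have zS: "(t, x) \<notin> N.zeros" if x: "x \<in> sphere_n ?r" for t x
  proof
    assume z: "(t, x) \<in> N.zeros"
    then have w: "(t, x) \<in> W" and g0: "bnorm Eu (G (t, x)) = 0"
      by (auto simp: N.zeros_def)
    then have t: "t \<in> {0..1}" and xB: "x \<in> ?B"
      using Wd(2) by auto
    have xE: "x \<in> topspace ?E" and x1: "L2_set x {..<?r} = 1"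
      using x by (auto simp: sphere_n_def)
    show False
    proof (cases "t \<le> 1 / 2")
      case True
      then have "(2 * t, x) \<in> topspace ?Y"
        unfolding topB using t xB by simp
      then have "(2 * t, x) \<in> inside ?Y H"
        using w True by (simp add: W_def inside_def J_def del: topspace_prod_topology)
      then show False
        using HS x by blast
    next
      case False
      then have l2: "1 / 2 < t" "t \<le> 1"
        using t by auto
      have "J (t, x) \<noteq> None"
        using w by (simp add: W_def inside_def)
      then have "G (t, x) = l (\<lambda>i. \<mu> (2 * t - 1) * x i)"
        using J_late[OF xB l2] by (simp add: G_def split: if_splits)
      moreover have "L2_set (\<lambda>i. \<mu> (2 * t - 1) * x i) {..<?r} \<le> bnorm Eu (l (\<lambda>i. \<mu> (2 * t - 1) * x i))"
        using lx sm[OF xE] by blast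
      moreover have "L2_set (\<lambda>i. \<mu> (2 * t - 1) * x i) {..<?r} > 0"
        using \<mu>[of "2 * t - 1"] l2 x1 by (simp add: L2_set_scale)
      ultimately show False
        using g0 by simp
    qed
  qed
  have J1: "J (1, x) = Some (l (\<lambda>i. c * x i), bzero Es \<Theta>)" if "x \<in> ?B" for x
    using J_late[OF that, of 1] small[OF that] by (simp add: \<mu>_def)
  have W1: "{1} \<times> ?B \<subseteq> W"
  proof
    fix p assume p: "p \<in> {1 :: real} \<times> ?B"
    then obtain x where x: "p = (1, x)" "x \<in> ?B"
      by blast
    have "p \<in> topspace ?Y"
      unfolding topB using x by simp
    then show "p \<in> W"
      using J1[OF x(2)] small[OF x(2)] x(1) by (simp add: W_def inside_def nu_def del: topspace_prod_topology)
  qed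
  interpret Lc: Euclidean_linear ?r "\<lambda>x. snd (\<phi>1 (l (\<lambda>i. c * x i)))"
    by (rule u.lin_into_Euclidean[OF u.lin_into_rescale[OF l] U1])
  \<comment> \<open>The bound \<open>lx\<close> was carried through all the deformations for this: a
    map that does not decrease norms has no kernel.\<close>
  have ker: "x = (\<lambda>i. 0)" if x: "x \<in> topspace ?E" and z: "snd (\<phi>1 (l (\<lambda>i. c * x i))) = (\<lambda>i. 0)" for x
  proof -
    have "bnorm Eu (l (\<lambda>i. c * x i)) = 0"
      using ln[OF sm[OF x]] z by (simp add: L2_set_def)
    then have "L2_set (\<lambda>i. c * x i) {..<?r} \<le> 0"
      using lx sm[OF x] by metis
    then have "c * L2_set x {..<?r} \<le> 0"
      using c by (simp add: L2_set_scale)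
    then have "L2_set x {..<?r} = 0"
      using c L2_set_nonneg[of x "{..<?r}"] by (simp add: mult_le_0_iff)
    then show ?thesis
      using L2_set_0_iff[OF x] by blast
  qed
  obtain L' where L': "homeomorphic_maps ?E ?E (\<lambda>x. snd (\<phi>1 (l (\<lambda>i. c * x i)))) L'"
    by (rule Lc.homeomorphic[OF ker])
  show False
  proof (rule N.no_null_homotopy[OF Jd(2) zclosed z0 zS W1 U1(1) _ _ L' Lc.zero])
    show "bproj Eu (G (1, x)) \<in> U1" if "x \<in> ?B" for x
      using J1[OF that] lfib[OF sm, of x c] that ball_n_sub U1(2) by (auto simp: G_def bover_def)
    show "snd (\<phi>1 (G (1, x))) = snd (\<phi>1 (l (\<lambda>i. c * x i)))" if "x \<in> ?B" for x
      using J1[OF that] by (simp add: G_def)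
  qed
qed

text \<open>For rank 0 the unstable norm vanishes, so D^+ is the whole level set where the stable
  norm is one. The path of \<open>p\<close> under the homotopy avoids it and ends in a zero vector,
  so by the intermediate value theorem it starts with stable norm below one.\<close>

lemma image_in_D:
  assumes u0: "brank Eu = 0" and p: "p \<in> D"
  shows "f p \<in> D"
proof -
  obtain \<theta> where \<theta>: "\<theta> \<in> topspace M" "p \<in> Dfib Eu Es \<theta>"
    using D_fiber[OF p] .
  obtain h where hc: "continuous_map (prod_topology (top_of_set {0..1 :: real}) (subtopology V (Dfib Eu Es \<theta>))) V h"
    and h0: "\<forall>v\<in>Dfib Eu Es \<theta>. h (0, v) = f v"
    and hp: "h ` ({0..1} \<times> Dfib Eu Es \<theta>) \<inter> Dplus Eu Es = {}"
    and h1: "if brank Eu > 0 then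
       (\<exists>\<Theta>\<in>topspace M. \<exists>A. fiber_linear Eu \<theta> \<Theta> A \<and>
          A ` unit_ball_boundary Eu \<theta> \<subseteq> bfiber Eu \<Theta> - unit_ball Eu \<Theta> \<and>
          (\<forall>(x, y)\<in>Dfib Eu Es \<theta>. h (1, (x, y)) = (A x, bzero Es \<Theta>)))
     else (\<exists>\<Theta>\<in>topspace M. \<forall>v\<in>Dfib Eu Es \<theta>. h (1, v) = (bzero Eu \<Theta>, bzero Es \<Theta>))"
    by (rule covers_homotopy[OF \<theta>(1)])
  obtain \<Theta> where \<Theta>: "\<Theta> \<in> topspace M" "h (1, p) = (bzero Eu \<Theta>, bzero Es \<Theta>)"
    using h1 u0 \<theta>(2) by auto
  have pV: "p \<in> topspace V"
    using p D_sub by blast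
  have "continuous_map (top_of_set {0..1 :: real}) (prod_topology (top_of_set {0..1}) (subtopology V (Dfib Eu Es \<theta>))) (\<lambda>t. (t, p))"
    using pV \<theta>(2) by (intro continuous_map_pairedI continuous_map_id[unfolded id_def]) simp
  from continuous_map_compose[OF this hc]
  have hpc: "continuous_map (top_of_set {0..1}) V (\<lambda>t. h (t, p))"
    by (simp add: o_def)
  have nu0: "nu q = 0" if "q \<in> topspace V" for q
  proof -
    have q: "fst q \<in> topspace (btop Eu)"
      using that by (simp add: V_point)
    obtain U \<phi> where U: "(U, \<phi>) \<in> btriv Eu" "bproj Eu (fst q) \<in> U"
      using u.chart_ex[OF u.proj_in[OF q]] by blast
    then have "fst q \<in> bover Eu U"
      using q by (simp add: bover_def)
    then show ?thesis
      using u.bnorm_chart[OF U(1)] u0 by (simp add: nu_def)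
  qed
  have hV: "h (t, p) \<in> topspace V" if "t \<in> {0..1}" for t
    using continuous_map_in[OF hpc] that by simp
  have ne: "ns (h (t, p)) \<noteq> 1" if "t \<in> {0..1}" for t
  proof
    assume "ns (h (t, p)) = 1"
    then have "h (t, p) \<in> Dplus Eu Es"
      using hV[OF that] nu0 by (simp add: Dplus_eq)
    then show False
      using hp that \<theta>(2) by blast
  qed
  have "continuous_on {0..1} (\<lambda>t. ns (h (t, p)))"
    using continuous_map_compose[OF hpc ns_cont] by (simp add: o_def)
  moreover have "ns (h (1, p)) = 0"
    using \<Theta> s.bnorm_zero by (simp add: ns_def)
  ultimately have "\<not> 1 \<le> ns (h (0, p))"
    using IVT2'[where f = "\<lambda>t. ns (h (t, p))" and a = 0 and b = 1 and y = 1] ne by fastforce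
  then have "ns (h (0, p)) \<le> 1"
    by simp
  then show ?thesis
    using hV[of 0] nu0 h0 \<theta>(2) by (simp add: D_eq)
qed

lemma fiber_point: "\<theta> \<in> topspace M \<Longrightarrow> (bzero Eu \<theta>, bzero Es \<theta>) \<in> Dfib Eu Es \<theta>"
  using pair_in_V(4)[OF _ u.fiber_zero] u.bnorm_zero by simp

lemma finite_orbit:
  assumes \<theta>: "\<theta> \<in> topspace M"
  shows "\<exists>v\<in>Dfib Eu Es \<theta>. \<forall>i\<le>k. (f ^^ i) v \<in> D"
proof (cases "brank Eu = 0")
  case True
  let ?v = "(bzero Eu \<theta>, bzero Es \<theta>)"
  have "(f ^^ i) ?v \<in> D" for i
  proof (induction i)
    case 0
    then show ?case
      using fiber_point[OF \<theta>] by (simp add: Dfib_def)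
  next
    case (Suc i)
    then show ?case
      using image_in_D[OF True] by simp
  qed
  then show ?thesis
    using fiber_point[OF \<theta>] by blast
next
  case False
  then show ?thesis
    using finite_orbit_unstable[OF \<theta>] by simp
qed

text \<open>Charts of the two bundles at \<open>\<theta>\<close> present the fiber of
  \<open>D\<close> as a continuous image of a product of two closed balls.\<close>

lemma compactin_Dfib:
  assumes \<theta>: "\<theta> \<in> topspace M"
  shows "compactin V (Dfib Eu Es \<theta>)"
proof -
  obtain U \<phi> where U: "(U, \<phi>) \<in> btriv Eu" "\<theta> \<in> U"
    using u.chart_ex[OF \<theta>] by blast
  obtain U' \<psi> where U': "(U', \<psi>) \<in> btriv Es" "\<theta> \<in> U'"
    using s.chart_ex[OF \<theta>] by blast
  let ?X = "prod_topology (Euclidean_space (brank Eu)) (Euclidean_space (brank Es))"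
  let ?e = "\<lambda>p. (chart_inv Eu U \<phi> (\<theta>, fst p), chart_inv Es U' \<psi> (\<theta>, snd p))"
  have "continuous_map ?X (prod_topology (subtopology M U) (Euclidean_space (brank Eu))) (\<lambda>p. (\<theta>, fst p))"
    using \<theta> U(2) by (intro continuous_map_pairedI continuous_map_fst) simp
  from continuous_map_compose[OF this u.chart_inv_cont[OF U(1)]]
  have c1: "continuous_map ?X (btop Eu) (\<lambda>p. chart_inv Eu U \<phi> (\<theta>, fst p))"
    by (simp add: o_def continuous_map_in_subtopology)
  have "continuous_map ?X (prod_topology (subtopology M U') (Euclidean_space (brank Es))) (\<lambda>p. (\<theta>, snd p))"
    using \<theta> U'(2) by (intro continuous_map_pairedI continuous_map_snd) simp
  from continuous_map_compose[OF this s.chart_inv_cont[OF U'(1)]]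
  have c2: "continuous_map ?X (btop Es) (\<lambda>p. chart_inv Es U' \<psi> (\<theta>, snd p))"
    by (simp add: o_def continuous_map_in_subtopology)
  have "bproj Eu (fst (?e p)) = bproj Es (snd (?e p))" if "p \<in> topspace ?X" for p
    using that u.chart_inv_proj[OF U] s.chart_inv_proj[OF U'] by auto
  then have ce: "continuous_map ?X V ?e"
    unfolding whitney_def continuous_map_in_subtopology
    using continuous_map_pairedI[OF c1 c2] by (simp add: case_prod_unfold Pi_iff)
  have "compactin ?X (ball_n (brank Eu) \<times> ball_n (brank Es))"
    by (simp add: compactin_Times compactin_ball_n)
  then have "compactin V (?e ` (ball_n (brank Eu) \<times> ball_n (brank Es)))"
    by (rule image_compactin[OF _ ce])
  also have "?e ` (ball_n (brank Eu) \<times> ball_n (brank Es)) = Dfib Eu Es \<theta>"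
  proof
    show "?e ` (ball_n (brank Eu) \<times> ball_n (brank Es)) \<subseteq> Dfib Eu Es \<theta>"
    proof
      fix q assume "q \<in> ?e ` (ball_n (brank Eu) \<times> ball_n (brank Es))"
      then obtain x y where q: "q = ?e (x, y)" and x: "x \<in> ball_n (brank Eu)" and y: "y \<in> ball_n (brank Es)"
        by auto
      have xE: "x \<in> topspace (Euclidean_space (brank Eu))" and yE: "y \<in> topspace (Euclidean_space (brank Es))"
        using x y ball_n_sub by blast+
      have "q \<in> topspace V"
        using continuous_map_in[OF ce, of "(x, y)"] xE yE q by simp
      moreover have "nu q \<le> 1"
        using u.bnorm_chart[OF U(1) u.chart_inv_over[OF U xE]] u.chart_right[OF U xE] x
        by (simp add: nu_def q ball_n_def)
      moreover have "ns q \<le> 1"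
        using s.bnorm_chart[OF U'(1) s.chart_inv_over[OF U' yE]] s.chart_right[OF U' yE] y
        by (simp add: ns_def q ball_n_def)
      ultimately show "q \<in> Dfib Eu Es \<theta>"
        using u.chart_inv_fiber[OF U xE] s.chart_inv_fiber[OF U' yE] by (simp add: Dfib_def D_eq q)
    qed
    show "Dfib Eu Es \<theta> \<subseteq> ?e ` (ball_n (brank Eu) \<times> ball_n (brank Es))"
    proof
      fix q assume q: "q \<in> Dfib Eu Es \<theta>"
      then have qf: "fst q \<in> bfiber Eu \<theta>" "snd q \<in> bfiber Es \<theta>" and qn: "nu q \<le> 1" "ns q \<le> 1"
        by (auto simp: Dfib_def D_eq)
      have o: "fst q \<in> bover Eu U" "snd q \<in> bover Es U'"
        using u.fiber_over[OF qf(1) U(2)] s.fiber_over[OF qf(2) U'(2)] .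
      have "snd (\<phi> (fst q)) \<in> ball_n (brank Eu)" "snd (\<psi> (snd q)) \<in> ball_n (brank Es)"
        using u.chart_coord[OF U(1) o(1)] u.bnorm_chart[OF U(1) o(1)] qn
          s.chart_coord[OF U'(1) o(2)] s.bnorm_chart[OF U'(1) o(2)]
        by (simp_all add: ball_n_def nu_def ns_def)
      moreover have "q = ?e (snd (\<phi> (fst q)), snd (\<psi> (snd q)))"
        using u.chart_left[OF U(1) o(1)] s.chart_left[OF U'(1) o(2)] qf
        by (simp add: bover_def prod_eq_iff)
      ultimately show "q \<in> ?e ` (ball_n (brank Eu) \<times> ball_n (brank Es))"
        by blast
    qed
  qed
  finally show ?thesis .
qed

theorem infinite_orbit:
  assumes \<theta>: "\<theta> \<in> topspace M"
  shows "\<exists>v\<in>Dfib Eu Es \<theta>. \<forall>m. (f ^^ m) v \<in> D"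
proof -
  let ?X = "subtopology V (Dfib Eu Es \<theta>)"
  have sub: "Dfib Eu Es \<theta> \<subseteq> D"
    by (auto simp: Dfib_def)
  then have top: "topspace ?X = Dfib Eu Es \<theta>"
    using D_sub by auto
  define S where "S = (\<lambda>k. {v \<in> Dfib Eu Es \<theta>. \<forall>i\<le>k. (f ^^ i) v \<in> D})"
  \<comment> \<open>The set \<open>S k\<close> is where the partial map \<open>f_opt ^^ k\<close> is
    defined on the fiber, and domains of such partial maps are closed.\<close>
  have "closedin ?X (S k)" for k
  proof -
    have "pmap ?X (\<lambda>v. Some v)"
      by (rule pmap_Some) (use sub top in \<open>auto simp: continuous_map_from_subtopology[OF continuous_map_id[unfolded id_def]]\<close>)
    then have "closedin ?X (pdom ?X (\<lambda>v. (f_opt ^^ k) (Some v)))"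
      using pmap_f_opt_iterate unfolding pmap_def by blast
    moreover have "pdom ?X (\<lambda>v. (f_opt ^^ k) (Some v)) = S k"
      unfolding pdom_def top S_def using sub by (auto simp: f_opt_orbit subset_iff split: if_splits)
    ultimately show ?thesis
      by simp
  qed
  moreover have "S k \<noteq> {}" for k
    using finite_orbit[OF \<theta>, of k] by (auto simp: S_def)
  moreover have "decseq S"
    by (auto simp: decseq_def S_def)
  moreover have "compact_space ?X"
    using compactin_Dfib[OF \<theta>] compact_space_subtopology by blast
  ultimately have "(\<Inter>k. S k) \<noteq> {}"
    by (intro compact_space_imp_nest)
  then show ?thesis
    by (auto simp: S_def)
qed

end

theorem theorem8:
  fixes n u s :: nat
    and \<Lambda> :: "'a topology" and \<A> :: "'a atlas"
    and Eu :: "('a, 'e) vbundle" and Es :: "('a, 'f) vbundle"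
    and f :: "'e \<times> 'f \<Rightarrow> 'e \<times> 'f"
  assumes "smooth_manifold n \<Lambda> \<A>" and "compact_space \<Lambda>"
    and "smooth_banach_bundle n \<Lambda> \<A> Eu" and "brank Eu = u"
    and "smooth_banach_bundle n \<Lambda> \<A> Es" and "brank Es = s"
    and "continuous_map (subtopology (whitney Eu Es) (Dset Eu Es)) (whitney Eu Es) f"
    and "\<And>\<theta>. \<theta> \<in> topspace \<Lambda> \<Longrightarrow> covers \<Lambda> Eu Es f \<theta>"
  shows "\<forall>\<theta>\<in>topspace \<Lambda>. \<exists>v\<in>Dfib Eu Es \<theta>. \<forall>m::nat. (f ^^ m) v \<in> Dset Eu Es"
proof -
  interpret covering n \<Lambda> \<A> Eu Es f
    using assms by unfold_locales
  show ?thesis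
    using infinite_orbit by blast
qed

end
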